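(* For every connected, non-acyclic finite simple graph $G$, we have $$\operatorname{mcd}(G)=\min_{(C_1,\dots,C_k)}\left\lceil\frac{\sum_{i=1}^k|C_i|}{k}\right\rceil,$$ the minimum being over all partial ear decompositions $(C_1,\dots,C_k)$, $k\geq 1$, of $G$.
   Context: Let $\mathbb{F}$ be an algebraically closed field and $\mathbb{P}^d$ the projective $d$-space over $\mathbb{F}$. Let $G$ be a finite simple graph with vertex set $V$ and edge set $E$. A picture $P$ of $G$ in $\mathbb{P}^d$ consists of a point $P(v)\in\mathbb{P}^d$ for each vertex $v$ and a line $P(e)\subseteq\mathbb{P}^d$ for each edge $e$, such that $P(v)\in P(e)$ whenever $v$ is an endpoint of $e$. The picture space $\mathcal{X}^d(G)$ is the set of all pictures of $G$, regarded as a Zariski-closed (reduced) algebraic subset of the product of $|V|$ copies of $\mathbb{P}^d$ and $|E|$ copies of the Grassmannian of lines in $\mathbb{P}^d$. For a connected non-acyclic graph $G$, the minimum constraint dimension $\operatorname{mcd}(G)$ is the smallest positive integer $d$ for which $\mathcal{X}^d(G)$ is not irreducible. A partial ear decomposition of $G$ is a sequence $(C_1,\dots,C_k)$ of pairwise disjoint edge sets such that, for each $i$, $C_i$ is (the edge set of) an induced cycle of $G/C_1/\cdots/C_{i-1}$. Here $G/C$ denotes contraction of all edges of $C$, keeping any loops and parallel edges that arise; a loop is a cycle of length 1 and a pair of parallel edges is a cycle of length 2; a cycle is called induced if it has no chord, i.e., there is no edge joining two distinct non-consecutive vertices of the cycle. *)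

theory Defs
  imports
    Complex_Main
    "HOL-Library.FuncSet"
    "HOL-Library.Extended_Nat"
    "HOL-Library.Poly_Mapping"
    "HOL-Computational_Algebra.Polynomial"
    "Jordan_Normal_Form.Matrix"
begin

section \<open>Graphs, contraction and partial ear decompositions\<close>

definition simple_graph :: "'v set \<Rightarrow> 'v set set \<Rightarrow> bool" where
  "simple_graph V E \<longleftrightarrow> finite V \<and> E \<subseteq> {{u, v} |u v. u \<in> V \<and> v \<in> V \<and> u \<noteq> v}"

text \<open>Loops are the edges whose set of ends is a singleton; parallel edges are distinct
  elements of \<open>edges\<close> with the same set of ends.\<close>

record ('a, 'e) multigraph =
  verts :: "'a set"
  edges :: "'e set"
  ends :: "'e \<Rightarrow> 'a set"

text \<open>The reflexive transitive closure of adjacency through an edge of \<open>C\<close>.\<close>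

definition linked :: "('a, 'e) multigraph \<Rightarrow> 'e set \<Rightarrow> ('a \<times> 'a) set" where
  "linked H C = {(x, y). \<exists>e\<in>C. ends H e = {x, y}}\<^sup>*"

definition connected_graph :: "('a, 'e) multigraph \<Rightarrow> bool" where
  "connected_graph H \<longleftrightarrow>
     verts H \<noteq> {} \<and> (\<forall>x\<in>verts H. \<forall>y\<in>verts H. (x, y) \<in> linked H (edges H))"

text \<open>A cycle of length \<open>n \<ge> 1\<close> with vertices \<open>x 0, \<dots>, x (n - 1)\<close> in cyclic order; for
  \<open>n = 1\<close> it is a loop and for \<open>n = 2\<close> a pair of parallel edges.\<close>

definition cycle_through ::
    "('a, 'e) multigraph \<Rightarrow> nat \<Rightarrow> (nat \<Rightarrow> 'a) \<Rightarrow> (nat \<Rightarrow> 'e) \<Rightarrow> bool" where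
  "cycle_through H n x e \<longleftrightarrow> 1 \<le> n \<and>
     inj_on x {..<n} \<and> x ` {..<n} \<subseteq> verts H \<and>
     inj_on e {..<n} \<and> e ` {..<n} \<subseteq> edges H \<and>
     (\<forall>i<n. ends H (e i) = {x i, x (Suc i mod n)})"

definition is_cycle :: "('a, 'e) multigraph \<Rightarrow> 'e set \<Rightarrow> bool" where
  "is_cycle H C \<longleftrightarrow> (\<exists>n x e. cycle_through H n x e \<and> C = e ` {..<n})"

definition acyclic_graph :: "('a, 'e) multigraph \<Rightarrow> bool" where
  "acyclic_graph H \<longleftrightarrow> (\<nexists>C. is_cycle H C)"

definition has_chord :: "('a, 'e) multigraph \<Rightarrow> nat \<Rightarrow> (nat \<Rightarrow> 'a) \<Rightarrow> bool" where
  "has_chord H n x \<longleftrightarrow>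
     (\<exists>i<n. \<exists>j<n. i \<noteq> j \<and> j \<noteq> Suc i mod n \<and> i \<noteq> Suc j mod n \<and>
        (\<exists>f\<in>edges H. ends H f = {x i, x j}))"

definition induced_cycle :: "('a, 'e) multigraph \<Rightarrow> 'e set \<Rightarrow> bool" where
  "induced_cycle H C \<longleftrightarrow>
     (\<exists>n x e. cycle_through H n x e \<and> C = e ` {..<n} \<and> \<not> has_chord H n x)"

text \<open>To iterate contraction within a single type, vertices of contracted graphs are branch
  sets, i.e. pairwise disjoint sets of original vertices; contracting \<open>C\<close> deletes the edges of
  \<open>C\<close> and replaces each class of \<open>C\<close>-linked vertices by its union.\<close>

definition merge :: "('v set, 'e) multigraph \<Rightarrow> 'e set \<Rightarrow> 'v set \<Rightarrow> 'v set" where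
  "merge H C X = \<Union> (linked H C `` {X})"

definition contract :: "('v set, 'e) multigraph \<Rightarrow> 'e set \<Rightarrow> ('v set, 'e) multigraph" where
  "contract H C =
     \<lparr>verts = merge H C ` verts H, edges = edges H - C, ends = (\<lambda>e. merge H C ` ends H e)\<rparr>"

definition graph_of :: "'v set \<Rightarrow> 'v set set \<Rightarrow> ('v, 'v set) multigraph" where
  "graph_of V E = \<lparr>verts = V, edges = E, ends = (\<lambda>e. e)\<rparr>"

definition branch_graph_of :: "'v set \<Rightarrow> 'v set set \<Rightarrow> ('v set, 'v set) multigraph" where
  "branch_graph_of V E =
     \<lparr>verts = (\<lambda>v. {v}) ` V, edges = E, ends = (\<lambda>e. (\<lambda>v. {v}) ` e)\<rparr>"

definition partial_ear_decomposition :: "'v set \<Rightarrow> 'v set set \<Rightarrow> 'v set set list \<Rightarrow> bool" where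
  "partial_ear_decomposition V E Cs \<longleftrightarrow>
     (\<forall>i<length Cs. \<forall>j<length Cs. i \<noteq> j \<longrightarrow> Cs ! i \<inter> Cs ! j = {}) \<and>
     (\<forall>i<length Cs. induced_cycle (foldl contract (branch_graph_of V E) (take i Cs)) (Cs ! i))"

section \<open>Points and lines of projective space\<close>

text \<open>A point of projective \<open>d\<close>-space is a one-dimensional subspace of the space of vectors of
  dimension \<open>d + 1\<close>; a line is the set of points on it.\<close>

definition proj_point :: "'a::field vec \<Rightarrow> 'a vec set" where
  "proj_point x = range (\<lambda>c. c \<cdot>\<^sub>v x)"

definition homog_vecs :: "nat \<Rightarrow> 'a::field vec set" where
  "homog_vecs d = carrier_vec (Suc d) - {0\<^sub>v (Suc d)}"

definition proj_space :: "nat \<Rightarrow> 'a::field vec set set" where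
  "proj_space d = proj_point ` homog_vecs d"

definition proj_line :: "nat \<Rightarrow> 'a::field vec \<Rightarrow> 'a vec \<Rightarrow> 'a vec set set" where
  "proj_line d x y =
     {proj_point (a \<cdot>\<^sub>v x + b \<cdot>\<^sub>v y) |a b. a \<cdot>\<^sub>v x + b \<cdot>\<^sub>v y \<in> homog_vecs d}"

definition proj_lines :: "nat \<Rightarrow> 'a::field vec set set set" where
  "proj_lines d =
     {proj_line d x y |x y. x \<in> homog_vecs d \<and> y \<in> homog_vecs d \<and> proj_point x \<noteq> proj_point y}"

section \<open>The Zariski topology on a product of projective spaces and Grassmannians\<close>

text \<open>Homogeneous coordinates on the \<open>V\<close>-fold product of projective \<open>d\<close>-space and the
  \<open>E\<close>-fold product of the Grassmannian of its lines, the latter in its Pluecker embedding: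
  \<open>Line_Coord e i j\<close> with \<open>i < j\<close> is the Pluecker coordinate with indices \<open>i\<close>, \<open>j\<close> of the line
  at \<open>e\<close>.\<close>

datatype ('v, 'e) coord = Point_Coord 'v nat | Line_Coord 'e nat nat

type_synonym ('v, 'e, 'a) coord_poly = "(('v, 'e) coord \<Rightarrow>\<^sub>0 nat) \<Rightarrow>\<^sub>0 'a"

definition point_coords :: "nat \<Rightarrow> 'v \<Rightarrow> ('v, 'e) coord set" where
  "point_coords d v = {Point_Coord v i |i. i \<le> d}"

definition line_coords :: "nat \<Rightarrow> 'e \<Rightarrow> ('v, 'e) coord set" where
  "line_coords d e = {Line_Coord e i j |i j. i < j \<and> j \<le> d}"

definition poly_vars :: "('v, 'e, 'a::zero) coord_poly \<Rightarrow> ('v, 'e) coord set" where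
  "poly_vars p = (\<Union>m\<in>Poly_Mapping.keys p. Poly_Mapping.keys m)"

definition eval_poly ::
    "('v, 'e, 'a::comm_semiring_1) coord_poly \<Rightarrow> (('v, 'e) coord \<Rightarrow> 'a) \<Rightarrow> 'a" where
  "eval_poly p \<phi> =
     (\<Sum>m\<in>Poly_Mapping.keys p. Poly_Mapping.lookup p m *
        (\<Prod>z\<in>Poly_Mapping.keys m. \<phi> z ^ Poly_Mapping.lookup m z))"

definition homogeneous_in :: "('v, 'e) coord set \<Rightarrow> ('v, 'e, 'a::zero) coord_poly \<Rightarrow> bool" where
  "homogeneous_in K p \<longleftrightarrow>
     (\<exists>n. \<forall>m\<in>Poly_Mapping.keys p.
        (\<Sum>z\<in>Poly_Mapping.keys m \<inter> K. Poly_Mapping.lookup m z) = n)"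

definition multihomogeneous ::
    "nat \<Rightarrow> 'v set \<Rightarrow> 'e set \<Rightarrow> ('v, 'e, 'a::zero) coord_poly \<Rightarrow> bool" where
  "multihomogeneous d V E p \<longleftrightarrow>
     poly_vars p \<subseteq> (\<Union>v\<in>V. point_coords d v) \<union> (\<Union>e\<in>E. line_coords d e) \<and>
     (\<forall>v\<in>V. homogeneous_in (point_coords d v) p) \<and>
     (\<forall>e\<in>E. homogeneous_in (line_coords d e) p)"

type_synonym ('v, 'e, 'a) configuration = "('v \<Rightarrow> 'a vec set) \<times> ('e \<Rightarrow> 'a vec set set)"

definition configurations ::
    "nat \<Rightarrow> 'v set \<Rightarrow> 'e set \<Rightarrow> ('v, 'e, 'a::field) configuration set" where
  "configurations d V E = (V \<rightarrow>\<^sub>E proj_space d) \<times> (E \<rightarrow>\<^sub>E proj_lines d)"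

definition homog_coords_of ::
    "nat \<Rightarrow> 'v set \<Rightarrow> 'e set \<Rightarrow> ('v, 'e, 'a::field) configuration \<Rightarrow>
      (('v, 'e) coord \<Rightarrow> 'a) \<Rightarrow> bool" where
  "homog_coords_of d V E P \<phi> \<longleftrightarrow>
     (\<forall>v\<in>V. vec (Suc d) (\<lambda>i. \<phi> (Point_Coord v i)) \<in> homog_vecs d \<and>
        fst P v = proj_point (vec (Suc d) (\<lambda>i. \<phi> (Point_Coord v i)))) \<and>
     (\<forall>e\<in>E. \<exists>x\<in>homog_vecs d. \<exists>y\<in>homog_vecs d.
        proj_point x \<noteq> proj_point y \<and> snd P e = proj_line d x y \<and>
        (\<forall>j\<le>d. \<forall>i<j. \<phi> (Line_Coord e i j) = x $ i * y $ j - x $ j * y $ i))"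

text \<open>For multihomogeneous \<open>p\<close> vanishing does not depend on the choice of homogeneous
  coordinates \<open>\<phi>\<close>.\<close>

definition zero_locus ::
    "nat \<Rightarrow> 'v set \<Rightarrow> 'e set \<Rightarrow> ('v, 'e, 'a::field) coord_poly set \<Rightarrow>
      ('v, 'e, 'a) configuration set" where
  "zero_locus d V E S =
     {P \<in> configurations d V E.
        \<forall>p\<in>S. \<forall>\<phi>. homog_coords_of d V E P \<phi> \<longrightarrow> eval_poly p \<phi> = 0}"

definition zariski_closed ::
    "nat \<Rightarrow> 'v set \<Rightarrow> 'e set \<Rightarrow> ('v, 'e, 'a::field) configuration set \<Rightarrow> bool" where
  "zariski_closed d V E A \<longleftrightarrow>
     (\<exists>S. (\<forall>p\<in>S. multihomogeneous d V E p) \<and> A = zero_locus d V E S)"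

text \<open>Irreducibility of \<open>X\<close> in the topology induced from the ambient product.\<close>

definition zariski_irreducible ::
    "nat \<Rightarrow> 'v set \<Rightarrow> 'e set \<Rightarrow> ('v, 'e, 'a::field) configuration set \<Rightarrow> bool" where
  "zariski_irreducible d V E X \<longleftrightarrow> X \<noteq> {} \<and>
     (\<forall>A B. zariski_closed d V E A \<and> zariski_closed d V E B \<and> X \<subseteq> A \<union> B
        \<longrightarrow> X \<subseteq> A \<or> X \<subseteq> B)"

section \<open>Picture spaces and the minimum constraint dimension\<close>

definition picture_space ::
    "nat \<Rightarrow> 'v set \<Rightarrow> 'v set set \<Rightarrow> ('v, 'v set, 'a::field) configuration set" where
  "picture_space d V E =
     {P \<in> configurations d V E. \<forall>e\<in>E. \<forall>v\<in>e. fst P v \<in> snd P e}"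

text \<open>The value is \<open>\<infinity>\<close> if all picture spaces are irreducible, so that an equation with a finite
  right-hand side includes the existence of a dimension with reducible picture space.\<close>

definition mcd :: "'a::field itself \<Rightarrow> 'v set \<Rightarrow> 'v set set \<Rightarrow> enat" where
  "mcd _ V E =
     Inf {enat d |d. 0 < d \<and>
       \<not> zariski_irreducible d V E (picture_space d V E :: ('v, 'v set, 'a) configuration set)}"

end

theory Submission
  imports Defs "Jordan_Normal_Form.Determinant"
begin

text \<open>Let \<open>n(F)\<close> denote the nullity \<open>|F| - |V| + c(F)\<close> of an edge set \<open>F\<close>.  Both sides of the
  equation are the least \<open>d > 0\<close> for which some nonempty \<open>F\<close> satisfies \<open>|F| \<le> d n(F)\<close>.

  Contracting an ear raises the nullity of the contracted edges by one, so the union of \<open>k\<close> ears has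
  nullity \<open>k\<close>; conversely, a largest \<open>F\<close> with \<open>|F| \<le> d n(F)\<close> contains every edge joining two of
  its linked vertices, and therefore shortest cycles inside \<open>F\<close> are induced and can be contracted
  one by one.

  If \<open>|F| > d n(F)\<close> for all nonempty \<open>F\<close>, then in every picture with a nonempty set \<open>F\<close> of
  collapsed edges the ends of these edges can be moved along the lines at them, since this is a
  homogeneous linear system with more unknowns than equations.  Hence every picture is a limit, along
  a curve, of pictures with fewer collapsed edges, and the pictures without collapsed edges are
  parametrised by an open subset of an affine space.

  If \<open>F\<close> is minimal with \<open>|F| \<le> d n(F)\<close>, then by Rado's theorem \<open>F\<close> has a colouring with \<open>d\<close>
  colours such that the ends of each edge are linked by edges of other colours.  It yields a square
  system of linear equations for the positions of the vertices given the directions of the lines; its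
  determinant vanishes as soon as some edge of \<open>F\<close> is not collapsed, but not identically.\<close>

subsection \<open>Components of an edge set\<close>

text \<open>No dimension theory of varieties enters. Limits are replaced by an identity argument:
  along a curve the homogeneous coordinates of a picture are polynomials in the parameter, so a
  multihomogeneous polynomial that vanishes at all but finitely many parameters vanishes at all of
  them. This dictates the shape of every curve: its point and Pluecker coordinates have to be
  polynomial and have to coincide, at the end in question, with coordinates fixed in advance, scalar
  factors included. Reducibility is shown by two closed sets: the pictures with all of F collapsed,
  and the zeros of the determinant times the product of the point coordinates with index 0, so that
  pictures leaving the affine chart fall into the second set. The colours serve to show that the
  determinant is not identically zero: each edge e gets a cycle whose other edges have other
  colours, and laying each line along the axis of its colour makes the matrix the identity.
  Minimality of F yields Rado's condition |S| \<le> d (n(F) - n(F - S)): subtract d n(F - S) \<le>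
  |F - S| from |F| \<le> d n(F).\<close>

definition reach :: "'v set set \<Rightarrow> ('v \<times> 'v) set" where
  "reach F = {(x, y). {x, y} \<in> F}\<^sup>*"

lemma reach_refl [simp]: "(x, x) \<in> reach F"
  by (simp add: reach_def)

lemma reach_edge: "{x, y} \<in> F \<Longrightarrow> (x, y) \<in> reach F"
  by (auto simp: reach_def)

lemma reach_trans: "(x, y) \<in> reach F \<Longrightarrow> (y, z) \<in> reach F \<Longrightarrow> (x, z) \<in> reach F"
  by (auto simp: reach_def)

lemma reach_sym: "(x, y) \<in> reach F \<Longrightarrow> (y, x) \<in> reach F"
proof -
  have "sym ({(x, y). {x, y} \<in> F}\<^sup>*)"
    by (rule sym_rtrancl) (auto simp: sym_def insert_commute)
  then show "(x, y) \<in> reach F \<Longrightarrow> (y, x) \<in> reach F"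
    by (auto simp: reach_def dest: symD)
qed

text \<open>\<open>reach\<close> lives on the whole type, so its classes need no side conditions;
  the vertex set enters only when the classes are counted.\<close>

lemma equiv_reach: "equiv UNIV (reach F)"
  by (auto intro!: equivI refl_onI symI transI intro: reach_sym reach_trans)

lemma reach_mono: "F \<subseteq> F' \<Longrightarrow> (x, y) \<in> reach F \<Longrightarrow> (x, y) \<in> reach F'"
  unfolding reach_def by (rule rtrancl_mono[THEN subsetD, rotated]) auto

lemma reach_class_eq_iff: "reach F `` {x} = reach F `` {y} \<longleftrightarrow> (x, y) \<in> reach F"
  using eq_equiv_class_iff[OF equiv_reach, of x y F] by simp

lemma reach_subset_reach:
  assumes "\<And>x y. {x, y} \<in> F \<Longrightarrow> (x, y) \<in> reach F'"
  shows "(x, y) \<in> reach F \<Longrightarrow> (x, y) \<in> reach F'"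
  unfolding reach_def[of F]
  by (induction rule: rtrancl_induct) (auto intro: reach_trans assms)

lemma reach_insert_reachable:
  assumes "(a, b) \<in> reach F"
  shows "reach (insert {a, b} F) = reach F"
proof (rule equalityI; rule subrelI)
  fix x y
  show "(x, y) \<in> reach F" if "(x, y) \<in> reach (insert {a, b} F)"
    using that
    by (rule reach_subset_reach[rotated])
      (use assms in \<open>auto simp: doubleton_eq_iff intro: reach_edge reach_sym\<close>)
  show "(x, y) \<in> reach (insert {a, b} F)" if "(x, y) \<in> reach F"
    using that by (rule reach_mono[rotated]) auto
qed

text \<open>The right-hand side contains \<open>v\<close> and is closed under all edges of the
  enlarged set, so no walk from \<open>v\<close> leaves it; the converse goes through the new
  edge.\<close>

lemma reach_insert_class:
  "reach (insert {a, b} F) `` {v} =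
     (if (v, a) \<in> reach F \<or> (v, b) \<in> reach F then reach F `` {a} \<union> reach F `` {b}
      else reach F `` {v})"
proof -
  let ?D = "\<lambda>v. if (v, a) \<in> reach F \<or> (v, b) \<in> reach F then reach F `` {a} \<union> reach F `` {b}
      else reach F `` {v}"
  have closed: "y \<in> ?D v" if "x \<in> ?D v" "{x, y} \<in> insert {a, b} F" for x y
    using that by (auto simp: doubleton_eq_iff split: if_splits
        intro: reach_trans reach_edge dest: reach_sym)
  have "y \<in> ?D v" if "(v, y) \<in> {(x, y). {x, y} \<in> insert {a, b} F}\<^sup>*" for y
    using that
  proof (induction rule: rtrancl_induct)
    case base
    then show ?case by (auto dest: reach_sym)
  next
    case (step y z)
    then show ?case using closed[of y z] by blast
  qed
  then have 1: "reach (insert {a, b} F) `` {v} \<subseteq> ?D v"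
    unfolding reach_def[of "insert {a, b} F"] by blast
  have m: "(x, y) \<in> reach F \<Longrightarrow> (x, y) \<in> reach (insert {a, b} F)" for x y
    by (rule reach_mono) auto
  have ab: "(a, b) \<in> reach (insert {a, b} F)" by (rule reach_edge) auto
  have "?D v \<subseteq> reach (insert {a, b} F) `` {v}"
    using ab reach_sym[OF ab] by (auto split: if_splits intro: reach_trans dest: m)
  then show ?thesis using 1 by blast
qed

definition comps :: "'v set \<Rightarrow> 'v set set \<Rightarrow> nat" where
  "comps V F = card (V // reach F)"

lemma quotient_eq_image: "V // R = (\<lambda>v. R `` {v}) ` V"
  by (auto simp: quotient_def)

lemma comps_insert_reachable: "(a, b) \<in> reach F \<Longrightarrow> comps V (insert {a, b} F) = comps V F"
  by (simp add: comps_def reach_insert_reachable)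

text \<open>Exactly two classes disappear and one appears: their union is no class of
  \<open>F\<close>, as it would link \<open>a\<close> to \<open>b\<close>.\<close>

lemma comps_insert_unreachable:
  assumes V: "finite V" "a \<in> V" "b \<in> V" and ab: "(a, b) \<notin> reach F"
  shows "Suc (comps V (insert {a, b} F)) = comps V F"
proof -
  let ?A = "reach F `` {a}" and ?B = "reach F `` {b}"
  let ?Q = "V // reach F"
  have ne: "?A \<noteq> ?B" using ab by (simp add: reach_class_eq_iff)
  have in_Q: "?A \<in> ?Q" "?B \<in> ?Q" using V by (auto simp: quotient_eq_image)
  have out: "?A \<union> ?B \<notin> ?Q"
  proof
    assume "?A \<union> ?B \<in> ?Q"
    then obtain v where v: "reach F `` {v} = ?A \<union> ?B" by (auto simp: quotient_eq_image)
    have "a \<in> reach F `` {v}" "b \<in> reach F `` {v}" unfolding v by simp_all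
    then have "(v, a) \<in> reach F" "(v, b) \<in> reach F" by blast+
    then show False using ab reach_sym reach_trans by metis
  qed
  have "V // reach (insert {a, b} F) = insert (?A \<union> ?B) (?Q - {?A, ?B})"
  proof -
    have *: "(v, a) \<in> reach F \<longleftrightarrow> reach F `` {v} = ?A" "(v, b) \<in> reach F \<longleftrightarrow> reach F `` {v} = ?B" for v
      by (simp_all add: reach_class_eq_iff)
    show ?thesis
      unfolding quotient_eq_image reach_insert_class * using V by (auto simp: image_iff)
  qed
  moreover have "finite ?Q" using V by (simp add: quotient_eq_image)
  moreover have "card {?A, ?B} = 2" using ne by simp
  moreover have "card {?A, ?B} \<le> card ?Q"
    using in_Q \<open>finite ?Q\<close> by (intro card_mono) auto
  ultimately show ?thesis
    unfolding comps_def using in_Q out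
    by (simp add: card_Diff_subset)
qed

lemma comps_insert_le:
  assumes "finite V" "a \<in> V" "b \<in> V"
  shows "comps V (insert {a, b} F) \<le> comps V F" "comps V F \<le> Suc (comps V (insert {a, b} F))"
  using comps_insert_reachable[of a b F V] comps_insert_unreachable[OF assms, of F] by linarith+

lemma comps_empty: "comps (V :: 'v set) {} = card V"
proof -
  have "reach {} = (Id :: ('v \<times> 'v) set)" by (auto simp: reach_def)
  then have "V // reach {} = (\<lambda>v. {v}) ` V" by (auto simp: quotient_eq_image)
  then show ?thesis unfolding comps_def by (simp add: card_image)
qed

definition edge_set :: "'v set \<Rightarrow> 'v set set \<Rightarrow> bool" where
  "edge_set V F \<longleftrightarrow> (\<forall>e\<in>F. \<exists>a\<in>V. \<exists>b\<in>V. e = {a, b} \<and> a \<noteq> b)"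

lemma edge_set_subset: "edge_set V F \<Longrightarrow> F' \<subseteq> F \<Longrightarrow> edge_set V F'"
  by (auto simp: edge_set_def)

lemma edge_set_finite: "edge_set V F \<Longrightarrow> finite V \<Longrightarrow> finite F"
  by (rule finite_subset[of _ "Pow V"]) (auto simp: edge_set_def)

lemma edge_setE:
  assumes "edge_set V F" "e \<in> F"
  obtains a b where "a \<in> V" "b \<in> V" "e = {a, b}" "a \<noteq> b"
  using assms by (auto simp: edge_set_def)

lemma simple_graph_edge_set: "simple_graph V E \<Longrightarrow> edge_set V E"
  by (fastforce simp: simple_graph_def edge_set_def)

text \<open>Diminishing returns: an edge that joins two components of a larger edge set also joins
  two components of a smaller one.\<close>

lemma comps_diminishing:
  assumes "finite V" "finite X" "edge_set V X" "A' \<subseteq> A"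
  shows "comps V (A' \<union> X) + comps V A \<le> comps V (A \<union> X) + comps V A'"
  using assms(2,3)
proof (induction X rule: finite_induct)
  case empty
  then show ?case by simp
next
  case (insert e X)
  obtain a b where ab: "a \<in> V" "b \<in> V" "e = {a, b}"
    using insert.prems by (auto simp: edge_set_def)
  have IH: "comps V (A' \<union> X) + comps V A \<le> comps V (A \<union> X) + comps V A'"
    using insert.IH insert.prems by (simp add: edge_set_def)
  have "comps V (insert e (A' \<union> X)) + comps V (A \<union> X) \<le> comps V (insert e (A \<union> X)) + comps V (A' \<union> X)"
  proof (cases "(a, b) \<in> reach (A' \<union> X)")
    case True
    then have "(a, b) \<in> reach (A \<union> X)" by (rule reach_mono[rotated]) (use assms in auto)
    then show ?thesis using True ab by (simp add: comps_insert_reachable)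
  next
    case False
    have "Suc (comps V (insert e (A' \<union> X))) = comps V (A' \<union> X)"
      using comps_insert_unreachable[OF assms(1) _ _ False] ab by simp
    moreover have "comps V (A \<union> X) \<le> Suc (comps V (insert e (A \<union> X)))"
      using comps_insert_le(2)[OF assms(1) ab(1,2)] ab by simp
    ultimately show ?thesis by linarith
  qed
  then show ?case using IH by simp
qed

text \<open>Diminishing returns with base sets \<open>A \<inter> B\<close> and \<open>A\<close> and
  added set \<open>B\<close>.\<close>

lemma comps_supermodular:
  assumes "finite V" "edge_set V B"
  shows "comps V A + comps V B \<le> comps V (A \<union> B) + comps V (A \<inter> B)"
  using comps_diminishing[OF assms(1) edge_set_finite[OF assms(2,1)] assms(2), of "A \<inter> B" A]
  by (simp add: Un_absorb1 add.commute)

lemma comps_Un_le: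
  assumes "finite V" "edge_set V X"
  shows "comps V A \<le> comps V (A \<union> X) + card X"
  using edge_set_finite[OF assms(2,1)] assms(2)
proof (induction X rule: finite_induct)
  case empty
  then show ?case by simp
next
  case (insert e X)
  obtain a b where ab: "a \<in> V" "b \<in> V" "e = {a, b}"
    using insert.prems by (auto simp: edge_set_def)
  have "comps V A \<le> comps V (A \<union> X) + card X"
    using insert.IH insert.prems by (simp add: edge_set_def)
  moreover have "comps V (A \<union> X) \<le> Suc (comps V (insert e (A \<union> X)))"
    using comps_insert_le(2)[OF assms(1) ab(1,2)] ab by simp
  ultimately show ?case using insert.hyps by simp
qed

text \<open>For edges on \<open>V\<close> this is the first Betti number, the rank of the cycle
  space. It is an integer because the subtraction would be truncated on natural numbers.\<close>

definition nullity :: "'v set \<Rightarrow> 'v set set \<Rightarrow> int" where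
  "nullity V F = int (card F) + int (comps V F) - int (card V)"

lemma nullity_empty: "nullity V {} = 0"
  by (simp add: nullity_def comps_empty)

lemma nullity_insert_reachable:
  "finite F \<Longrightarrow> (a, b) \<in> reach F \<Longrightarrow> {a, b} \<notin> F \<Longrightarrow> nullity V (insert {a, b} F) = nullity V F + 1"
  by (simp add: nullity_def comps_insert_reachable)

lemma nullity_insert_unreachable:
  assumes "finite V" "a \<in> V" "b \<in> V" "(a, b) \<notin> reach F" "finite F"
  shows "nullity V (insert {a, b} F) = nullity V F"
proof -
  have "{a, b} \<notin> F" using assms(4) reach_edge[of a b F] by auto
  then show ?thesis using comps_insert_unreachable[OF assms(1-4)] assms(5) by (simp add: nullity_def)
qed

lemma nullity_supermodular:
  assumes "finite V" "edge_set V A" "edge_set V B"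
  shows "nullity V A + nullity V B \<le> nullity V (A \<union> B) + nullity V (A \<inter> B)"
  using comps_supermodular[OF assms(1,3), of A]
    card_Un_Int[of A B] edge_set_finite[OF assms(2,1)] edge_set_finite[OF assms(3,1)]
  by (simp add: nullity_def)

text \<open>Removing an edge lowers the cardinality by one and raises the number of components by at
  most one.\<close>

lemma nullity_mono:
  assumes "finite V" "edge_set V B" "A \<subseteq> B"
  shows "nullity V A \<le> nullity V B"
proof -
  have fin: "finite B" using assms edge_set_finite by blast
  then have "card (B - A) = card B - card A" "card A \<le> card B" 
    using assms by (auto simp: card_Diff_subset finite_subset card_mono)
  moreover have "comps V A \<le> comps V B + card (B - A)"
    using comps_Un_le[OF assms(1) edge_set_subset[OF assms(2)], of "B - A" A] assms(3)
    by (simp add: Un_absorb1)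
  ultimately show ?thesis by (simp add: nullity_def)
qed

lemma comps_antimono:
  assumes "finite V" "edge_set V B" "A \<subseteq> B"
  shows "comps V B \<le> comps V A"
proof -
  have "comps V (A \<union> X) \<le> comps V A" if "finite X" "edge_set V X" for X
    using that
  proof (induction X rule: finite_induct)
    case (insert e X)
    obtain a b where ab: "a \<in> V" "b \<in> V" "e = {a, b}"
      using insert.prems by (auto simp: edge_set_def)
    have "comps V (A \<union> X) \<le> comps V A"
      using insert.IH insert.prems by (simp add: edge_set_def)
    moreover have "comps V (insert e (A \<union> X)) \<le> comps V (A \<union> X)"
      using comps_insert_le(1)[OF assms(1) ab(1,2)] ab by simp
    ultimately show ?case by simp
  qed simp
  from this[of B] show ?thesis
    using assms edge_set_finite[OF assms(2,1)] by (simp add: Un_absorb1)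
qed

subsection \<open>Rado's theorem and edge colourings\<close>

text \<open>Shrink a set \<open>A i\<close> with at least two elements: by submodularity the Hall condition cannot
  fail for both removals.\<close>

lemma rado_transversal:
  fixes f :: "'b set \<Rightarrow> int" and A :: "'i \<Rightarrow> 'b set"
  assumes "finite I"
    and submod: "\<And>X Y. f (X \<union> Y) + f (X \<inter> Y) \<le> f X + f Y"
    and mono: "\<And>X Y. X \<subseteq> Y \<Longrightarrow> f X \<le> f Y"
    and empty: "f {} \<le> 0"
    and "\<And>i. i \<in> I \<Longrightarrow> finite (A i)"
    and "\<And>S. S \<subseteq> I \<Longrightarrow> int (card S) \<le> f (\<Union>i\<in>S. A i)"
  shows "\<exists>t. (\<forall>i\<in>I. t i \<in> A i) \<and> (\<forall>S\<subseteq>I. int (card S) \<le> f (t ` S))"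
  using assms(5,6)
proof (induction "\<Sum>i\<in>I. card (A i)" arbitrary: A rule: less_induct)
  case (less A)
  show ?case
  proof (cases "\<exists>i\<in>I. \<exists>x\<in>A i. \<exists>y\<in>A i. x \<noteq> y")
    case False
    \<comment> \<open>The Hall condition for a single index asks for \<open>f (A i) \<ge> 1\<close>,
      which excludes the empty set.\<close>
    have "\<exists>x. x \<in> A i" if "i \<in> I" for i
      using less.prems(2)[of "{i}"] that empty by (cases "A i = {}") auto
    then obtain t where t: "t i \<in> A i" if "i \<in> I" for i by metis
    have "A i = {t i}" if "i \<in> I" for i using False t that by blast
    then have "(\<Union>i\<in>S. A i) = t ` S" if "S \<subseteq> I" for S using that by blast
    then show ?thesis using t less.prems(2) by (intro exI[of _ t]) auto
  next
    case True
    then obtain i0 x y where xy: "i0 \<in> I" "x \<in> A i0" "y \<in> A i0" "x \<noteq> y" by blast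
    define B where "B z = A(i0 := A i0 - {z})" for z
    have small: "(\<Sum>i\<in>I. card (B z i)) < (\<Sum>i\<in>I. card (A i))" if "z \<in> A i0" for z
    proof (rule sum_strict_mono_ex1)
      show "\<forall>i\<in>I. card (B z i) \<le> card (A i)"
        using less.prems(1) by (auto simp: B_def intro!: card_mono)
      have "card (A i0 - {z}) < card (A i0)"
        using that less.prems(1)[OF xy(1)] by (intro psubset_card_mono) auto
      then show "\<exists>i\<in>I. card (B z i) < card (A i)"
        using xy(1) by (intro bexI[of _ i0]) (auto simp: B_def)
    qed (fact assms(1))
    have sub: "B z i \<subseteq> A i" for z i by (auto simp: B_def)
    have fin: "finite (B z i)" if "i \<in> I" for z i
      using less.prems(1)[OF that] sub finite_subset by blast
    have step: ?thesis if "z \<in> A i0" "\<And>S. S \<subseteq> I \<Longrightarrow> int (card S) \<le> f (\<Union>i\<in>S. B z i)" for z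
      using less.hyps[OF small[OF that(1)] fin that(2)] sub by blast
    show ?thesis
    proof (rule ccontr)
      assume neg: "\<not> ?thesis"
      obtain S1 where S1: "S1 \<subseteq> I" "f (\<Union>i\<in>S1. B x i) < int (card S1)"
        using step[of x] xy neg not_le by metis
      obtain S2 where S2: "S2 \<subseteq> I" "f (\<Union>i\<in>S2. B y i) < int (card S2)"
        using step[of y] xy neg not_le by metis
      \<comment> \<open>Away from \<open>i0\<close> the shrunken family is the old one, so a
        violation has to involve \<open>i0\<close>.\<close>
      have mem: "i0 \<in> S" if "S \<subseteq> I" "f (\<Union>i\<in>S. B z i) < int (card S)" for S z
      proof (rule ccontr)
        assume "i0 \<notin> S"
        then have "(\<Union>i\<in>S. B z i) = (\<Union>i\<in>S. A i)" by (intro SUP_cong) (auto simp: B_def)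
        then show False using less.prems(2)[OF that(1)] that(2) by simp
      qed
      have i0: "i0 \<in> S1" "i0 \<in> S2" using mem S1 S2 by auto
      let ?X = "\<Union>i\<in>S1. B x i" and ?Y = "\<Union>i\<in>S2. B y i"
      \<comment> \<open>As \<open>x \<noteq> y\<close>, each element of \<open>A i0\<close> survives
        one of the two removals.\<close>
      have "?X \<union> ?Y = (\<Union>i\<in>S1 \<union> S2. A i)"
      proof
        show "?X \<union> ?Y \<subseteq> (\<Union>i\<in>S1 \<union> S2. A i)" using sub by blast
        show "(\<Union>i\<in>S1 \<union> S2. A i) \<subseteq> ?X \<union> ?Y"
          using i0 xy(4) by (fastforce simp: B_def split: if_splits)
      qed
      then have 1: "int (card (S1 \<union> S2)) \<le> f (?X \<union> ?Y)"
        using less.prems(2)[of "S1 \<union> S2"] S1 S2 by simp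
      \<comment> \<open>Dropping \<open>i0\<close> costs one in the Hall bound, whereas the two
        strict integer violations cost two; this gives the contradiction with submodularity.\<close>
      have "(\<Union>i\<in>S1 \<inter> S2 - {i0}. A i) \<subseteq> ?X \<inter> ?Y"
        by (auto simp: B_def)
      then have 2: "int (card (S1 \<inter> S2 - {i0})) \<le> f (?X \<inter> ?Y)"
        using less.prems(2)[of "S1 \<inter> S2 - {i0}"] S1 mono by (meson Diff_subset inf.coboundedI1 order_trans)
      have fins: "finite S1" "finite S2" using S1 S2 assms(1) finite_subset by blast+
      have "card (S1 \<inter> S2) = Suc (card (S1 \<inter> S2 - {i0}))"
        using card_Suc_Diff1[of "S1 \<inter> S2" i0] i0 fins by simp
      then show False
        using 1 2 submod[of ?X ?Y] S1(2) S2(2) card_Un_Int[OF fins] by linarith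
    qed
  qed
qed

text \<open>Apply Rado's theorem to the sum of \<open>d\<close> copies of the cographic rank function
  \<open>S \<mapsto> nullity F - nullity (F - S)\<close>: it partitions \<open>F\<close> into \<open>d\<close> sets whose removal does not
  disconnect any component.\<close>

lemma coconnected_colouring:
  assumes V: "finite V" and F: "edge_set V F"
    and dense: "int (card F) \<le> int d * nullity V F"
    and sparse: "\<And>T. T \<subset> F \<Longrightarrow> int d * nullity V T \<le> int (card T)"
  shows "\<exists>colour. \<forall>e\<in>F. colour e < d \<and> (\<forall>a b. e = {a, b} \<longrightarrow> (a, b) \<in> reach {f \<in> F. colour f \<noteq> colour e})"
proof -
  have finF: "finite F" using V F edge_set_finite by blast
  have sub: "edge_set V (F - T)" for T using F edge_set_subset by blast
  \<comment> \<open>A transversal element \<open>(e, j)\<close> puts \<open>e\<close> into the copy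
    \<open>j\<close>; each summand is the rank of a slice of \<open>S\<close> in the dual of the
    cycle matroid of \<open>F\<close>.\<close>
  define f where "f S = (\<Sum>j<d. nullity V F - nullity V (F - {e. (e, j) \<in> S}))" for S :: "('a set \<times> nat) set"
  have submod: "f (X \<union> Y) + f (X \<inter> Y) \<le> f X + f Y" for X Y
  proof -
    have le: "nullity V (F - {e. (e, j) \<in> X}) + nullity V (F - {e. (e, j) \<in> Y})
       \<le> nullity V (F - {e. (e, j) \<in> X \<union> Y}) + nullity V (F - {e. (e, j) \<in> X \<inter> Y})" for j
      using nullity_supermodular[OF V sub sub, of "{e. (e, j) \<in> X}" "{e. (e, j) \<in> Y}"]
      by (simp add: Diff_Un[symmetric] Diff_Int[symmetric] Collect_disj_eq Collect_conj_eq add.commute)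
    have "nullity V F - nullity V (F - {e. (e, j) \<in> X \<union> Y})
         + (nullity V F - nullity V (F - {e. (e, j) \<in> X \<inter> Y}))
       \<le> nullity V F - nullity V (F - {e. (e, j) \<in> X}) + (nullity V F - nullity V (F - {e. (e, j) \<in> Y}))" for j
      using le[of j] by linarith
    then show ?thesis
      unfolding f_def sum.distrib[symmetric] by (rule sum_mono)
  qed
  have mono: "f X \<le> f Y" if "X \<subseteq> Y" for X Y
    unfolding f_def using that by (intro sum_mono diff_left_mono nullity_mono[OF V sub]) auto
  have empty: "f {} \<le> 0" by (simp add: f_def)
  \<comment> \<open>Over \<open>S\<close> with all \<open>d\<close> copies the rank is
    \<open>d * (nullity V F - nullity V (F - S))\<close>, and \<open>dense\<close> together with
    \<open>sparse\<close> for \<open>F - S\<close> bounds it below by \<open>card S\<close>. The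
    empty \<open>S\<close> is separate since \<open>sparse\<close> speaks of proper subsets.\<close>
  have hall: "int (card S) \<le> f (\<Union>e\<in>S. {e} \<times> {..<d})" if "S \<subseteq> F" for S
  proof (cases "S = {}")
    case True
    then show ?thesis by (simp add: f_def)
  next
    case False
    then have "int d * nullity V (F - S) \<le> int (card (F - S))"
      using that by (intro sparse) auto
    also have "int (card (F - S)) = int (card F) - int (card S)"
      using that finF card_mono[OF finF that] by (simp add: card_Diff_subset finite_subset of_nat_diff)
    finally have "int (card S) \<le> int d * (nullity V F - nullity V (F - S))"
      using dense by (simp add: right_diff_distrib)
    also have "\<dots> = f (\<Union>e\<in>S. {e} \<times> {..<d})"
      by (simp add: f_def)
    finally show ?thesis .
  qed
  obtain t where t: "\<And>e. e \<in> F \<Longrightarrow> t e \<in> {e} \<times> {..<d}"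
    and tS: "\<And>S. S \<subseteq> F \<Longrightarrow> int (card S) \<le> f (t ` S)"
    using rado_transversal[OF finF submod mono empty, of "\<lambda>e. {e} \<times> {..<d}"] hall by blast
  define colour where "colour e = snd (t e)" for e
  have t_eq: "t e = (e, colour e)" and colour_less: "colour e < d" if "e \<in> F" for e
    using t[OF that] by (auto simp: colour_def)
  have "(a, b) \<in> reach {f \<in> F. colour f \<noteq> colour e}" if e: "e \<in> F" and ab: "e = {a, b}" for e a b
  proof (rule ccontr)
    assume no: "(a, b) \<notin> reach {f \<in> F. colour f \<noteq> colour e}"
    \<comment> \<open>The transversal restricted to one colour lies in a single copy, so the colour
      class is independent in the dual matroid: deleting it creates no new component, whereas
      separating \<open>a\<close> from \<open>b\<close> would.\<close>
    let ?S = "{f \<in> F. colour f = colour e}" and ?T = "{f \<in> F. colour f \<noteq> colour e}"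
    have abV: "a \<in> V" "b \<in> V" using e ab F by (auto simp: edge_set_def doubleton_eq_iff)
    have "{g. (g, j) \<in> t ` ?S} = (if j = colour e then ?S else {})" for j
      using t_eq by (auto simp: image_iff)
    then have "f (t ` ?S) = (\<Sum>j<d. if j = colour e then nullity V F - nullity V (F - ?S) else 0)"
      unfolding f_def by (intro sum.cong) auto
    also have "\<dots> = nullity V F - nullity V (F - ?S)" using colour_less[OF e] by simp
    also have "F - ?S = ?T" by auto
    finally have "int (card ?S) \<le> nullity V F - nullity V ?T" using tS[of ?S] by simp
    moreover have "card F = card ?S + card ?T"
      using finF by (subst card_Un_disjoint[symmetric]) (auto intro: arg_cong[of _ _ card])
    moreover have "comps V F < comps V ?T"
    proof -
      have "comps V F \<le> comps V (insert e ?T)"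
        using e by (intro comps_antimono[OF V F]) auto
      then show ?thesis using comps_insert_unreachable[OF V abV no] ab by simp
    qed
    ultimately show False by (simp add: nullity_def)
  qed
  then show ?thesis using colour_less by blast
qed

subsection \<open>Contractions and ear decompositions\<close>

text \<open>The closed form of iterated contraction: once the edges of \<open>F\<close> are
  contracted, in whatever stages, the branch sets are the classes of \<open>reach F\<close>.\<close>

definition quot_graph :: "'v set \<Rightarrow> 'v set set \<Rightarrow> 'v set set \<Rightarrow> ('v set, 'v set) multigraph" where
  "quot_graph V E F =
     \<lparr>verts = V // reach F, edges = E - F, ends = (\<lambda>e. (\<lambda>v. reach F `` {v}) ` e)\<rparr>"

lemma quot_graph_simps [simp]:
  "verts (quot_graph V E F) = V // reach F"
  "edges (quot_graph V E F) = E - F"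
  "ends (quot_graph V E F) e = (\<lambda>v. reach F `` {v}) ` e"
  by (simp_all add: quot_graph_def)

lemma quot_graph_empty: "quot_graph (V :: 'v set) E {} = branch_graph_of V E"
proof -
  have "reach {} = (Id :: ('v \<times> 'v) set)" by (auto simp: reach_def)
  then show ?thesis
    by (simp add: quot_graph_def branch_graph_of_def quotient_eq_image)
qed

lemma linked_refl [simp]: "(X, X) \<in> linked H C"
  by (simp add: linked_def)

lemma linked_edge: "e \<in> C \<Longrightarrow> ends H e = {X, Y} \<Longrightarrow> (X, Y) \<in> linked H C"
  by (auto simp: linked_def)

lemma linked_trans: "(X, Y) \<in> linked H C \<Longrightarrow> (Y, Z) \<in> linked H C \<Longrightarrow> (X, Z) \<in> linked H C"
  by (auto simp: linked_def)

lemma linked_mono: "C \<subseteq> C' \<Longrightarrow> (X, Y) \<in> linked H C \<Longrightarrow> (X, Y) \<in> linked H C'"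
  unfolding linked_def by (rule rtrancl_mono[THEN subsetD, rotated]) auto

lemma linked_quot_graph:
  assumes "(v, w) \<in> reach (F \<union> C)"
  shows "(reach F `` {v}, reach F `` {w}) \<in> linked (quot_graph V E F) C"
  using assms unfolding reach_def[of "F \<union> C"]
proof (induction rule: rtrancl_induct)
  case (step y z)
  then have "{y, z} \<in> F \<or> {y, z} \<in> C" by auto
  then have "(reach F `` {y}, reach F `` {z}) \<in> linked (quot_graph V E F) C"
  proof
    assume "{y, z} \<in> F"
    then have "reach F `` {y} = reach F `` {z}" by (simp add: reach_class_eq_iff reach_edge)
    then show ?thesis by simp
  next
    assume "{y, z} \<in> C"
    then show ?thesis by (rule linked_edge) simp
  qed
  then show ?case using step.IH by (rule linked_trans[rotated])
qed simp

text \<open>The end \<open>Y\<close> is kept general so that induction along the walk applies; it is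
  a class because every step leads to the class of an end of an edge.\<close>

lemma reach_if_linked_quot_graph:
  assumes C: "edge_set V C"
    and "(reach F `` {v}, Y) \<in> linked (quot_graph V E F) C"
  shows "\<exists>w. Y = reach F `` {w} \<and> (v, w) \<in> reach (F \<union> C)"
  using assms(2) unfolding linked_def
proof (induction rule: rtrancl_induct)
  case base
  then show ?case by auto
next
  case (step Y Z)
  obtain w where w: "Y = reach F `` {w}" "(v, w) \<in> reach (F \<union> C)" using step.IH by auto
  obtain e where e: "e \<in> C" "(\<lambda>v. reach F `` {v}) ` e = {Y, Z}" using step.hyps by auto
  obtain a b where ab: "e = {a, b}" using C e(1) by (auto simp: edge_set_def)
  have "\<exists>a b. {a, b} \<in> C \<and> Y = reach F `` {a} \<and> Z = reach F `` {b}"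
  proof -
    have "{reach F `` {a}, reach F `` {b}} = {Y, Z}" using e(2) ab by simp
    then consider "reach F `` {a} = Y" "reach F `` {b} = Z" | "reach F `` {a} = Z" "reach F `` {b} = Y"
      by (auto simp only: doubleton_eq_iff)
    then show ?thesis
    proof cases
      case 1
      then show ?thesis using e(1) ab by blast
    next
      case 2
      moreover have "{b, a} \<in> C" using e(1) ab by (simp add: insert_commute)
      ultimately show ?thesis by blast
    qed
  qed
  then obtain a b where ab: "{a, b} \<in> C" "Y = reach F `` {a}" "Z = reach F `` {b}" by blast
  have "(w, a) \<in> reach (F \<union> C)"
    using ab w reach_class_eq_iff[of F w a] reach_mono[of F "F \<union> C"] by blast
  moreover have "(a, b) \<in> reach (F \<union> C)" using ab(1) by (intro reach_edge) auto
  ultimately show ?case using w ab reach_trans by metis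
qed

lemma reach_Un_if_linked_quot_graph:
  assumes "edge_set V C"
    and "(reach F `` {v}, reach F `` {w}) \<in> linked (quot_graph V E F) C"
  shows "(v, w) \<in> reach (F \<union> C)"
proof -
  obtain u where "reach F `` {w} = reach F `` {u}" "(v, u) \<in> reach (F \<union> C)"
    using reach_if_linked_quot_graph[OF assms] by blast
  then show ?thesis
    using reach_mono[of F "F \<union> C" u w] reach_class_eq_iff[of F u w] reach_trans by (metis Un_upper1)
qed

lemma merge_quot_graph:
  assumes "edge_set V C"
  shows "merge (quot_graph V E F) C (reach F `` {v}) = reach (F \<union> C) `` {v}"
proof
  show "merge (quot_graph V E F) C (reach F `` {v}) \<subseteq> reach (F \<union> C) `` {v}"
  proof
    fix u
    assume "u \<in> merge (quot_graph V E F) C (reach F `` {v})"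
    then obtain Y where Y: "(reach F `` {v}, Y) \<in> linked (quot_graph V E F) C" "u \<in> Y"
      by (auto simp: merge_def)
    then obtain w where "Y = reach F `` {w}" "(v, w) \<in> reach (F \<union> C)"
      using reach_if_linked_quot_graph[OF assms] by blast
    then show "u \<in> reach (F \<union> C) `` {v}"
      using Y(2) reach_mono[of F "F \<union> C" w u] reach_trans by fastforce
  qed
  show "reach (F \<union> C) `` {v} \<subseteq> merge (quot_graph V E F) C (reach F `` {v})"
  proof
    fix w
    assume "w \<in> reach (F \<union> C) `` {v}"
    then have "(reach F `` {v}, reach F `` {w}) \<in> linked (quot_graph V E F) C"
      by (intro linked_quot_graph) simp
    moreover have "w \<in> reach F `` {w}" by simp
    ultimately show "w \<in> merge (quot_graph V E F) C (reach F `` {v})"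
      unfolding merge_def by blast
  qed
qed

lemma contract_quot_graph:
  assumes "edge_set V C"
  shows "contract (quot_graph V E F) C = quot_graph V E (F \<union> C)"
  unfolding contract_def
  by (simp add: quot_graph_def[of V E "F \<union> C"] quotient_eq_image image_image
      merge_quot_graph[OF assms] Diff_eq Int_assoc)

lemma cycle_path_linked:
  assumes "cycle_through H n x e" "i < n"
  shows "(x 0, x i) \<in> linked H (e ` {..<i})"
  using assms(2)
proof (induction i)
  case (Suc i)
  have "(x 0, x i) \<in> linked H (e ` {..<Suc i})"
    using Suc by (auto intro: linked_mono[rotated])
  moreover have "ends H (e i) = {x i, x (Suc i)}"
    using assms(1) Suc.prems by (simp add: cycle_through_def)
  then have "(x i, x (Suc i)) \<in> linked H (e ` {..<Suc i})"
    by (rule linked_edge[rotated]) simp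
  ultimately show ?case by (rule linked_trans)
qed simp

text \<open>A cycle with \<open>n\<close> edges merges \<open>n\<close> different branch sets into
  one, so it lowers the number of components by \<open>n - 1\<close>.\<close>

lemma nullity_cycle:
  assumes V: "finite V" and E: "edge_set V E" and F: "F \<subseteq> E"
    and cyc: "cycle_through (quot_graph V E F) n x e"
  shows "nullity V (F \<union> e ` {..<n}) = nullity V F + 1"
proof -
  let ?H = "quot_graph V E F" and ?C = "e ` {..<n}"
  have n: "1 \<le> n" and e: "inj_on e {..<n}" "?C \<subseteq> E - F"
    and x: "inj_on x {..<n}" "x ` {..<n} \<subseteq> V // reach F"
    and ends: "\<And>i. i < n \<Longrightarrow> ends ?H (e i) = {x i, x (Suc i mod n)}"
    using cyc by (auto simp: cycle_through_def)
  have C: "edge_set V ?C" using E edge_set_subset e(2) by blast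
  have finE: "finite E" using V E edge_set_finite by blast
  have card_C: "card (F \<union> ?C) = card F + n"
    using e F finE by (subst card_Un_disjoint) (auto simp: card_image intro: finite_subset)
  \<comment> \<open>The last edge closes the path of the other \<open>n - 1\<close> edges and merges
    nothing.\<close>
  have lower: "comps V F \<le> comps V (F \<union> ?C) + (n - 1)"
  proof -
    let ?C' = "e ` {..<n - 1}" and ?f = "e (n - 1)"
    have "{..<n} = insert (n - 1) {..<n - 1}" using n by auto
    then have C_eq: "?C = insert ?f ?C'" by simp
    have "?f \<in> ?C" using n by auto
    then obtain a b where ab: "?f = {a, b}" using C edge_setE by metis
    have "{reach F `` {a}, reach F `` {b}} = {x (n - 1), x 0}"
      using ends[of "n - 1"] n ab by simp
    moreover have "(x 0, x (n - 1)) \<in> linked ?H ?C'"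
      using cycle_path_linked[OF cyc, of "n - 1"] n by simp
    ultimately have "(reach F `` {a}, reach F `` {b}) \<in> linked ?H ?C' \<or>
        (reach F `` {b}, reach F `` {a}) \<in> linked ?H ?C'"
      unfolding doubleton_eq_iff by metis
    moreover have "?C' \<subseteq> ?C" by auto
    then have C': "edge_set V ?C'" by (rule edge_set_subset[OF C])
    ultimately have "(a, b) \<in> reach (F \<union> ?C')"
      using reach_Un_if_linked_quot_graph[OF C'] reach_sym[of b a "F \<union> ?C'"] by blast
    then have "comps V (F \<union> ?C) = comps V (F \<union> ?C')"
      using comps_insert_reachable[of a b "F \<union> ?C'" V] by (simp add: ab[symmetric] C_eq)
    moreover have "comps V F \<le> comps V (F \<union> ?C') + card ?C'"
      by (rule comps_Un_le[OF V C'])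
    moreover have "card ?C' \<le> n - 1" using card_image_le[of "{..<n - 1}" e] by simp
    ultimately show ?thesis by linarith
  qed
  \<comment> \<open>All \<open>n\<close> branch sets on the cycle have the same image under
    \<open>merge\<close>.\<close>
  have upper: "comps V (F \<union> ?C) + (n - 1) \<le> comps V F"
  proof -
    let ?Q = "V // reach F" and ?X = "x ` {..<n}"
    have finQ: "finite ?Q" using V by (simp add: quotient_eq_image)
    have same: "merge ?H ?C (x i) = merge ?H ?C (x 0)" if "i < n" for i
    proof -
      have "x 0 \<in> V // reach F" "x i \<in> V // reach F" using x(2) n that by auto
      then obtain a b where a: "x 0 = reach F `` {a}" and b: "x i = reach F `` {b}"
        by (auto simp: quotient_eq_image)
      have "(x 0, x i) \<in> linked ?H ?C"
        using cycle_path_linked[OF cyc that] by (rule linked_mono[rotated]) (use that in auto)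
      then have "(a, b) \<in> reach (F \<union> ?C)"
        using reach_Un_if_linked_quot_graph[OF C] a b by metis
      then show ?thesis unfolding a b merge_quot_graph[OF C] reach_class_eq_iff by (rule reach_sym)
    qed
    have "merge ?H ?C Y \<in> insert (merge ?H ?C (x 0)) (merge ?H ?C ` (?Q - ?X))" if "Y \<in> ?Q" for Y
    proof (cases "Y \<in> ?X")
      case True
      then obtain i where "i < n" "Y = x i" by blast
      then show ?thesis using same[of i] by simp
    next
      case False
      then show ?thesis using that by blast
    qed
    then have "merge ?H ?C ` ?Q \<subseteq> insert (merge ?H ?C (x 0)) (merge ?H ?C ` (?Q - ?X))" by blast
    moreover have "V // reach (F \<union> ?C) = merge ?H ?C ` ?Q"
      by (simp add: quotient_eq_image image_image merge_quot_graph[OF C])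
    ultimately have "comps V (F \<union> ?C) \<le> card (insert (merge ?H ?C (x 0)) (merge ?H ?C ` (?Q - ?X)))"
      unfolding comps_def using finQ by (simp add: card_mono)
    also have "\<dots> \<le> Suc (card (?Q - ?X))"
      using finQ by (intro order_trans[OF card_insert_le_m1] Suc_le_mono[THEN iffD2]) (auto intro: card_image_le)
    also have "card (?Q - ?X) = comps V F - n"
      using finQ x by (simp add: card_Diff_subset card_image comps_def)
    finally have "comps V (F \<union> ?C) \<le> Suc (comps V F - n)" .
    moreover have "n \<le> comps V F"
      using card_mono[OF finQ x(2)] x(1) by (simp add: card_image comps_def)
    ultimately show ?thesis using n by linarith
  qed
  show ?thesis using lower upper card_C n by (simp add: nullity_def)
qed

text \<open>The list condition in recursive form; \<open>F\<close> accumulates the edges contracted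
  so far.\<close>

fun ear_sequence :: "'v set \<Rightarrow> 'v set set \<Rightarrow> 'v set set \<Rightarrow> 'v set set list \<Rightarrow> bool" where
  "ear_sequence V E F [] \<longleftrightarrow> True"
| "ear_sequence V E F (C # Cs) \<longleftrightarrow>
     induced_cycle (quot_graph V E F) C \<and> ear_sequence V E (F \<union> C) Cs"

lemma induced_cycleD:
  assumes "induced_cycle (quot_graph V E F) C"
  shows "C \<subseteq> E - F" "C \<noteq> {}"
proof -
  obtain n x e where *: "cycle_through (quot_graph V E F) n x e" "C = e ` {..<n}"
    using assms by (auto simp: induced_cycle_def)
  show "C \<subseteq> E - F" using * by (auto simp: cycle_through_def)
  have "n \<noteq> 0" using * by (auto simp: cycle_through_def)
  then show "C \<noteq> {}" using * by (auto simp: lessThan_eq_iff lessThan_empty_iff bot_nat_def)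
qed

lemma nullity_induced_cycle:
  assumes "finite V" "edge_set V E" "F \<subseteq> E" "induced_cycle (quot_graph V E F) C"
  shows "nullity V (F \<union> C) = nullity V F + 1"
  using assms nullity_cycle[OF assms(1-3)] by (auto simp: induced_cycle_def)

lemma ear_sequence_iff:
  assumes "edge_set V E" "F \<subseteq> E"
  shows "ear_sequence V E F Cs \<longleftrightarrow>
    (\<forall>i<length Cs. induced_cycle (foldl contract (quot_graph V E F) (take i Cs)) (Cs ! i))"
  using assms(2)
proof (induction Cs arbitrary: F)
  case (Cons C Cs)
  show ?case
  proof (cases "induced_cycle (quot_graph V E F) C")
    case True
    have C: "C \<subseteq> E" "edge_set V C" using induced_cycleD[OF True] assms(1) edge_set_subset by blast+
    have "contract (quot_graph V E F) C = quot_graph V E (F \<union> C)"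
      by (rule contract_quot_graph[OF C(2)])
    then show ?thesis
      using True Cons.IH[of "F \<union> C"] C Cons.prems by (auto simp: less_Suc_eq_0_disj)
  next
    case False
    then show ?thesis by (auto intro!: exI[of _ 0])
  qed
qed simp

text \<open>Contracted edges are deleted, so later ears avoid them; this yields disjointness and the
  sum formula, while each ear adds one to the nullity.\<close>

lemma ear_sequence_props:
  assumes V: "finite V" and E: "edge_set V E"
  shows "F \<subseteq> E \<Longrightarrow> ear_sequence V E F Cs \<Longrightarrow>
    \<Union> (set Cs) \<subseteq> E - F \<and> nullity V (F \<union> \<Union> (set Cs)) = nullity V F + int (length Cs) \<and>
    card (\<Union> (set Cs)) = (\<Sum>C\<leftarrow>Cs. card C) \<and>
    (\<forall>i<length Cs. \<forall>j<length Cs. i \<noteq> j \<longrightarrow> Cs ! i \<inter> Cs ! j = {})"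
proof (induction Cs arbitrary: F)
  case (Cons C Cs)
  have C: "C \<subseteq> E - F" using Cons.prems(2) induced_cycleD(1)[of V E F C] by simp
  have CE: "F \<union> C \<subseteq> E" using C Cons.prems(1) by blast
  have "ear_sequence V E (F \<union> C) Cs" using Cons.prems(2) by simp
  from Cons.IH[OF CE this] have IH: "\<Union> (set Cs) \<subseteq> E - (F \<union> C)"
    "nullity V (F \<union> C \<union> \<Union> (set Cs)) = nullity V (F \<union> C) + int (length Cs)"
    "card (\<Union> (set Cs)) = (\<Sum>C\<leftarrow>Cs. card C)"
    "\<forall>i<length Cs. \<forall>j<length Cs. i \<noteq> j \<longrightarrow> Cs ! i \<inter> Cs ! j = {}"
    by blast+
  have finE: "finite E" using V E edge_set_finite by blast
  have "card (C \<union> \<Union> (set Cs)) = card C + card (\<Union> (set Cs))"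
    using IH(1) C finE by (intro card_Un_disjoint) (auto intro: finite_subset)
  moreover have "nullity V (F \<union> C) = nullity V F + 1"
    using nullity_induced_cycle[OF V E] Cons.prems by simp
  moreover have dC: "C \<inter> Cs ! j = {}" if "j < length Cs" for j
    using IH(1) nth_mem[OF that] by blast
  then have "(C # Cs) ! i \<inter> (C # Cs) ! j = {}"
    if "i < length (C # Cs)" "j < length (C # Cs)" "i \<noteq> j" for i j
    using that IH(4) by (cases i; cases j) (simp_all add: Int_commute[of _ C])
  moreover have "\<Union> (set (C # Cs)) \<subseteq> E - F" using IH(1) C by auto
  ultimately show ?case
    using IH(2,3) by (simp add: Un_assoc)
qed simp

lemma partial_ear_decomposition_iff:
  assumes "finite V" "edge_set V E"
  shows "partial_ear_decomposition V E Cs \<longleftrightarrow> ear_sequence V E {} Cs"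
  using ear_sequence_iff[OF assms(2), of "{}" Cs] ear_sequence_props[OF assms, of "{}" Cs]
  by (auto simp: partial_ear_decomposition_def quot_graph_empty)

section \<open>Induced cycles and ears inside a flat edge set\<close>

lemma linked_imp_walk:
  assumes "(A, B) \<in> linked H C"
  shows "\<exists>m y g. y 0 = A \<and> y m = B \<and> (\<forall>i<m. g i \<in> C \<and> ends H (g i) = {y i, y (Suc i)})"
proof -
  obtain m where "(A, B) \<in> {(x, y). \<exists>e\<in>C. ends H e = {x, y}} ^^ m"
    using assms unfolding linked_def rtrancl_is_UN_relpow by blast
  then obtain y where y: "y 0 = A" "y m = B" "\<forall>i<m. \<exists>e\<in>C. ends H e = {y i, y (Suc i)}"
    unfolding relpow_fun_conv by auto
  define g where "g i = (SOME e. e \<in> C \<and> ends H e = {y i, y (Suc i)})" for i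
  have "g i \<in> C \<and> ends H (g i) = {y i, y (Suc i)}" if "i < m" for i
    unfolding g_def by (rule someI_ex) (use y(3) that in blast)
  then show ?thesis using y by blast
qed

text \<open>A chord of a cycle inside \<open>D\<close> has linked ends, so it lies in \<open>D\<close> again and closes up a
  shorter cycle.\<close>

lemma exists_induced_cycle:
  fixes H :: "('a, 'e) multigraph"
  assumes D: "D \<subseteq> edges H"
    and vert: "\<And>e. e \<in> D \<Longrightarrow> ends H e \<subseteq> verts H"
    and flat: "\<And>f A B. f \<in> edges H \<Longrightarrow> ends H f = {A, B} \<Longrightarrow> (A, B) \<in> linked H D \<Longrightarrow> f \<in> D"
    and f: "f0 \<in> D" "ends H f0 = {A0, B0}" "(A0, B0) \<in> linked H (D - {f0})"
  shows "\<exists>C\<subseteq>D. induced_cycle H C"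
proof -
  \<comment> \<open>A closing edge \<open>f\<close> and a walk of length \<open>m\<close> between
    its ends in the rest of \<open>D\<close>; \<open>m = 0\<close> is a loop. For the least
    \<open>m\<close> this is a cycle.\<close>
  define W where "W m f y g \<longleftrightarrow> f \<in> D \<and> ends H f = {y 0, y m} \<and>
     (\<forall>i<m. g i \<in> D - {f} \<and> ends H (g i) = {y i, y (Suc i)})" for m :: nat and f y g
  have "\<exists>m f y g. W m f y g"
    using linked_imp_walk[OF f(3)] f(1,2) unfolding W_def by blast
  then obtain m where "\<exists>f y g. W m f y g" and min: "\<And>k. k < m \<Longrightarrow> \<not> (\<exists>f y g. W k f y g)"
    using exists_least_iff[of "\<lambda>m. \<exists>f y g. W m f y g"] by blast
  then obtain f y g where W: "W m f y g" by blast
  then have f: "f \<in> D" "ends H f = {y 0, y m}"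
    and g: "\<And>i. i < m \<Longrightarrow> g i \<in> D" "\<And>i. i < m \<Longrightarrow> g i \<noteq> f" "\<And>i. i < m \<Longrightarrow> ends H (g i) = {y i, y (Suc i)}"
    by (auto simp: W_def)
  have distinct: "y i \<noteq> y j" if "i < j" "j \<le> m" for i j
  proof
    assume eq: "y i = y j"
    \<comment> \<open>\<open>h\<close> skips the indices from \<open>i\<close> to
      \<open>j - 1\<close>, which cuts out the closed part of the walk.\<close>
    define h where "h k = (if k < i then k else k + (j - i))" for k
    have "y (h (Suc k)) = y (Suc (h k))" for k
      using that eq by (cases "Suc k = i") (auto simp: h_def)
    moreover have "h k < m" if "k < m - (j - i)" for k
      using that \<open>i < j\<close> \<open>j \<le> m\<close> by (auto simp: h_def)
    moreover have "y (h 0) = y 0" using that eq by (auto simp: h_def)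
    moreover have "h (m - (j - i)) = m" using that by (auto simp: h_def)
    ultimately have "W (m - (j - i)) f (\<lambda>k. y (h k)) (\<lambda>k. g (h k))"
      using f g by (auto simp: W_def)
    moreover have "m - (j - i) < m" using that by simp
    ultimately show False using min by blast
  qed
  then have inj_y: "inj_on y {..m}"
    by (auto simp: inj_on_def) (metis linorder_neqE_nat)
  have y_eq: "y i = y j \<longleftrightarrow> i = j" if "i \<le> m" "j \<le> m" for i j
    using inj_y that by (auto simp: inj_on_def)
  define e where "e i = (if i < m then g i else f)" for i
  have ends_e: "ends H (e i) = {y i, y (Suc i mod Suc m)}" if "i < Suc m" for i
    using that f g by (cases "i = m") (auto simp: e_def)
  have inj_g: "i = j" if "i < m" "j < m" "g i = g j" for i j
  proof -
    have "{y i, y (Suc i)} = {y j, y (Suc j)}" using g(3) that by metis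
    then show ?thesis using that by (auto simp: doubleton_eq_iff y_eq)
  qed
  have "inj_on e {..<Suc m}"
    unfolding inj_on_def by (auto simp: e_def less_Suc_eq dest: inj_g g(2) g(2)[symmetric])
  moreover have eD: "e ` {..<Suc m} \<subseteq> D" using f g by (auto simp: e_def)
  moreover have "y ` {..<Suc m} \<subseteq> verts H"
  proof
    fix A assume "A \<in> y ` {..<Suc m}"
    then obtain i where "i < Suc m" "A = y i" by blast
    then have "A \<in> ends H (e i)" "e i \<in> D" using ends_e eD by auto
    then show "A \<in> verts H" using vert by blast
  qed
  moreover have "inj_on y {..<Suc m}" using inj_y by (simp add: lessThan_Suc_atMost)
  ultimately have cyc: "cycle_through H (Suc m) y e"
    using ends_e D by (auto simp: cycle_through_def)
  \<comment> \<open>\<open>h\<close> would close up the part of the walk from \<open>i\<close> to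
    \<open>j\<close>. The excluded pairs are the cyclic neighbours, \<open>0\<close> and
    \<open>m\<close> being joined by the closing edge.\<close>
  have no: False if ij: "i < j" "j \<le> m" "j \<noteq> Suc i" "\<not> (i = 0 \<and> j = m)"
    and h: "h \<in> edges H" "ends H h = {y i, y j}" for i j h
  proof -
    have walk: "(y i, y k) \<in> linked H D" if "i \<le> k" "k \<le> m" for k
      using that
    proof (induction k rule: dec_induct)
      case (step k)
      have "(y k, y (Suc k)) \<in> linked H D"
        using step.prems g by (intro linked_edge[of "g k"]) auto
      then show ?case using step linked_trans Suc_leD by metis
    qed simp
    have "h \<in> D" using flat[OF h] walk[of j] ij by simp
    moreover have "g k \<noteq> h" if "i \<le> k" "k < j" for k
    proof
      assume "g k = h"
      then have "{y k, y (Suc k)} = {y i, y j}" using g(3)[of k] h that ij by auto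
      then show False using that ij by (auto simp: doubleton_eq_iff y_eq)
    qed
    ultimately have "W (j - i) h (\<lambda>k. y (i + k)) (\<lambda>k. g (i + k))"
      using h g ij by (auto simp: W_def)
    moreover have "j - i < m" using ij by auto
    ultimately show False using min by blast
  qed
  have "\<not> has_chord H (Suc m) y"
  proof
    assume "has_chord H (Suc m) y"
    then obtain i j h where ij: "i < Suc m" "j < Suc m" "i \<noteq> j" "j \<noteq> Suc i mod Suc m"
      "i \<noteq> Suc j mod Suc m" and h: "h \<in> edges H" "ends H h = {y i, y j}"
      by (auto simp: has_chord_def)
    have mods: "k < m \<Longrightarrow> Suc k mod Suc m = Suc k" for k by simp
    show False
    proof (cases "i < j")
      case True
      then show False using no[OF True _ _ _ h] ij mods[of i] by force
    next
      case False
      have h': "ends H h = {y j, y i}" using h(2) by (simp add: insert_commute)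
      show False using no[of j i h, OF _ _ _ _ h(1) h'] False ij mods[of j] by force
    qed
  qed
  then show ?thesis using cyc eD unfolding induced_cycle_def by blast
qed

text \<open>An edge of \<open>D\<close> that is a bridge of the full set is also one at the moment
  when it is added, so it joins two components.\<close>

lemma nullity_eq_if_bridges:
  assumes V: "finite V" and F0: "finite F0"
    and "finite D" "edge_set V D" "D \<inter> F0 = {}"
    and "\<And>a b. {a, b} \<in> D \<Longrightarrow> (a, b) \<notin> reach (F0 \<union> (D - {{a, b}}))"
  shows "nullity V (F0 \<union> D) = nullity V F0"
  using assms(3-)
proof (induction D rule: finite_induct)
  case (insert e D)
  obtain a b where ab: "a \<in> V" "b \<in> V" "e = {a, b}"
    using insert.prems(1) by (auto simp: edge_set_def)
  have "(x, y) \<notin> reach (F0 \<union> (D - {{x, y}}))" if "{x, y} \<in> D" for x y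
  proof
    assume "(x, y) \<in> reach (F0 \<union> (D - {{x, y}}))"
    then have "(x, y) \<in> reach (F0 \<union> (insert e D - {{x, y}}))"
      by (rule reach_mono[rotated]) auto
    then show False using insert.prems(3) that by blast
  qed
  then have IH: "nullity V (F0 \<union> D) = nullity V F0"
    using insert.IH insert.prems by (simp add: edge_set_def)
  have "insert e D - {e} = D" using insert.hyps by auto
  then have "(a, b) \<notin> reach (F0 \<union> D)" using insert.prems(3)[of a b] ab(3) by simp
  then have "nullity V (insert e (F0 \<union> D)) = nullity V (F0 \<union> D)"
    using nullity_insert_unreachable[OF V ab(1,2)] insert.hyps F0 ab(3) by simp
  then show ?case using IH by simp
qed simp

text \<open>While \<open>k > 0\<close> some nullity is missing, so not all remaining edges of
  \<open>F\<close> are bridges. A shortest cycle among them is induced in the whole contraction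
  because flatness keeps every chord inside \<open>F\<close>.\<close>

lemma exists_ear_sequence:
  assumes V: "finite V" and E: "edge_set V E" and FE: "F \<subseteq> E"
    and flat: "\<And>a b. {a, b} \<in> E \<Longrightarrow> (a, b) \<in> reach F \<Longrightarrow> {a, b} \<in> F"
  shows "F0 \<subseteq> F \<Longrightarrow> nullity V F0 + int k = nullity V F \<Longrightarrow>
     \<exists>Cs. ear_sequence V E F0 Cs \<and> length Cs = k \<and> \<Union> (set Cs) \<subseteq> F"
proof (induction k arbitrary: F0)
  case 0
  then show ?case by (intro exI[of _ "[]"]) simp
next
  case (Suc k)
  have finE: "finite E" using V E edge_set_finite by blast
  have fin: "finite F" using FE finE by (rule finite_subset)
  have fins: "finite F0" "finite (F - F0)" using finite_subset[OF Suc.prems(1) fin] fin by simp_all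
  have EF: "edge_set V (F - F0)" by (rule edge_set_subset[OF E]) (use FE in blast)
  let ?H = "quot_graph V E F0" and ?D = "F - F0"
  have FD: "F0 \<union> ?D = F" using Suc.prems(1) by blast
  have "\<exists>a b. {a, b} \<in> ?D \<and> (a, b) \<in> reach (F0 \<union> (?D - {{a, b}}))"
  proof (rule ccontr)
    assume "\<not> ?thesis"
    then have "nullity V (F0 \<union> ?D) = nullity V F0"
      by (intro nullity_eq_if_bridges V fins EF) auto
    then show False using Suc.prems(2) FD by simp
  qed
  then obtain a b where ab: "{a, b} \<in> ?D" "(a, b) \<in> reach (F0 \<union> (?D - {{a, b}}))" by blast
  have "\<exists>C\<subseteq>?D. induced_cycle ?H C"
  proof (rule exists_induced_cycle)
    show "?D \<subseteq> edges ?H" using FE by auto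
    show "ends ?H e \<subseteq> verts ?H" if "e \<in> ?D" for e
    proof -
      have "e \<subseteq> V" using edge_setE[OF EF that] by blast
      then show ?thesis by (auto simp: quotient_eq_image)
    qed
    show "f \<in> ?D" if f: "f \<in> edges ?H" "ends ?H f = {A, B}" and AB: "(A, B) \<in> linked ?H ?D" for f A B
    proof -
      have fE: "f \<in> E" "f \<notin> F0" using f by auto
      obtain a b where ab: "f = {a, b}" using edge_setE[OF E fE(1)] by metis
      have "{reach F0 `` {a}, reach F0 `` {b}} = {A, B}" using f(2) ab by simp
      then have "(reach F0 `` {a}, reach F0 `` {b}) \<in> linked ?H ?D \<or>
          (reach F0 `` {b}, reach F0 `` {a}) \<in> linked ?H ?D"
        using AB unfolding doubleton_eq_iff by metis
      then have "(a, b) \<in> reach (F0 \<union> ?D)"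
        using reach_Un_if_linked_quot_graph[OF EF] reach_sym[of b a "F0 \<union> ?D"] by blast
      then have "f \<in> F" using flat[of a b] fE ab FD by simp
      then show ?thesis using fE by simp
    qed
    show "{a, b} \<in> ?D" by fact
    show "ends ?H {a, b} = {reach F0 `` {a}, reach F0 `` {b}}" by simp
    show "(reach F0 `` {a}, reach F0 `` {b}) \<in> linked ?H (?D - {{a, b}})"
      by (rule linked_quot_graph) fact
  qed
  then obtain C where C: "C \<subseteq> ?D" "induced_cycle ?H C" by blast
  have "F0 \<subseteq> E" using Suc.prems(1) FE by blast
  then have "nullity V (F0 \<union> C) = nullity V F0 + 1" by (rule nullity_induced_cycle[OF V E _ C(2)])
  then have "nullity V (F0 \<union> C) + int k = nullity V F" using Suc.prems(2) by simp
  moreover have "F0 \<union> C \<subseteq> F" using C(1) Suc.prems(1) by blast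
  ultimately obtain Cs where "ear_sequence V E (F0 \<union> C) Cs" "length Cs = k" "\<Union> (set Cs) \<subseteq> F"
    using Suc.IH by blast
  then show ?case using C by (intro exI[of _ "C # Cs"]) auto
qed

lemma dense_iff_ears:
  assumes V: "finite V" and E: "edge_set V E" and d: "0 < d"
  shows "(\<exists>F\<subseteq>E. F \<noteq> {} \<and> int (card F) \<le> int d * nullity V F) \<longleftrightarrow>
    (\<exists>Cs. 1 \<le> length Cs \<and> partial_ear_decomposition V E Cs \<and> (\<Sum>C\<leftarrow>Cs. card C) \<le> d * length Cs)"
proof
  assume "\<exists>F\<subseteq>E. F \<noteq> {} \<and> int (card F) \<le> int d * nullity V F"
  then obtain F0 where F0: "F0 \<subseteq> E" "F0 \<noteq> {}" "int (card F0) \<le> int d * nullity V F0" by blast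
  have finE: "finite E" using V E edge_set_finite by blast
  define P where "P F \<longleftrightarrow> F \<subseteq> E \<and> F \<noteq> {} \<and> int (card F) \<le> int d * nullity V F" for F
  have "\<forall>F. P F \<longrightarrow> card F < Suc (card E)"
    using finE by (auto simp: P_def less_Suc_eq_le intro: card_mono)
  moreover have "P F0" using F0 by (simp add: P_def)
  ultimately obtain F where F: "P F" and max: "\<And>F'. P F' \<Longrightarrow> card F' \<le> card F"
    using ex_has_greatest_nat[of P F0 card "Suc (card E)"] by blast
  have finF: "finite F" using F finE finite_subset by (auto simp: P_def)
  \<comment> \<open>An edge with linked ends adds one to the cardinality and
    \<open>d \<ge> 1\<close> to the right-hand side, against the choice of \<open>F\<close>.\<close>
  have flat: "{a, b} \<in> F" if "{a, b} \<in> E" "(a, b) \<in> reach F" for a b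
  proof (rule ccontr)
    assume no: "{a, b} \<notin> F"
    then have "nullity V (insert {a, b} F) = nullity V F + 1"
      using that finF by (intro nullity_insert_reachable)
    then have "P (insert {a, b} F)"
      using F d no finF that by (auto simp: P_def distrib_left)
    from max[OF this] show False using no finF by simp
  qed
  have "0 < card F" using F finF by (auto simp: P_def card_gt_0_iff)
  then have "0 < int d * nullity V F" using F by (simp add: P_def)
  then have "0 < nullity V F" using d by (simp add: zero_less_mult_iff)
  then obtain k where k: "nullity V F = int k" "1 \<le> k"
    by (cases "nullity V F") auto
  obtain Cs where Cs: "ear_sequence V E {} Cs" "length Cs = k" "\<Union> (set Cs) \<subseteq> F"
    using exists_ear_sequence[OF V E _ flat, of "{}" k] F k by (auto simp: P_def nullity_empty)
  \<comment> \<open>The ears need not exhaust \<open>F\<close>: bridges may remain, which only makes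
    the sum smaller.\<close>
  have "(\<Sum>C\<leftarrow>Cs. card C) \<le> card F"
    using ear_sequence_props[OF V E _ Cs(1)] card_mono[OF finF Cs(3)] by simp
  also have "card F \<le> d * k" using F k by (simp add: P_def flip: of_nat_mult)
  finally show "\<exists>Cs. 1 \<le> length Cs \<and> partial_ear_decomposition V E Cs \<and> (\<Sum>C\<leftarrow>Cs. card C) \<le> d * length Cs"
    using Cs k partial_ear_decomposition_iff[OF V E] by blast
next
  assume "\<exists>Cs. 1 \<le> length Cs \<and> partial_ear_decomposition V E Cs \<and> (\<Sum>C\<leftarrow>Cs. card C) \<le> d * length Cs"
  then obtain Cs where Cs: "1 \<le> length Cs" "ear_sequence V E {} Cs" "(\<Sum>C\<leftarrow>Cs. card C) \<le> d * length Cs"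
    using partial_ear_decomposition_iff[OF V E] by blast
  let ?F = "\<Union> (set Cs)"
  have props: "?F \<subseteq> E" "nullity V ?F = int (length Cs)" "card ?F = (\<Sum>C\<leftarrow>Cs. card C)"
    using ear_sequence_props[OF V E _ Cs(2)] by (auto simp: nullity_empty)
  have "?F \<noteq> {}" using props(2) Cs(1) nullity_empty[of V] by fastforce
  moreover have "int (card ?F) \<le> int d * nullity V ?F"
    unfolding props using Cs(3) by (simp flip: of_nat_mult)
  ultimately show "\<exists>F\<subseteq>E. F \<noteq> {} \<and> int (card F) \<le> int d * nullity V F" using props(1) by blast
qed

subsection \<open>Coordinates of points and lines\<close>

lemma homog_vecs_iff: "x \<in> homog_vecs d \<longleftrightarrow> dim_vec x = Suc d \<and> (\<exists>i\<le>d. x $ i \<noteq> 0)"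
proof -
  have "x = 0\<^sub>v (Suc d) \<longleftrightarrow> (\<forall>i\<le>d. x $ i = 0)" if "dim_vec x = Suc d"
    using that by (auto simp: vec_eq_iff less_Suc_eq_le)
  moreover have "x \<in> homog_vecs d \<longleftrightarrow> dim_vec x = Suc d \<and> x \<noteq> 0\<^sub>v (Suc d)"
    unfolding homog_vecs_def carrier_vec_def by simp
  ultimately show ?thesis by blast
qed

lemma homog_vecsI: "dim_vec x = Suc d \<Longrightarrow> i \<le> d \<Longrightarrow> x $ i \<noteq> 0 \<Longrightarrow> x \<in> homog_vecs d"
  by (auto simp: homog_vecs_iff)

lemma homog_vecs_dim: "x \<in> homog_vecs d \<Longrightarrow> dim_vec x = Suc d"
  by (simp add: homog_vecs_iff)

lemma proj_point_smult:
  assumes "(c :: 'a :: field) \<noteq> 0"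
  shows "proj_point (c \<cdot>\<^sub>v x) = proj_point x"
proof -
  have "k \<cdot>\<^sub>v x = (k / c) \<cdot>\<^sub>v (c \<cdot>\<^sub>v x)" for k using assms by (simp add: smult_smult_assoc)
  then have "proj_point x \<subseteq> proj_point (c \<cdot>\<^sub>v x)" unfolding proj_point_def by blast
  moreover have "proj_point (c \<cdot>\<^sub>v x) \<subseteq> proj_point x"
    unfolding proj_point_def by (auto simp: smult_smult_assoc)
  ultimately show ?thesis by blast
qed

lemma proj_point_eqD:
  assumes "proj_point x = proj_point y" "x \<in> homog_vecs d" "y \<in> homog_vecs d"
  obtains c where "c \<noteq> 0" "x = c \<cdot>\<^sub>v y"
proof -
  have "1 \<cdot>\<^sub>v x \<in> proj_point x" unfolding proj_point_def by blast
  then have "x \<in> proj_point y" using assms(1) by simp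
  then obtain c where c: "x = c \<cdot>\<^sub>v y" by (auto simp: proj_point_def)
  have "c \<noteq> 0" using c assms(2,3) by (auto simp: homog_vecs_iff)
  then show ?thesis using that c by blast
qed

definition pluecker :: "'a :: field vec \<Rightarrow> 'a vec \<Rightarrow> nat \<Rightarrow> nat \<Rightarrow> 'a" where
  "pluecker x y i j = x $ i * y $ j - x $ j * y $ i"

lemma proj_point_eq_iff_pluecker:
  fixes x y :: "'a :: field vec"
  assumes x: "x \<in> homog_vecs d" and y: "y \<in> homog_vecs d"
  shows "proj_point x = proj_point y \<longleftrightarrow> (\<forall>j\<le>d. \<forall>i<j. pluecker x y i j = 0)"
proof
  assume "proj_point x = proj_point y"
  then obtain c where "x = c \<cdot>\<^sub>v y" using x y by (rule proj_point_eqD)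
  then show "\<forall>j\<le>d. \<forall>i<j. pluecker x y i j = 0"
    using homog_vecs_dim[OF y] by (simp add: pluecker_def)
next
  assume 0: "\<forall>j\<le>d. \<forall>i<j. pluecker x y i j = 0"
  have all0: "x $ i * y $ j = x $ j * y $ i" if "i \<le> d" "j \<le> d" for i j
    using 0 that by (cases i j rule: linorder_cases) (auto simp: pluecker_def mult.commute)
  obtain i where i: "i \<le> d" "x $ i \<noteq> 0" using x by (auto simp: homog_vecs_iff)
  have "y = (y $ i / x $ i) \<cdot>\<^sub>v x"
    using homog_vecs_dim[OF x] homog_vecs_dim[OF y] all0[OF i(1)] i(2)
    by (intro eq_vecI) (auto simp: field_simps less_Suc_eq_le)
  moreover from this have "y $ i / x $ i \<noteq> 0"
    using y homog_vecs_dim[OF x] by (auto simp: homog_vecs_iff)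
  ultimately show "proj_point x = proj_point y" using proj_point_smult by metis
qed

lemma proj_point_in_proj_line_iff:
  assumes "x \<in> homog_vecs d" "y \<in> homog_vecs d" "z \<in> homog_vecs d"
  shows "proj_point z \<in> proj_line d x y \<longleftrightarrow> (\<exists>a b. z = a \<cdot>\<^sub>v x + b \<cdot>\<^sub>v y)"
proof
  assume "proj_point z \<in> proj_line d x y"
  then obtain a b where ab: "proj_point z = proj_point (a \<cdot>\<^sub>v x + b \<cdot>\<^sub>v y)"
    "a \<cdot>\<^sub>v x + b \<cdot>\<^sub>v y \<in> homog_vecs d" by (auto simp: proj_line_def)
  then obtain c where c: "z = c \<cdot>\<^sub>v (a \<cdot>\<^sub>v x + b \<cdot>\<^sub>v y)" using assms(3) proj_point_eqD by blast
  have "z = (c * a) \<cdot>\<^sub>v x + (c * b) \<cdot>\<^sub>v y"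
    unfolding c using assms(1,2)[THEN homog_vecs_dim]
    by (intro eq_vecI) (simp_all add: distrib_left mult.assoc)
  then show "\<exists>a b. z = a \<cdot>\<^sub>v x + b \<cdot>\<^sub>v y" by blast
next
  assume "\<exists>a b. z = a \<cdot>\<^sub>v x + b \<cdot>\<^sub>v y"
  then show "proj_point z \<in> proj_line d x y" using assms(3) by (auto simp: proj_line_def)
qed

lemma proj_line_change_basis:
  fixes x y :: "'a :: field vec"
  assumes x: "x \<in> homog_vecs d" and y: "y \<in> homog_vecs d"
    and xy: "proj_point x \<noteq> proj_point y"
    and z: "z = a \<cdot>\<^sub>v x + b \<cdot>\<^sub>v y" and w: "w = a' \<cdot>\<^sub>v x + b' \<cdot>\<^sub>v y" and D: "a * b' - a' * b \<noteq> 0"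
  shows "z \<in> homog_vecs d" "w \<in> homog_vecs d" "proj_point z \<noteq> proj_point w"
    "proj_line d z w = proj_line d x y"
    "i \<le> d \<Longrightarrow> j \<le> d \<Longrightarrow> pluecker z w i j = (a * b' - a' * b) * pluecker x y i j"
proof -
  have dx: "dim_vec x = Suc d" and dy: "dim_vec y = Suc d" using x y homog_vecs_dim by auto
  have zi: "z $ i = a * x $ i + b * y $ i" and wi: "w $ i = a' * x $ i + b' * y $ i" if "i \<le> d" for i
    using that dx dy z w by simp_all
  have dim: "dim_vec z = Suc d" "dim_vec w = Suc d" using z w dx dy by simp_all
  have pl: "pluecker z w i j = (a * b' - a' * b) * pluecker x y i j" if "i \<le> d" "j \<le> d" for i j
    unfolding pluecker_def using that by (simp add: zi wi algebra_simps)
  then show "i \<le> d \<Longrightarrow> j \<le> d \<Longrightarrow> pluecker z w i j = (a * b' - a' * b) * pluecker x y i j" .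
  obtain i j where ij: "j \<le> d" "i < j" "pluecker x y i j \<noteq> 0"
    using xy proj_point_eq_iff_pluecker[OF x y] by blast
  then have "pluecker z w i j \<noteq> 0" using pl[of i j] D by simp
  then have "z $ i \<noteq> 0 \<or> z $ j \<noteq> 0" "w $ i \<noteq> 0 \<or> w $ j \<noteq> 0" by (auto simp: pluecker_def)
  then show hz: "z \<in> homog_vecs d" and hw: "w \<in> homog_vecs d"
    using dim ij homog_vecsI[of _ d i] homog_vecsI[of _ d j] by auto
  then show "proj_point z \<noteq> proj_point w"
    using ij \<open>pluecker z w i j \<noteq> 0\<close> proj_point_eq_iff_pluecker[OF hz hw] by blast
  have 1: "k \<cdot>\<^sub>v z + l \<cdot>\<^sub>v w = (k * a + l * a') \<cdot>\<^sub>v x + (k * b + l * b') \<cdot>\<^sub>v y" for k l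
    unfolding z w using dx dy by (intro eq_vecI) (simp_all add: algebra_simps)
  define \<Delta> where "\<Delta> = a * b' - a' * b"
  have D: "\<Delta> \<noteq> 0" using D by (simp add: \<Delta>_def)
  \<comment> \<open>Cramer's rule for the inverse change of basis.\<close>
  have 2: "k \<cdot>\<^sub>v x + l \<cdot>\<^sub>v y = ((k * b' - l * a') / \<Delta>) \<cdot>\<^sub>v z + ((l * a - k * b) / \<Delta>) \<cdot>\<^sub>v w" for k l
  proof -
    have "((k * b' - l * a') / \<Delta> * a + (l * a - k * b) / \<Delta> * a') = k * \<Delta> / \<Delta>"
      unfolding \<Delta>_def by (simp add: field_simps add_divide_distrib[symmetric] diff_divide_distrib[symmetric])
    moreover have "((k * b' - l * a') / \<Delta> * b + (l * a - k * b) / \<Delta> * b') = l * \<Delta> / \<Delta>"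
      unfolding \<Delta>_def by (simp add: field_simps add_divide_distrib[symmetric] diff_divide_distrib[symmetric])
    ultimately show ?thesis unfolding 1 using D by simp
  qed
  show "proj_line d z w = proj_line d x y"
    unfolding proj_line_def using 1 2 by (auto, metis)
qed

lemma proj_line_eqI:
  fixes x y :: "'a :: field vec"
  assumes x: "x \<in> homog_vecs d" and y: "y \<in> homog_vecs d"
    and xy: "proj_point x \<noteq> proj_point y"
    and z: "z \<in> homog_vecs d" "proj_point z \<in> proj_line d x y"
    and w: "w \<in> homog_vecs d" "proj_point w \<in> proj_line d x y" and zw: "proj_point z \<noteq> proj_point w"
  obtains c where "c \<noteq> 0" "proj_line d z w = proj_line d x y"
    "\<And>i j. i \<le> d \<Longrightarrow> j \<le> d \<Longrightarrow> pluecker z w i j = c * pluecker x y i j"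
proof -
  obtain a b where ab: "z = a \<cdot>\<^sub>v x + b \<cdot>\<^sub>v y" using z proj_point_in_proj_line_iff[OF x y] by blast
  obtain a' b' where ab': "w = a' \<cdot>\<^sub>v x + b' \<cdot>\<^sub>v y" using w proj_point_in_proj_line_iff[OF x y] by blast
  have dx: "dim_vec x = Suc d" and dy: "dim_vec y = Suc d" using x y homog_vecs_dim by auto
  have pl: "pluecker z w i j = (a * b' - a' * b) * pluecker x y i j" if "i \<le> d" "j \<le> d" for i j
    unfolding pluecker_def ab ab' using that dx dy by (simp add: algebra_simps)
  have "a * b' - a' * b \<noteq> 0"
  proof
    assume "a * b' - a' * b = 0"
    then have "\<forall>j\<le>d. \<forall>i<j. pluecker z w i j = 0" using pl by simp
    then show False using zw proj_point_eq_iff_pluecker[OF z(1) w(1)] by blast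
  qed
  then show ?thesis using that[OF _ proj_line_change_basis(4)[OF x y xy ab ab']] pl by blast
qed

text \<open>Prepares the deformation: as the second basis vector is zero at the pivot
  \<open>i\<close>, moving along it leaves the pivot coordinate of a point alone. The Pluecker
  coordinates are preserved exactly, not just up to a factor.\<close>

lemma proj_line_basis_through:
  fixes x y :: "'a :: field vec"
  assumes x: "x \<in> homog_vecs d" and y: "y \<in> homog_vecs d"
    and xy: "proj_point x \<noteq> proj_point y"
    and z: "z \<in> homog_vecs d" "proj_point z \<in> proj_line d x y" and i: "i \<le> d" "z $ i \<noteq> 0"
  obtains w where "w \<in> homog_vecs d" "w $ i = 0" "proj_point z \<noteq> proj_point w"
    "proj_line d z w = proj_line d x y"
    "\<And>k l. k \<le> d \<Longrightarrow> l \<le> d \<Longrightarrow> pluecker z w k l = pluecker x y k l"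
proof -
  obtain a b where ab: "z = a \<cdot>\<^sub>v x + b \<cdot>\<^sub>v y" using z proj_point_in_proj_line_iff[OF x y] by blast
  have dx: "dim_vec x = Suc d" and dy: "dim_vec y = Suc d" using x y homog_vecs_dim by auto
  have zi: "z $ i = a * x $ i + b * y $ i" using ab dx dy i by simp
  then have "a \<noteq> 0 \<or> b \<noteq> 0" using i(2) by auto
  \<comment> \<open>Complete the coefficient vector of \<open>z\<close> to a matrix of determinant
    1.\<close>
  then have "\<exists>a' b'. a * b' - a' * b = 1"
  proof
    assume "a \<noteq> 0"
    then show ?thesis by (intro exI[of _ 0] exI[of _ "1 / a"]) simp
  next
    assume "b \<noteq> 0"
    then show ?thesis by (intro exI[of _ "- 1 / b"] exI[of _ 0]) simp
  qed
  then obtain a' b' where ab': "a * b' - a' * b = 1" by blast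
  \<comment> \<open>Subtracting \<open>c\<close> times \<open>z\<close> clears the coordinate
    \<open>i\<close> and does not affect the determinant.\<close>
  define c where "c = (a' * x $ i + b' * y $ i) / z $ i"
  define w where "w = (a' - c * a) \<cdot>\<^sub>v x + (b' - c * b) \<cdot>\<^sub>v y"
  have D: "a * (b' - c * b) - (a' - c * a) * b = 1" using ab' by (simp add: algebra_simps)
  have D0: "a * (b' - c * b) - (a' - c * a) * b \<noteq> 0" using D by simp
  have "w $ i = (a' * x $ i + b' * y $ i) - c * z $ i"
    unfolding w_def zi using dx dy i by (simp add: algebra_simps)
  then have "w $ i = 0" using i(2) by (simp add: c_def)
  then show ?thesis
    using that[of w] proj_line_change_basis[OF x y xy ab w_def D0] D by simp
qed

subsection \<open>Polynomials in the coordinates\<close>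

lemma eval_poly_cong:
  assumes "\<And>z. z \<in> poly_vars p \<Longrightarrow> \<phi> z = \<psi> z"
  shows "eval_poly p \<phi> = eval_poly p \<psi>"
  unfolding eval_poly_def
  by (intro sum.cong arg_cong2[of _ _ _ _ "(*)"] prod.cong refl arg_cong[of _ _ "\<lambda>x. x ^ _"] assms)
     (auto simp: poly_vars_def)

lemma eval_poly_curve:
  obtains r :: "'a :: field poly" where "\<And>t. eval_poly p (\<lambda>z. poly (g z) t) = poly r t"
proof
  show "eval_poly p (\<lambda>z. poly (g z) t) = poly (\<Sum>m\<in>Poly_Mapping.keys p. [:Poly_Mapping.lookup p m:] *
        (\<Prod>z\<in>Poly_Mapping.keys m. g z ^ Poly_Mapping.lookup m z)) t" for t
    by (simp add: eval_poly_def poly_sum poly_prod)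
qed

text \<open>Over a finite field, one plus the product of all \<open>X - a\<close> is nonconstant but
  takes only the value 1.\<close>

lemma infinite_UNIV_alg_closed_field: "infinite (UNIV :: 'a :: alg_closed_field set)"
proof
  assume fin: "finite (UNIV :: 'a set)"
  define p where "p = (\<Prod>a\<in>(UNIV :: 'a set). [:- a, 1:]) + 1"
  have "degree (\<Prod>a\<in>(UNIV :: 'a set). [:- a, 1:]) = card (UNIV :: 'a set)"
    by (subst degree_prod_eq_sum_degree) auto
  moreover have "0 < card (UNIV :: 'a set)" using fin by (simp add: card_gt_0_iff)
  ultimately have "0 < degree p" unfolding p_def by (subst degree_add_eq_left) auto
  then obtain z where "poly p z = 0" using alg_closed_imp_poly_has_root by blast
  moreover have "poly (\<Prod>a\<in>(UNIV :: 'a set). [:- a, 1:]) z = 0"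
    using fin by (auto simp: poly_prod prod_zero_iff)
  ultimately show False by (simp add: p_def)
qed

text \<open>A nonzero polynomial has finitely many roots and the field is infinite; this takes the
  place of passing to a limit.\<close>

lemma poly_eq_0_cofinite:
  fixes r :: "'a :: alg_closed_field poly"
  assumes "finite B" "\<And>t. t \<notin> B \<Longrightarrow> poly r t = 0"
  shows "r = 0"
proof (rule ccontr)
  assume "r \<noteq> 0"
  then have "finite (B \<union> {t. poly r t = 0})" using assms(1) poly_roots_finite by blast
  moreover have "B \<union> {t. poly r t = 0} = UNIV" using assms(2) by blast
  ultimately show False using infinite_UNIV_alg_closed_field by metis
qed

text \<open>Only square-free monomials occur, so a monomial is given by its set of variables and its
  degree in a block is a cardinality.\<close>

lemma exists_multihomogeneous:
  fixes c :: "'k \<Rightarrow> 'a :: comm_semiring_1"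
  assumes K: "finite K"
    and Z: "\<And>k. k \<in> K \<Longrightarrow> finite (Z k)"
      "\<And>k. k \<in> K \<Longrightarrow> Z k \<subseteq> (\<Union>v\<in>V. point_coords d v) \<union> (\<Union>e\<in>E. line_coords d e)"
    and hom: "\<And>v. v \<in> V \<Longrightarrow> \<exists>n. \<forall>k\<in>K. card (Z k \<inter> point_coords d v) = n"
      "\<And>e. e \<in> E \<Longrightarrow> \<exists>n. \<forall>k\<in>K. card (Z k \<inter> line_coords d e) = n"
  shows "\<exists>p. multihomogeneous d V E p \<and> (\<forall>\<phi>. eval_poly p \<phi> = (\<Sum>k\<in>K. c k * (\<Prod>z\<in>Z k. \<phi> z)))"
proof -
  define m where "m k = (\<Sum>z\<in>Z k. Poly_Mapping.single z (1 :: nat))" for k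
  have lookup_m: "Poly_Mapping.lookup (m k) z = (if z \<in> Z k then 1 else 0)" if "k \<in> K" for k z
  proof -
    have "Poly_Mapping.lookup (m k) z = (\<Sum>z'\<in>Z k. if z' = z then 1 else 0)"
      unfolding m_def lookup_sum by (intro sum.cong refl) (auto simp: lookup_single)
    then show ?thesis using Z(1)[OF that] by simp
  qed
  have keys_m: "Poly_Mapping.keys (m k) = Z k" if "k \<in> K" for k
    using lookup_m[OF that] by (auto simp: in_keys_iff split: if_splits)
  define p where "p = (\<Sum>k\<in>K. Poly_Mapping.single (m k) (c k))"
  have keys_p: "Poly_Mapping.keys p \<subseteq> m ` K"
    unfolding p_def using keys_sum[of "\<lambda>k. Poly_Mapping.single (m k) (c k)" K] by fastforce
  have degree: "(\<Sum>z\<in>Poly_Mapping.keys (m k) \<inter> A. Poly_Mapping.lookup (m k) z) = card (Z k \<inter> A)"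
    if "k \<in> K" for k A
    by (simp add: keys_m[OF that] lookup_m[OF that])
  have homI: "homogeneous_in A p" if "\<exists>n. \<forall>k\<in>K. card (Z k \<inter> A) = n" for A
    unfolding homogeneous_in_def using that keys_p degree by (metis (no_types, lifting) imageE subsetD)
  have "poly_vars p \<subseteq> (\<Union>v\<in>V. point_coords d v) \<union> (\<Union>e\<in>E. line_coords d e)"
    using keys_p keys_m Z(2) by (fastforce simp: poly_vars_def)
  then have "multihomogeneous d V E p"
    using hom homI by (auto simp: multihomogeneous_def)
  moreover have "eval_poly p \<phi> = (\<Sum>k\<in>K. c k * (\<Prod>z\<in>Z k. \<phi> z))" for \<phi>
  proof -
    let ?mon = "\<lambda>m. \<Prod>z\<in>Poly_Mapping.keys m. \<phi> z ^ Poly_Mapping.lookup m z"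
    have mon: "?mon (m k) = (\<Prod>z\<in>Z k. \<phi> z)" if "k \<in> K" for k
      unfolding keys_m[OF that] by (intro prod.cong refl) (simp add: lookup_m[OF that])
    have "eval_poly p \<phi> = (\<Sum>l\<in>m ` K. Poly_Mapping.lookup p l * ?mon l)"
      unfolding eval_poly_def using K keys_p
      by (intro sum.mono_neutral_left) (auto simp: in_keys_iff)
    \<comment> \<open>\<open>m\<close> need not be injective on \<open>K\<close>, so the
      coefficients of equal monomials have to be collected.\<close>
    also have "\<dots> = (\<Sum>l\<in>m ` K. \<Sum>k\<in>K. if m k = l then c k * ?mon l else 0)"
      unfolding p_def lookup_sum sum_distrib_right
      by (intro sum.cong refl) (simp add: lookup_single when_def)
    also have "\<dots> = (\<Sum>k\<in>K. \<Sum>l\<in>m ` K. if m k = l then c k * ?mon l else 0)"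
      by (rule sum.swap)
    also have "\<dots> = (\<Sum>k\<in>K. c k * ?mon (m k))"
      using K by (intro sum.cong refl) simp
    also have "\<dots> = (\<Sum>k\<in>K. c k * (\<Prod>z\<in>Z k. \<phi> z))"
      by (intro sum.cong refl) (simp only: mon)
    finally show ?thesis .
  qed
  ultimately show ?thesis by blast
qed

subsection \<open>Pictures given by coordinate functions\<close>

definition picture_of ::
    "nat \<Rightarrow> 'v set \<Rightarrow> 'e set \<Rightarrow> ('v \<Rightarrow> nat \<Rightarrow> 'a :: field) \<Rightarrow> ('e \<Rightarrow> nat \<Rightarrow> 'a) \<Rightarrow> ('e \<Rightarrow> nat \<Rightarrow> 'a) \<Rightarrow>
      ('v, 'e, 'a) configuration" where
  "picture_of d V E x a b =
     (\<lambda>v\<in>V. proj_point (vec (Suc d) (x v)), \<lambda>e\<in>E. proj_line d (vec (Suc d) (a e)) (vec (Suc d) (b e)))"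

text \<open>Lines are given by two spanning vectors, so that the Pluecker relations hold by
  construction. Over a commutative ring the same formula serves scalars and polynomials in a curve
  parameter.\<close>

fun coords_of ::
    "('v \<Rightarrow> nat \<Rightarrow> 'a :: comm_ring) \<Rightarrow> ('e \<Rightarrow> nat \<Rightarrow> 'a) \<Rightarrow> ('e \<Rightarrow> nat \<Rightarrow> 'a) \<Rightarrow> ('v, 'e) coord \<Rightarrow> 'a" where
  "coords_of x a b (Point_Coord v i) = x v i"
| "coords_of x a b (Line_Coord e i j) = a e i * b e j - a e j * b e i"

definition nondegenerate_coords :: "nat \<Rightarrow> 'v set \<Rightarrow> 'e set \<Rightarrow> (('v, 'e) coord \<Rightarrow> 'a :: field) \<Rightarrow> bool" where
  "nondegenerate_coords d V E \<phi> \<longleftrightarrow>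
     (\<forall>v\<in>V. \<exists>i\<le>d. \<phi> (Point_Coord v i) \<noteq> 0) \<and> (\<forall>e\<in>E. \<exists>j\<le>d. \<exists>i<j. \<phi> (Line_Coord e i j) \<noteq> 0)"

lemma vec_homog_vecs_iff: "vec (Suc d) f \<in> homog_vecs d \<longleftrightarrow> (\<exists>i\<le>d. f i \<noteq> 0)"
  by (auto simp: homog_vecs_iff)

lemma vec_pluecker:
  "i \<le> d \<Longrightarrow> j \<le> d \<Longrightarrow> pluecker (vec (Suc d) f) (vec (Suc d) g) i j = f i * g j - f j * g i"
  by (simp add: pluecker_def)

lemma independent_vecs:
  assumes "j \<le> d" "i < j" "f i * g j - f j * g i \<noteq> (0 :: 'a :: field)"
  shows "vec (Suc d) f \<in> homog_vecs d" "vec (Suc d) g \<in> homog_vecs d"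
    "proj_point (vec (Suc d) f) \<noteq> proj_point (vec (Suc d) g)"
proof -
  have "f i \<noteq> 0 \<or> f j \<noteq> 0" "g i \<noteq> 0 \<or> g j \<noteq> 0" "i \<le> d" using assms by auto
  then show f: "vec (Suc d) f \<in> homog_vecs d" and g: "vec (Suc d) g \<in> homog_vecs d"
    using assms(1) by (auto simp: vec_homog_vecs_iff)
  have "pluecker (vec (Suc d) f) (vec (Suc d) g) i j \<noteq> 0"
    using assms by (simp add: vec_pluecker)
  then show "proj_point (vec (Suc d) f) \<noteq> proj_point (vec (Suc d) g)"
    using proj_point_eq_iff_pluecker[OF f g] assms(1,2) by blast
qed

lemma picture_of_homog_coords:
  assumes "nondegenerate_coords d V E (coords_of x a b)"
  shows "picture_of d V E x a b \<in> configurations d V E"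
    "homog_coords_of d V E (picture_of d V E x a b) (coords_of x a b)"
proof -
  have V: "vec (Suc d) (x v) \<in> homog_vecs d" if "v \<in> V" for v
    using assms that by (auto simp: nondegenerate_coords_def vec_homog_vecs_iff)
  have E: "vec (Suc d) (a e) \<in> homog_vecs d \<and> vec (Suc d) (b e) \<in> homog_vecs d \<and>
      proj_point (vec (Suc d) (a e)) \<noteq> proj_point (vec (Suc d) (b e))" if e: "e \<in> E" for e
  proof -
    obtain i j where "j \<le> d" "i < j" "a e i * b e j - a e j * b e i \<noteq> 0"
      using assms e unfolding nondegenerate_coords_def coords_of.simps by blast
    then show ?thesis using independent_vecs[of j d i "a e" "b e"] by blast
  qed
  have "proj_line d (vec (Suc d) (a e)) (vec (Suc d) (b e)) \<in> proj_lines d" if "e \<in> E" for e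
    using E[OF that] unfolding proj_lines_def by blast
  then show "picture_of d V E x a b \<in> configurations d V E"
    using V by (auto simp: picture_of_def configurations_def proj_space_def)
  have "\<exists>y\<in>homog_vecs d. \<exists>z\<in>homog_vecs d.
        proj_point y \<noteq> proj_point z \<and> snd (picture_of d V E x a b) e = proj_line d y z \<and>
        (\<forall>j\<le>d. \<forall>i<j. coords_of x a b (Line_Coord e i j) = y $ i * z $ j - y $ j * z $ i)" if e: "e \<in> E" for e
    using E[OF e] e
    by (intro bexI[of _ "vec (Suc d) (a e)"] bexI[of _ "vec (Suc d) (b e)"])
      (auto simp: picture_of_def)
  then show "homog_coords_of d V E (picture_of d V E x a b) (coords_of x a b)"
    using V by (simp add: homog_coords_of_def picture_of_def)
qed

lemma picture_of_in_picture_space: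
  assumes nd: "nondegenerate_coords d V E (coords_of x a b)" and E: "edge_set V E"
    and inc: "\<And>e v. e \<in> E \<Longrightarrow> v \<in> e \<Longrightarrow> \<exists>k l. \<forall>i\<le>d. x v i = k * a e i + l * b e i"
  shows "picture_of d V E x a b \<in> picture_space d V E"
proof -
  have "fst (picture_of d V E x a b) v \<in> snd (picture_of d V E x a b) e" if e: "e \<in> E" "v \<in> e" for e v
  proof -
    have v: "v \<in> V" using edge_setE[OF E e(1)] e(2) by blast
    obtain k l where kl: "\<forall>i\<le>d. x v i = k * a e i + l * b e i" using inc[OF e] by blast
    have eq: "vec (Suc d) (x v) = k \<cdot>\<^sub>v vec (Suc d) (a e) + l \<cdot>\<^sub>v vec (Suc d) (b e)"
      using kl by (intro eq_vecI) auto
    have "vec (Suc d) (x v) \<in> homog_vecs d"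
      using nd v by (auto simp: nondegenerate_coords_def vec_homog_vecs_iff)
    then have "proj_point (vec (Suc d) (x v)) \<in> proj_line d (vec (Suc d) (a e)) (vec (Suc d) (b e))"
      unfolding proj_line_def eq by blast
    then show ?thesis using e v by (simp add: picture_of_def)
  qed
  then show ?thesis using picture_of_homog_coords(1)[OF nd] by (auto simp: picture_space_def)
qed

definition coord_vec :: "nat \<Rightarrow> (('v, 'e) coord \<Rightarrow> 'a) \<Rightarrow> 'v \<Rightarrow> 'a vec" where
  "coord_vec d \<phi> v = vec (Suc d) (\<lambda>i. \<phi> (Point_Coord v i))"

lemma homog_coords_pointD:
  assumes "homog_coords_of d V E P \<phi>" "v \<in> V"
  shows "coord_vec d \<phi> v \<in> homog_vecs d" "fst P v = proj_point (coord_vec d \<phi> v)"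
  using assms by (auto simp: homog_coords_of_def coord_vec_def)

lemma homog_coords_lineE:
  assumes "homog_coords_of d V E P \<phi>" "e \<in> E"
  obtains x y where "x \<in> homog_vecs d" "y \<in> homog_vecs d" "proj_point x \<noteq> proj_point y"
    "snd P e = proj_line d x y" "\<And>i j. i < j \<Longrightarrow> j \<le> d \<Longrightarrow> \<phi> (Line_Coord e i j) = pluecker x y i j"
proof -
  have "\<exists>x\<in>homog_vecs d. \<exists>y\<in>homog_vecs d.
        proj_point x \<noteq> proj_point y \<and> snd P e = proj_line d x y \<and>
        (\<forall>j\<le>d. \<forall>i<j. \<phi> (Line_Coord e i j) = x $ i * y $ j - x $ j * y $ i)"
    using assms unfolding homog_coords_of_def by (elim conjE bspec)
  then show ?thesis by (elim bexE conjE) (rule that; simp add: pluecker_def)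
qed

text \<open>The two ends are different points of the line, so they span it and their brackets are
  proportional to its Pluecker coordinates. The factor \<open>c\<close> depends on the coordinates
  chosen.\<close>

lemma noncollapsed_line_coords:
  assumes \<phi>: "homog_coords_of d V E P \<phi>" and P: "P \<in> picture_space d V E"
    and e: "e \<in> E" "e = {u, v}" "u \<in> V" "v \<in> V" and ne: "fst P u \<noteq> fst P v"
  obtains c where "c \<noteq> 0" "\<And>i j. i < j \<Longrightarrow> j \<le> d \<Longrightarrow> \<phi> (Line_Coord e i j) =
    c * (\<phi> (Point_Coord u i) * \<phi> (Point_Coord v j) - \<phi> (Point_Coord u j) * \<phi> (Point_Coord v i))"
proof -
  obtain x y where xy: "x \<in> homog_vecs d" "y \<in> homog_vecs d" "proj_point x \<noteq> proj_point y"
    "snd P e = proj_line d x y" "\<And>i j. i < j \<Longrightarrow> j \<le> d \<Longrightarrow> \<phi> (Line_Coord e i j) = pluecker x y i j"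
    using homog_coords_lineE[OF \<phi> e(1)] by blast
  note u = homog_coords_pointD[OF \<phi> e(3)] and v = homog_coords_pointD[OF \<phi> e(4)]
  have "fst P u \<in> snd P e" "fst P v \<in> snd P e" using P e by (auto simp: picture_space_def)
  then have "proj_point (coord_vec d \<phi> u) \<in> proj_line d x y" "proj_point (coord_vec d \<phi> v) \<in> proj_line d x y"
    using u v xy(4) by auto
  then obtain c where c: "c \<noteq> 0" and
    pl: "\<And>i j. i \<le> d \<Longrightarrow> j \<le> d \<Longrightarrow> pluecker (coord_vec d \<phi> u) (coord_vec d \<phi> v) i j = c * pluecker x y i j"
    using proj_line_eqI[OF xy(1-3) u(1) _ v(1)] ne u(2) v(2) by metis
  have "\<phi> (Line_Coord e i j) =
    (1 / c) * (\<phi> (Point_Coord u i) * \<phi> (Point_Coord v j) - \<phi> (Point_Coord u j) * \<phi> (Point_Coord v i))"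
    if "i < j" "j \<le> d" for i j
    using pl[of i j] that c xy(5) by (simp add: coord_vec_def vec_pluecker)
  then show ?thesis using that[of "1 / c"] c by simp
qed

definition orientation :: "'v set \<Rightarrow> 'v set set \<Rightarrow> ('v set \<Rightarrow> 'v) \<Rightarrow> ('v set \<Rightarrow> 'v) \<Rightarrow> bool" where
  "orientation V E s t \<longleftrightarrow> (\<forall>e\<in>E. e = {s e, t e} \<and> s e \<in> V \<and> t e \<in> V \<and> s e \<noteq> t e)"

lemma orientationD:
  assumes "orientation V E s t" "e \<in> E"
  shows "e = {s e, t e}" "s e \<in> V" "t e \<in> V" "s e \<noteq> t e"
  using assms unfolding orientation_def by blast+

lemma exists_orientation: "edge_set V E \<Longrightarrow> \<exists>s t. orientation V E s t"
  unfolding edge_set_def orientation_def by metis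

lemma orientation_edge_set: "orientation V E s t \<Longrightarrow> edge_set V E"
  unfolding edge_set_def orientation_def by blast

lemma orientation_subset: "orientation V E s t \<Longrightarrow> F \<subseteq> E \<Longrightarrow> orientation V F s t"
  unfolding orientation_def by blast

subsection \<open>Dense edge sets make the picture space reducible\<close>

text \<open>The walk from \<open>u\<close> to \<open>v\<close> as a 1-chain with boundary
  \<open>v - u\<close>, expressed by pairing with all functions \<open>h\<close>. Edges traversed
  against the orientation count negatively.\<close>

lemma reach_chain:
  assumes "(u, v) \<in> reach T" "finite T" "orientation V T s t"
  shows "\<exists>z :: 'v set \<Rightarrow> 'a :: field. \<forall>h. (\<Sum>e\<in>T. z e * (h (t e) - h (s e))) = h v - h (u :: 'v)"
  using assms(1) unfolding reach_def
proof (induction rule: rtrancl_induct)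
  case base
  then show ?case by (intro exI[of _ "\<lambda>_. 0"]) simp
next
  case (step v w)
  obtain z :: "'v set \<Rightarrow> 'a" where z: "\<And>h. (\<Sum>e\<in>T. z e * (h (t e) - h (s e))) = h v - h u"
    using step.IH by blast
  let ?e = "{v, w}"
  have e: "?e \<in> T" using step.hyps by simp
  have "v = s ?e \<and> w = t ?e \<or> v = t ?e \<and> w = s ?e"
    using orientationD(1)[OF assms(3) e] by (simp only: doubleton_eq_iff)
  then have "\<exists>c :: 'a. \<forall>h. c * (h (t ?e) - h (s ?e)) = h w - h v"
    by (elim disjE) (metis mult_1, metis minus_diff_eq mult_minus1)
  then obtain c :: 'a where c: "\<And>h. c * (h (t ?e) - h (s ?e)) = h w - h v" by blast
  have "(\<Sum>e\<in>T. (z e + (if e = ?e then c else 0)) * (h (t e) - h (s e))) = h w - h u" for h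
  proof -
    have "(\<Sum>e\<in>T. (z e + (if e = ?e then c else 0)) * (h (t e) - h (s e)))
       = (\<Sum>e\<in>T. z e * (h (t e) - h (s e))) + (\<Sum>e\<in>T. if e = ?e then c * (h (t e) - h (s e)) else 0)"
      unfolding sum.distrib[symmetric] by (intro sum.cong refl) (simp add: distrib_right)
    also have "\<dots> = (h v - h u) + (h w - h v)"
      using assms(2) e by (simp only: z sum.delta if_True c)
    finally show ?thesis by simp
  qed
  then show ?case by (intro exI[of _ "\<lambda>e. z e + (if e = ?e then c else 0)"]) simp
qed

text \<open>Each of the two monomials, indexed by a Boolean, has one coordinate at \<open>u\<close>
  and one at \<open>v\<close>, hence the same multidegree.\<close>

lemma exists_bracket_polynomial:
  assumes f: "u \<in> V" "v \<in> V" "u \<noteq> v" and ij: "i < j" "j \<le> d"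
  shows "\<exists>p :: ('v, 'e, 'a :: comm_ring_1) coord_poly. multihomogeneous d V E p \<and> (\<forall>\<phi>. eval_poly p \<phi> =
    \<phi> (Point_Coord u i) * \<phi> (Point_Coord v j) - \<phi> (Point_Coord u j) * \<phi> (Point_Coord v i))"
proof -
  define Z :: "bool \<Rightarrow> ('v, 'e) coord set" where
    "Z k = (if k then {Point_Coord u i, Point_Coord v j} else {Point_Coord u j, Point_Coord v i})" for k
  have pts: "Z k \<inter> point_coords d w =
      (if w = u then {Point_Coord u (if k then i else j)} else if w = v then {Point_Coord v (if k then j else i)} else {})"
    for k w
    using ij f(3) by (auto simp: Z_def point_coords_def)
  have lines: "Z k \<inter> line_coords d e = {}" for k e by (auto simp: Z_def line_coords_def)
  have sub: "Z k \<subseteq> (\<Union>v\<in>V. point_coords d v) \<union> (\<Union>e\<in>E. line_coords d e)" for k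
    using f ij by (auto simp: Z_def point_coords_def)
  have "\<exists>n. \<forall>k\<in>UNIV. card (Z k \<inter> point_coords d w) = n" for w
    by (intro exI[of _ "if w = u \<or> w = v then 1 else 0"]) (simp add: pts)
  moreover have "finite (Z k)" for k by (simp add: Z_def)
  ultimately obtain p :: "('v, 'e, 'a) coord_poly" where p: "multihomogeneous d V E p"
    "\<And>\<phi>. eval_poly p \<phi> = (\<Sum>k\<in>UNIV. (if k then 1 else - 1) * (\<Prod>z\<in>Z k. \<phi> z))"
    using exists_multihomogeneous[where K = "UNIV :: bool set" and Z = Z and d = d and V = V and E = E and c = "\<lambda>k. if k then 1 else - 1"] sub lines
    by auto
  have "eval_poly p \<phi> = \<phi> (Point_Coord u i) * \<phi> (Point_Coord v j) - \<phi> (Point_Coord u j) * \<phi> (Point_Coord v i)" for \<phi>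
    using f(3) by (simp add: p(2) UNIV_bool Z_def)
  then show ?thesis using p(1) by blast
qed

text \<open>In the Leibniz expansion each permutation picks one entry per column, so every term has
  degree one in the line at each edge of \<open>F\<close>. The product over \<open>V\<close> adds
  degree one at each vertex; where the polynomial is nonzero, all points lie in the affine
  chart.\<close>

lemma exists_determinant_polynomial:
  fixes z :: "nat \<Rightarrow> nat \<Rightarrow> 'a :: comm_ring_1"
  assumes V: "finite V" and F: "F \<subseteq> E" and h: "bij_betw h {0..<n} F"
    and colour: "\<And>i. i < n \<Longrightarrow> colour i < d"
  shows "\<exists>p :: ('v, 'e, 'a) coord_poly. multihomogeneous d V E p \<and> (\<forall>\<phi>. eval_poly p \<phi> =
     (\<Prod>v\<in>V. \<phi> (Point_Coord v 0)) *
     det (mat n n (\<lambda>(i, k). z i k * \<phi> (Line_Coord (h k) 0 (Suc (colour i))))))"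
proof -
  define K where "K = {p. p permutes {0..<n}}"
  define L :: "(nat \<Rightarrow> nat) \<Rightarrow> nat \<Rightarrow> ('v, 'e) coord" where
    "L p i = Line_Coord (h (p i)) 0 (Suc (colour i))" for p i
  define Z where "Z p = (\<lambda>v. Point_Coord v 0) ` V \<union> L p ` {0..<n}" for p
  have perm: "bij_betw (\<lambda>i. h (p i)) {0..<n} F" if "p \<in> K" for p
    using bij_betw_trans[OF permutes_imp_bij h, of p] that by (simp add: K_def o_def)
  have inj_L: "inj_on (L p) {0..<n}" if "p \<in> K" for p
    using bij_betw_imp_inj_on[OF perm[OF that]] by (auto simp: inj_on_def L_def)
  have pts: "Z p \<inter> point_coords d v = {Point_Coord v 0}" if "v \<in> V" for p v
    using that by (auto simp: Z_def L_def point_coords_def)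
  have L_iff: "L p i \<in> line_coords d e \<longleftrightarrow> h (p i) = e" if "i < n" for p i e
    using colour[OF that] unfolding L_def line_coords_def by (simp add: Suc_le_eq)
  have Point_notin: "(\<lambda>v. Point_Coord v 0) ` V \<inter> line_coords d e = {}" for e :: 'e
    by (auto simp: line_coords_def)
  have Z_lines: "Z p \<inter> line_coords d e = L p ` {i \<in> {0..<n}. h (p i) = e}" for p e
  proof -
    have "L p ` {0..<n} \<inter> line_coords d e = L p ` {i \<in> {0..<n}. L p i \<in> line_coords d e}" by blast
    also have "{i \<in> {0..<n}. L p i \<in> line_coords d e} = {i \<in> {0..<n}. h (p i) = e}"
      by (intro Collect_cong) (simp add: L_iff cong: conj_cong)
    finally show ?thesis by (simp add: Z_def Int_Un_distrib2 Point_notin)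
  qed
  have lines: "card (Z p \<inter> line_coords d e) = (if e \<in> F then 1 else 0)" if pK: "p \<in> K" for p e
  proof -
    have "card (Z p \<inter> line_coords d e) = card {i \<in> {0..<n}. h (p i) = e}"
      unfolding Z_lines by (intro card_image inj_on_subset[OF inj_L[OF pK]]) blast
    moreover have "{i \<in> {0..<n}. h (p i) = e} = {}" if "e \<notin> F"
      using perm[OF pK] that unfolding bij_betw_def by blast
    moreover have "card {i \<in> {0..<n}. h (p i) = e} = 1" if "e \<in> F"
    proof -
      obtain i where "i \<in> {0..<n}" "h (p i) = e" using perm[OF pK] \<open>e \<in> F\<close> unfolding bij_betw_def by blast
      then have "{i \<in> {0..<n}. h (p i) = e} = {i}"
        using bij_betw_imp_inj_on[OF perm[OF pK]] unfolding inj_on_def by blast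
      then show ?thesis by simp
    qed
    ultimately show ?thesis by simp
  qed
  have sub: "Z p \<subseteq> (\<Union>v\<in>V. point_coords d v) \<union> (\<Union>e\<in>E. line_coords d e)" if pK: "p \<in> K" for p
  proof -
    have "h (p i) \<in> E" if "i < n" for i using perm[OF pK] that F by (auto simp: bij_betw_def)
    then have "L p i \<in> (\<Union>e\<in>E. line_coords d e)" if "i < n" for i
      using colour[OF that] that by (auto simp: L_def line_coords_def Suc_le_eq)
    then show ?thesis by (auto simp: Z_def point_coords_def)
  qed
  have "finite K" unfolding K_def by (simp add: finite_permutations)
  moreover have "finite (Z p)" for p using V by (simp add: Z_def)
  moreover have "\<exists>m. \<forall>p\<in>K. card (Z p \<inter> point_coords d v) = m" if "v \<in> V" for v
    using pts[OF that] by auto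
  moreover have "\<exists>m. \<forall>p\<in>K. card (Z p \<inter> line_coords d e) = m" for e
    using lines by blast
  ultimately obtain q :: "('v, 'e, 'a) coord_poly" where q: "multihomogeneous d V E q"
    "\<And>\<phi>. eval_poly q \<phi> = (\<Sum>p\<in>K. (signof p * (\<Prod>i = 0..<n. z i (p i))) * (\<Prod>c\<in>Z p. \<phi> c))"
    using exists_multihomogeneous[where K = K and Z = Z and V = V and d = d and E = E and c = "\<lambda>p. signof p * (\<Prod>i = 0..<n. z i (p i))"] sub by blast
  have prod_Z: "(\<Prod>c\<in>Z p. \<phi> c) = (\<Prod>v\<in>V. \<phi> (Point_Coord v 0)) *
      (\<Prod>i = 0..<n. \<phi> (Line_Coord (h (p i)) 0 (Suc (colour i))))" if "p \<in> K" for p and \<phi> :: "('v, 'e) coord \<Rightarrow> 'a"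
  proof -
    have "(\<Prod>c\<in>Z p. \<phi> c) = (\<Prod>c\<in>(\<lambda>v. Point_Coord v 0) ` V. \<phi> c) * (\<Prod>c\<in>L p ` {0..<n}. \<phi> c)"
      unfolding Z_def using V by (intro prod.union_disjoint) (auto simp: L_def)
    also have "(\<Prod>c\<in>(\<lambda>v. Point_Coord v 0) ` V. \<phi> c) = (\<Prod>v\<in>V. \<phi> (Point_Coord v 0))"
      by (subst prod.reindex) (auto simp: inj_on_def)
    also have "(\<Prod>c\<in>L p ` {0..<n}. \<phi> c) = (\<Prod>i = 0..<n. \<phi> (L p i))"
      by (subst prod.reindex[OF inj_L[OF that]]) simp
    finally show ?thesis by (simp add: L_def)
  qed
  have "eval_poly q \<phi> = (\<Prod>v\<in>V. \<phi> (Point_Coord v 0)) *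
     det (mat n n (\<lambda>(i, k). z i k * \<phi> (Line_Coord (h k) 0 (Suc (colour i)))))" for \<phi>
  proof -
    have "p i < n" if "p \<in> K" "i < n" for p i
      using that permutes_in_image[of p "{0..<n}" i] by (simp add: K_def)
    note less = this[unfolded K_def, simplified]
    have det: "det (mat n n (\<lambda>(i, k). z i k * \<phi> (Line_Coord (h k) 0 (Suc (colour i))))) =
       (\<Sum>p\<in>K. signof p * (\<Prod>i = 0..<n. z i (p i) * \<phi> (Line_Coord (h (p i)) 0 (Suc (colour i)))))"
      unfolding K_def by (subst det_def'[where n = n])
        (auto simp: less intro!: sum.cong prod.cong arg_cong2[of _ _ _ _ "(*)"])
    show ?thesis
      unfolding q(2) det sum_distrib_left by (auto intro!: sum.cong simp: prod_Z prod.distrib mult_ac)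
  qed
  then show ?thesis using q(1) by blast
qed

text \<open>In an affine picture the differences of affine coordinates along the edges of \<open>F\<close> satisfy
  the linear system with matrix \<open>z e f * q f\<close>, where \<open>q f\<close> is the component of the direction of
  the line at \<open>f\<close> in the coordinate given by the colour of \<open>e\<close>.  Its determinant thus vanishes unless
  all edges of \<open>F\<close> are collapsed, whereas it is \<open>1\<close> for a totally collapsed picture in which the
  line at \<open>f\<close> is parallel to the coordinate axis given by the colour of \<open>f\<close>.\<close>

lemma reducible_if_coloured:
  assumes V: "finite V" and E: "edge_set V E" and F: "F \<subseteq> E" "F \<noteq> {}"
    and colour_less: "\<And>e. e \<in> F \<Longrightarrow> colour e < d"
    and colour: "\<And>e a b. e \<in> F \<Longrightarrow> e = {a, b} \<Longrightarrow> (a, b) \<in> reach {f \<in> F. colour f \<noteq> colour e}"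
  shows "\<not> zariski_irreducible d V E (picture_space d V E :: ('v, 'v set, 'a :: field) configuration set)"
proof
  let ?X = "picture_space d V E :: ('v, 'v set, 'a) configuration set"
  assume irr: "zariski_irreducible d V E ?X"
  obtain s t where st: "orientation V E s t" using exists_orientation[OF E] by blast
  have stO: "orientation V F s t" using st F(1) by (rule orientation_subset)
  note stF = orientationD[OF stO]
  have finF: "finite F" using edge_set_finite[OF E V] F(1) by (rule finite_subset[rotated])
  \<comment> \<open>The edge \<open>e\<close> is closed up to a cycle by a chain from
    \<open>t e\<close> to \<open>s e\<close> that avoids the colour of \<open>e\<close>; cycles
    annihilate differences of functions on the vertices.\<close>
  have "\<exists>z :: 'v set \<Rightarrow> 'a. z e = 1 \<and> (\<forall>f\<in>F. f \<noteq> e \<and> colour f = colour e \<longrightarrow> z f = 0) \<and>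
      (\<forall>h. (\<Sum>f\<in>F. z f * (h (t f) - h (s f))) = 0)" if e: "e \<in> F" for e
  proof -
    let ?T = "{f \<in> F. colour f \<noteq> colour e}"
    have "e = {t e, s e}"
      using stF(1)[OF e] insert_commute[of "s e" "t e" "{}"] by (rule trans)
    then have te: "(t e, s e) \<in> reach ?T" by (rule colour[OF e])
    have T: "finite ?T" "orientation V ?T s t"
      using finF by (auto intro: orientation_subset[OF stO])
    obtain z :: "'v set \<Rightarrow> 'a" where z: "\<And>h. (\<Sum>f\<in>?T. z f * (h (t f) - h (s f))) = h (s e) - h (t e)"
      using reach_chain[OF te T, where ?'a = 'a] by blast
    define z' where "z' f = (if f = e then 1 else if colour f = colour e then 0 else z f)" for f
    have "(\<Sum>f\<in>F. z' f * (h (t f) - h (s f))) = 0" for h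
    proof -
      have "(\<Sum>f\<in>F. z' f * (h (t f) - h (s f))) = (\<Sum>f\<in>insert e ?T. z' f * (h (t f) - h (s f)))"
        using finF e by (intro sum.mono_neutral_right) (auto simp: z'_def)
      also have "\<dots> = (h (t e) - h (s e)) + (\<Sum>f\<in>?T. z' f * (h (t f) - h (s f)))"
        using finF by (subst sum.insert) (auto simp: z'_def)
      also have "(\<Sum>f\<in>?T. z' f * (h (t f) - h (s f))) = (\<Sum>f\<in>?T. z f * (h (t f) - h (s f)))"
        by (intro sum.cong refl) (auto simp: z'_def)
      finally show ?thesis by (simp add: z)
    qed
    then show ?thesis by (intro exI[of _ z']) (auto simp: z'_def)
  qed
  then obtain z :: "'v set \<Rightarrow> 'v set \<Rightarrow> 'a" where z_diag: "\<And>e. e \<in> F \<Longrightarrow> z e e = 1"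
    and z_off: "\<And>e f. e \<in> F \<Longrightarrow> f \<in> F \<Longrightarrow> f \<noteq> e \<Longrightarrow> colour f = colour e \<Longrightarrow> z e f = 0"
    and z_cycle: "\<And>e h. e \<in> F \<Longrightarrow> (\<Sum>f\<in>F. z e f * (h (t f) - h (s f))) = 0"
    by metis
  define n where "n = card F"
  obtain h where h: "bij_betw h {0..<n} F" using ex_bij_betw_nat_finite[OF finF] n_def by blast
  have hF: "h i \<in> F" if "i < n" for i using h that by (auto simp: bij_betw_def)
  \<comment> \<open>Row \<open>i\<close> is the cycle equation of the edge \<open>h i\<close>, read
    in the affine coordinate given by its colour; the coordinates
    \<open>Line_Coord f 0 (Suc j)\<close> form the direction of the line at
    \<open>f\<close>.\<close>
  define M where "M \<phi> = mat n n (\<lambda>(i, k). z (h i) (h k) * \<phi> (Line_Coord (h k) 0 (Suc (colour (h i)))))"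
    for \<phi> :: "('v, 'v set) coord \<Rightarrow> 'a"
  obtain p :: "('v, 'v set, 'a) coord_poly" where p: "multihomogeneous d V E p"
    "\<And>\<phi>. eval_poly p \<phi> = (\<Prod>v\<in>V. \<phi> (Point_Coord v 0)) * det (M \<phi>)"
    using exists_determinant_polynomial[OF V F(1) h, of "\<lambda>i. colour (h i)" d "\<lambda>i k. z (h i) (h k)"]
      colour_less hF unfolding M_def by blast
  \<comment> \<open>The brackets of the ends of all edges in \<open>F\<close> cut out the pictures
    in which \<open>F\<close> is collapsed.\<close>
  define S where "S = {q :: ('v, 'v set, 'a) coord_poly. multihomogeneous d V E q \<and> (\<exists>f\<in>F. \<exists>j\<le>d. \<exists>i<j. \<forall>\<phi>. eval_poly q \<phi> =
    \<phi> (Point_Coord (s f) i) * \<phi> (Point_Coord (t f) j) - \<phi> (Point_Coord (s f) j) * \<phi> (Point_Coord (t f) i))}"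
  let ?A = "zero_locus d V E {p}" and ?B = "zero_locus d V E S"
  have "\<forall>q\<in>S. multihomogeneous d V E q" by (simp add: S_def)
  then have closed: "zariski_closed d V E ?A" "zariski_closed d V E ?B"
    unfolding zariski_closed_def using p(1) by blast+
  have cover: "?X \<subseteq> ?A \<union> ?B"
  proof
    fix P assume P: "P \<in> ?X"
    then have conf: "P \<in> configurations d V E" by (simp add: picture_space_def)
    show "P \<in> ?A \<union> ?B"
    proof (rule ccontr)
      assume no: "P \<notin> ?A \<union> ?B"
      obtain \<phi> where \<phi>: "homog_coords_of d V E P \<phi>" "eval_poly p \<phi> \<noteq> 0"
        using no conf by (auto simp: zero_locus_def)
      have det: "det (M \<phi>) \<noteq> 0" using \<phi>(2) p(2) by auto
      have x0: "\<phi> (Point_Coord v 0) \<noteq> 0" if "v \<in> V" for v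
        using \<phi>(2) p(2)[of \<phi>] that V by (auto simp: prod_zero_iff)
      have "\<exists>f\<in>F. fst P (s f) \<noteq> fst P (t f)"
      proof (rule ccontr)
        assume eq: "\<not> ?thesis"
        have "eval_poly q \<psi> = 0" if q: "q \<in> S" and \<psi>: "homog_coords_of d V E P \<psi>" for q \<psi>
        proof -
          obtain f i j where f: "f \<in> F" "j \<le> d" "i < j" "eval_poly q \<psi> =
            \<psi> (Point_Coord (s f) i) * \<psi> (Point_Coord (t f) j) - \<psi> (Point_Coord (s f) j) * \<psi> (Point_Coord (t f) i)"
            using q unfolding S_def by blast
          note u = homog_coords_pointD[OF \<psi> stF(2)[OF f(1)]] and v = homog_coords_pointD[OF \<psi> stF(3)[OF f(1)]]
          have "proj_point (coord_vec d \<psi> (s f)) = proj_point (coord_vec d \<psi> (t f))"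
            using eq f(1) u(2) v(2) by auto
          then have "pluecker (coord_vec d \<psi> (s f)) (coord_vec d \<psi> (t f)) i j = 0"
            using proj_point_eq_iff_pluecker[OF u(1) v(1)] f(2,3) by blast
          then show ?thesis using f(2-4) by (simp add: coord_vec_def vec_pluecker)
        qed
        then show False using no conf by (auto simp: zero_locus_def)
      qed
      then obtain f0 where f0: "f0 \<in> F" "fst P (s f0) \<noteq> fst P (t f0)" by blast
      define w where "w j v = \<phi> (Point_Coord v j) / \<phi> (Point_Coord v 0)" for j v
      \<comment> \<open>\<open>\<alpha>\<close> measures the affine difference of the ends in units
        of the line direction: 0 if they coincide, and otherwise the reciprocal of the Pluecker
        factor times the two coordinates with index 0.\<close>
      have "\<exists>\<alpha>. (\<forall>j<d. \<phi> (Line_Coord f 0 (Suc j)) * \<alpha> = w (Suc j) (t f) - w (Suc j) (s f)) \<and>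
          (fst P (s f) \<noteq> fst P (t f) \<longrightarrow> \<alpha> \<noteq> 0)" if f: "f \<in> F" for f
      proof (cases "fst P (s f) = fst P (t f)")
        case True
        note u = homog_coords_pointD[OF \<phi>(1) stF(2)[OF f]] and v = homog_coords_pointD[OF \<phi>(1) stF(3)[OF f]]
        obtain c where c: "c \<noteq> 0" "coord_vec d \<phi> (s f) = c \<cdot>\<^sub>v coord_vec d \<phi> (t f)"
          using proj_point_eqD[OF _ u(1) v(1)] True u(2) v(2) by auto
        have "\<phi> (Point_Coord (s f) j) = c * \<phi> (Point_Coord (t f) j)" if "j \<le> d" for j
          using arg_cong[OF c(2), of "\<lambda>v. v $ j"] that by (simp add: coord_vec_def)
        then have "w (Suc j) (s f) = w (Suc j) (t f)" if "j < d" for j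
          using that c(1) unfolding w_def by simp
        then show ?thesis using True by (intro exI[of _ 0]) simp
      next
        case False
        obtain c where c: "c \<noteq> 0" "\<And>i j. i < j \<Longrightarrow> j \<le> d \<Longrightarrow> \<phi> (Line_Coord f i j) =
            c * (\<phi> (Point_Coord (s f) i) * \<phi> (Point_Coord (t f) j) - \<phi> (Point_Coord (s f) j) * \<phi> (Point_Coord (t f) i))"
          using noncollapsed_line_coords[OF \<phi>(1) P _ stF(1-3)[OF f] False] f F(1) by blast
        have nz: "\<phi> (Point_Coord (s f) 0) \<noteq> 0" "\<phi> (Point_Coord (t f) 0) \<noteq> 0" using x0 stF(2,3)[OF f] by auto
        have "\<phi> (Line_Coord f 0 (Suc j)) * (1 / (c * \<phi> (Point_Coord (s f) 0) * \<phi> (Point_Coord (t f) 0))) =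
            w (Suc j) (t f) - w (Suc j) (s f)" if "j < d" for j
          by (subst c(2)) (use that nz c(1) in \<open>simp_all add: w_def field_simps\<close>)
        then show ?thesis
          using nz c(1) by (intro exI[of _ "1 / (c * \<phi> (Point_Coord (s f) 0) * \<phi> (Point_Coord (t f) 0))"]) simp
      qed
      then obtain \<alpha> where \<alpha>: "\<And>f j. f \<in> F \<Longrightarrow> j < d \<Longrightarrow> \<phi> (Line_Coord f 0 (Suc j)) * \<alpha> f = w (Suc j) (t f) - w (Suc j) (s f)"
        and \<alpha>0: "\<And>f. f \<in> F \<Longrightarrow> fst P (s f) \<noteq> fst P (t f) \<Longrightarrow> \<alpha> f \<noteq> 0" by metis
      define a where "a = vec n (\<lambda>k. \<alpha> (h k))"
      have "M \<phi> *\<^sub>v a = 0\<^sub>v n"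
      proof (rule eq_vecI)
        fix i assume "i < dim_vec (0\<^sub>v n :: 'a vec)"
        then have i: "i < n" by simp
        have "(M \<phi> *\<^sub>v a) $ i = (\<Sum>k = 0..<n. z (h i) (h k) * \<phi> (Line_Coord (h k) 0 (Suc (colour (h i)))) * \<alpha> (h k))"
          using i by (simp add: M_def a_def scalar_prod_def)
        also have "\<dots> = (\<Sum>f\<in>F. z (h i) f * \<phi> (Line_Coord f 0 (Suc (colour (h i)))) * \<alpha> f)"
          by (rule sum.reindex_bij_betw[OF h])
        also have "\<dots> = (\<Sum>f\<in>F. z (h i) f * (w (Suc (colour (h i))) (t f) - w (Suc (colour (h i))) (s f)))"
          using \<alpha> colour_less[OF hF[OF i]] by (intro sum.cong refl) (simp add: mult.assoc)
        also have "\<dots> = 0" by (rule z_cycle[OF hF[OF i]])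
        finally show "(M \<phi> *\<^sub>v a) $ i = 0\<^sub>v n $ i" using i by simp
      qed (simp add: M_def)
      moreover have "a \<noteq> 0\<^sub>v n"
      proof -
        obtain k where k: "k < n" "h k = f0" using f0(1) h by (auto simp: bij_betw_def image_iff)
        then have "a $ k \<noteq> 0" using \<alpha>0[OF f0] by (simp add: a_def)
        then show ?thesis using k(1) by auto
      qed
      moreover have "a \<in> carrier_vec n" by (simp add: a_def)
      ultimately show False
        using det det_0_iff_vec_prod_zero[of "M \<phi>" n] by (auto simp: M_def)
    qed
  qed
  obtain f0 where f0: "f0 \<in> F" using F(2) by blast
  have d: "1 \<le> d" using colour_less[OF f0] by simp
  have not_A: "\<not> ?X \<subseteq> ?A"
  proof
    assume sub: "?X \<subseteq> ?A"
    define o' :: "nat \<Rightarrow> 'a" where "o' i = (if i = 0 then 1 else 0)" for i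
    define x where "x = (\<lambda>v :: 'v. o')"
    define a where "a = (\<lambda>e :: 'v set. o')"
    \<comment> \<open>Edges outside \<open>F\<close> get the first axis, which exists as
      \<open>d \<ge> 1\<close>.\<close>
    define b where "b = (\<lambda>(e :: 'v set) i. if i = Suc (if e \<in> F then colour e else 0) then 1 else 0 :: 'a)"
    have nd: "nondegenerate_coords d V E (coords_of x a b)"
    proof -
      have "coords_of x a b (Line_Coord e 0 (Suc (if e \<in> F then colour e else 0))) \<noteq> 0" for e
        by (simp add: a_def b_def o'_def)
      moreover have "Suc (if e \<in> F then colour e else 0) \<le> d" for e using colour_less[of e] d by auto
      moreover have "coords_of x a b (Point_Coord v 0) \<noteq> 0" for v by (simp add: x_def o'_def)
      ultimately show ?thesis unfolding nondegenerate_coords_def by blast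
    qed
    have "picture_of d V E x a b \<in> ?X"
      by (rule picture_of_in_picture_space[OF nd E])
        (intro exI[of _ 1] exI[of _ 0], simp add: x_def a_def)
    then have "eval_poly p (coords_of x a b) = 0"
      using sub picture_of_homog_coords(2)[OF nd] by (auto simp: zero_locus_def)
    moreover have "M (coords_of x a b) = 1\<^sub>m n"
    proof (rule eq_matI)
      fix i k assume "i < dim_row (1\<^sub>m n :: 'a mat)" "k < dim_col (1\<^sub>m n :: 'a mat)"
      then have ik: "i < n" "k < n" by auto
      show "M (coords_of x a b) $$ (i, k) = 1\<^sub>m n $$ (i, k)"
      proof (cases "i = k")
        case True
        then show ?thesis using ik z_diag[OF hF[OF ik(1)]] hF[OF ik(2)] by (simp add: M_def a_def b_def o'_def)
      next
        \<comment> \<open>Either the colours agree and \<open>z\<close> vanishes, or they differ and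
          the line at \<open>h k\<close> has no component along the axis of row
          \<open>i\<close>.\<close>
        case False
        then have "h k \<noteq> h i" using h ik by (auto simp: bij_betw_def inj_on_def)
        then show ?thesis
          using False ik z_off[OF hF[OF ik(1)] hF[OF ik(2)]] hF[OF ik(2)]
          by (cases "colour (h k) = colour (h i)") (simp_all add: M_def a_def b_def o'_def)
      qed
    qed (simp_all add: M_def)
    moreover have "(\<Prod>v\<in>V. coords_of x a b (Point_Coord v 0)) = 1" by (simp add: x_def o'_def)
    ultimately show False using p(2)[of "coords_of x a b"] by simp
  qed
  have not_B: "\<not> ?X \<subseteq> ?B"
  proof
    assume sub: "?X \<subseteq> ?B"
    \<comment> \<open>All lines coincide; \<open>s f0\<close> sits at one point of the common line
      and all other vertices at a second one, so \<open>f0\<close> is not collapsed.\<close>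
    define a where "a = (\<lambda>(e :: 'v set) (i :: nat). if i = 0 then 1 else 0 :: 'a)"
    define b where "b = (\<lambda>(e :: 'v set) (i :: nat). if i = 1 then 1 else 0 :: 'a)"
    define x where "x = (\<lambda>(v :: 'v) (i :: nat). if v = s f0 then (if i = 0 then 1 else 0) else (if i = 1 then 1 else 0) :: 'a)"
    have nd: "nondegenerate_coords d V E (coords_of x a b)"
    proof -
      have "coords_of x a b (Line_Coord e 0 1) \<noteq> 0" for e
        by (simp add: a_def b_def)
      moreover have "coords_of x a b (Point_Coord v (if v = s f0 then 0 else 1)) \<noteq> 0" for v by (simp add: x_def)
      ultimately show ?thesis using d unfolding nondegenerate_coords_def
        by (metis less_numeral_extra(1) zero_le)
    qed
    have "\<exists>k l. \<forall>i\<le>d. x v i = k * a e i + l * b e i" for e v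
    proof (cases "v = s f0")
      case True
      then show ?thesis by (intro exI[of _ 1] exI[of _ 0]) (simp add: x_def a_def)
    next
      case False
      then show ?thesis by (intro exI[of _ 0] exI[of _ 1]) (simp add: x_def b_def)
    qed
    then have "picture_of d V E x a b \<in> ?X"
      by (intro picture_of_in_picture_space[OF nd E])
    then have B: "eval_poly q (coords_of x a b) = 0" if "q \<in> S" for q
      using sub picture_of_homog_coords(2)[OF nd] that by (auto simp: zero_locus_def)
    obtain q :: "('v, 'v set, 'a) coord_poly" where q: "multihomogeneous d V E q" "\<And>\<phi>. eval_poly q \<phi> =
      \<phi> (Point_Coord (s f0) 0) * \<phi> (Point_Coord (t f0) 1) - \<phi> (Point_Coord (s f0) 1) * \<phi> (Point_Coord (t f0) 0)"
      using exists_bracket_polynomial[OF stF(2-4)[OF f0], of 0 1 d E] d by auto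
    have "q \<in> S" unfolding S_def using q f0 d by (intro CollectI conjI bexI[of _ f0] exI[of _ 1] exI[of _ 0]) auto
    from B[OF this] show False using q(2) stF(4)[OF f0] by (simp add: x_def)
  qed
  show False using irr closed cover not_A not_B unfolding zariski_irreducible_def by blast
qed

text \<open>A dense set of least cardinality has no dense proper nonempty subset, which is the
  sparsity that the colouring needs.\<close>

lemma reducible_if_dense:
  assumes V: "finite V" and E: "edge_set V E" and d: "0 < d"
    and "\<exists>F\<subseteq>E. F \<noteq> {} \<and> int (card F) \<le> int d * nullity V F"
  shows "\<not> zariski_irreducible d V E (picture_space d V E :: ('v, 'v set, 'a :: field) configuration set)"
proof -
  define P where "P F \<longleftrightarrow> F \<subseteq> E \<and> F \<noteq> {} \<and> int (card F) \<le> int d * nullity V F" for F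
  obtain F0 where "P F0" using assms(4) P_def by blast
  then obtain F where F: "P F" and min: "\<And>T. P T \<Longrightarrow> card F \<le> card T"
    using ex_has_least_nat[of P F0 card] by blast
  have FE: "F \<subseteq> E" "F \<noteq> {}" "int (card F) \<le> int d * nullity V F" using F by (auto simp: P_def)
  have EF: "edge_set V F" by (rule edge_set_subset[OF E FE(1)])
  have finF: "finite F" by (rule edge_set_finite[OF EF V])
  have "int d * nullity V T \<le> int (card T)" if T: "T \<subset> F" for T
  proof (cases "T = {}")
    case True
    then show ?thesis by (simp add: nullity_empty)
  next
    case False
    have "\<not> P T" using min[of T] psubset_card_mono[OF finF T] by auto
    then show ?thesis using False T FE(1) by (auto simp: P_def)
  qed
  then obtain colour where "\<forall>e\<in>F. colour e < d \<and> (\<forall>a b. e = {a, b} \<longrightarrow> (a, b) \<in> reach {f \<in> F. colour f \<noteq> colour e})"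
    using coconnected_colouring[OF V EF FE(3)] by blast
  then show ?thesis by (intro reducible_if_coloured[OF V E FE(1,2), of colour]) auto
qed

subsection \<open>Deformations of degenerate pictures\<close>

lemma exists_nontrivial_solution:
  fixes A :: "'j \<Rightarrow> 'i \<Rightarrow> 'a :: field"
  assumes "finite J" "finite I" "card J < card I"
  shows "\<exists>x. (\<exists>i\<in>I. x i \<noteq> 0) \<and> (\<forall>j\<in>J. (\<Sum>i\<in>I. A j i * x i) = 0)"
  using assms
proof (induction J arbitrary: I A rule: finite_induct)
  case empty
  then have "I \<noteq> {}" by auto
  then show ?case by (intro exI[of _ "\<lambda>_. 1"]) auto
next
  case (insert j J)
  show ?case
  proof (cases "\<forall>i\<in>I. A j i = 0")
    case True
    have "card J < card I" using insert.prems insert.hyps by simp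
    from insert.IH[OF insert.prems(1) this, of A] True show ?thesis by auto
  next
    case False
    then obtain i0 where i0: "i0 \<in> I" "A j i0 \<noteq> 0" by blast
    let ?I = "I - {i0}"
    have "finite ?I" "card J < card ?I" using insert.prems insert.hyps i0(1) by auto
    from insert.IH[OF this, of "\<lambda>k i. A k i - A k i0 / A j i0 * A j i"]
    obtain x where x: "\<exists>i\<in>?I. x i \<noteq> 0"
      "\<And>k. k \<in> J \<Longrightarrow> (\<Sum>i\<in>?I. (A k i - A k i0 / A j i0 * A j i) * x i) = 0" by blast
    define T where "T k = (\<Sum>i\<in>?I. A k i * x i)" for k
    \<comment> \<open>Back-substitution for the pivot unknown \<open>i0\<close>, which was
      eliminated from the other equations.\<close>
    define x' where "x' = x(i0 := - T j / A j i0)"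
    have sum: "(\<Sum>i\<in>I. A k i * x' i) = T k - A k i0 / A j i0 * T j" for k
    proof -
      have "(\<Sum>i\<in>I. A k i * x' i) = A k i0 * x' i0 + (\<Sum>i\<in>?I. A k i * x' i)"
        using insert.prems(1) i0(1) by (rule sum.remove)
      also have "(\<Sum>i\<in>?I. A k i * x' i) = T k"
        unfolding T_def by (intro sum.cong refl) (auto simp: x'_def)
      finally show ?thesis by (simp add: x'_def)
    qed
    have "T k - A k i0 / A j i0 * T j = 0" if "k \<in> J" for k
      using x(2)[OF that]
      by (simp add: T_def left_diff_distrib sum_subtractf sum_distrib_left mult.assoc)
    then have "\<forall>k\<in>insert j J. (\<Sum>i\<in>I. A k i * x' i) = 0"
      using i0(2) by (simp add: sum)
    moreover have "\<exists>i\<in>I. x' i \<noteq> 0" using x(1) by (auto simp: x'_def)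
    ultimately show ?thesis by blast
  qed
qed

lemma exists_representatives:
  assumes "finite V"
  shows "\<exists>R\<subseteq>V. card R = comps V F \<and> (\<forall>v\<in>V. \<exists>r\<in>R. (v, r) \<in> reach F)"
proof -
  have "\<forall>C\<in>V // reach F. \<exists>v\<in>V. reach F `` {v} = C" by (auto simp: quotient_eq_image)
  then obtain f where f: "\<And>C. C \<in> V // reach F \<Longrightarrow> f C \<in> V" "\<And>C. C \<in> V // reach F \<Longrightarrow> reach F `` {f C} = C"
    by metis
  have "inj_on f (V // reach F)" by (rule inj_on_inverseI[of _ "\<lambda>v. reach F `` {v}"]) (rule f(2))
  then have "card (f ` (V // reach F)) = comps V F" by (simp add: card_image comps_def)
  moreover have "\<exists>r\<in>f ` (V // reach F). (v, r) \<in> reach F" if "v \<in> V" for v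
  proof -
    have v: "reach F `` {v} \<in> V // reach F" using that by (auto simp: quotient_eq_image)
    have "(v, f (reach F `` {v})) \<in> reach F"
      using f(2)[OF v] reach_class_eq_iff[of F v "f (reach F `` {v})"] by simp
    then show ?thesis using v by blast
  qed
  ultimately show ?thesis using f(1) by (intro exI[of _ "f ` (V // reach F)"]) auto
qed

text \<open>Fixing one vertex in each component leaves \<open>d * (card V - comps V F) + card F\<close> unknowns for
  \<open>d * card F\<close> equations.\<close>

lemma exists_deformation:
  fixes y :: "'v set \<Rightarrow> nat \<Rightarrow> 'a :: field"
  assumes V: "finite V" and st: "orientation V F s t"
    and J: "\<And>v. finite (J v)" "\<And>v. v \<in> V \<Longrightarrow> card (J v) = d"
      "\<And>e. e \<in> F \<Longrightarrow> J (s e) = J (t e)"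
    and sparse: "int d * nullity V F < int (card F)"
  shows "\<exists>\<delta> \<alpha>. (\<forall>v j. j \<notin> J v \<longrightarrow> \<delta> v j = 0) \<and>
    (\<forall>e\<in>F. \<forall>j\<in>J (s e). \<delta> (s e) j - \<delta> (t e) j = \<alpha> e * y e j) \<and> (\<exists>e\<in>F. \<alpha> e \<noteq> 0)"
proof -
  note stF = orientationD[OF st]
  have finF: "finite F" by (rule edge_set_finite[OF orientation_edge_set[OF st] V])
  obtain R where R: "R \<subseteq> V" "card R = comps V F" "\<forall>v\<in>V. \<exists>r\<in>R. (v, r) \<in> reach F"
    using exists_representatives[OF V, of F] by blast
  define N where "N = V - R"
  have finN: "finite N" using V by (simp add: N_def)
  have le: "comps V F \<le> card V" using card_mono[OF V R(1)] R(2) by simp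
  have cardN: "card N = card V - comps V F"
    unfolding N_def using R V by (simp add: card_Diff_subset finite_subset)
  then have "int (card N) = int (card V) - int (comps V F)" using le by simp
  then have intN: "int d * int (card N) = int d * int (card V) - int d * int (comps V F)"
    by (simp add: right_diff_distrib)
  let ?I = "Sigma N J <+> F" and ?Q = "SIGMA e:F. J (s e)"
  \<comment> \<open>Row \<open>(e, j)\<close> encodes
    \<open>\<delta> (s e) j - \<delta> (t e) j - \<alpha> e * y e j\<close>: the unknowns
    \<open>Inl\<close> are displacements of vertices outside \<open>R\<close>, the unknowns
    \<open>Inr\<close> the factors \<open>\<alpha>\<close>.\<close>
  define A :: "'v set \<times> nat \<Rightarrow> ('v \<times> nat) + 'v set \<Rightarrow> 'a" where
    "A q i = (case q of (e, j) \<Rightarrow> (case i of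
       Inl p \<Rightarrow> (if p = (s e, j) then 1 else 0) - (if p = (t e, j) then 1 else 0)
     | Inr f \<Rightarrow> - (if f = e then y e j else 0)))" for q i
  have "card ?Q = card F * d" using finF J(1) J(2)[OF stF(2)] by (simp add: card_SigmaI)
  moreover have "card (Sigma N J) = card N * d" using finN J(1,2) by (simp add: card_SigmaI N_def)
  then have "card ?I = card N * d + card F"
    using finN finF J(1) by (simp add: card_Plus)
  moreover have "int (card F * d) < int (card N * d + card F)"
    using sparse intN by (simp add: nullity_def algebra_simps)
  then have "card F * d < card N * d + card F" by (simp only: of_nat_less_iff)
  ultimately have "card ?Q < card ?I" by simp
  moreover have "finite ?Q" "finite ?I" using finF finN J(1) by auto
  ultimately obtain x where x: "\<exists>i\<in>?I. x i \<noteq> 0" "\<And>q. q \<in> ?Q \<Longrightarrow> (\<Sum>i\<in>?I. A q i * x i) = 0"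
    using exists_nontrivial_solution[of ?Q ?I A] by blast
  define \<delta> where "\<delta> v j = (if (v, j) \<in> Sigma N J then x (Inl (v, j)) else 0)" for v j
  define \<alpha> where "\<alpha> e = x (Inr e)" for e
  have finS: "finite (Sigma N J)" using finN J(1) by auto
  have eq: "\<delta> (s e) j - \<delta> (t e) j = \<alpha> e * y e j" if e: "e \<in> F" "j \<in> J (s e)" for e j
  proof -
    have delta: "(\<Sum>p\<in>Sigma N J. (if p = (w, j) then 1 else 0) * x (Inl p)) = \<delta> w j" for w
    proof -
      have "(\<Sum>p\<in>Sigma N J. (if p = (w, j) then 1 else 0) * x (Inl p)) =
        (\<Sum>p\<in>Sigma N J. if p = (w, j) then x (Inl p) else 0)" by (intro sum.cong refl) simp
      then show ?thesis unfolding \<delta>_def using sum.delta[OF finS, of "(w, j)" "\<lambda>p. x (Inl p)"] by simp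
    qed
    have "0 = (\<Sum>i\<in>?I. A (e, j) i * x i)" using x(2)[of "(e, j)"] e by simp
    also have "\<dots> = (\<Sum>p\<in>Sigma N J. A (e, j) (Inl p) * x (Inl p)) + (\<Sum>f\<in>F. A (e, j) (Inr f) * x (Inr f))"
      by (simp add: sum.Plus[OF finS finF])
    also have "(\<Sum>p\<in>Sigma N J. A (e, j) (Inl p) * x (Inl p)) = \<delta> (s e) j - \<delta> (t e) j"
      unfolding delta[symmetric] sum_subtractf[symmetric] A_def
      by (intro sum.cong refl) (simp add: left_diff_distrib)
    also have "(\<Sum>f\<in>F. A (e, j) (Inr f) * x (Inr f)) = (\<Sum>f\<in>F. if f = e then - (y e j * \<alpha> f) else 0)"
      by (intro sum.cong refl) (simp add: A_def \<alpha>_def)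
    also have "\<dots> = - (y e j * \<alpha> e)" using finF e(1) by (simp add: sum.delta)
    finally show ?thesis by (simp add: mult.commute)
  qed
  \<comment> \<open>If all \<open>\<alpha>\<close> vanish, the displacements are constant on
    components and zero at the representatives, so the whole solution is trivial.\<close>
  have "\<exists>e\<in>F. \<alpha> e \<noteq> 0"
  proof (rule ccontr)
    assume "\<not> ?thesis"
    then have \<alpha>0: "\<alpha> e = 0" if "e \<in> F" for e using that by blast
    have edge: "\<delta> (s e) j = \<delta> (t e) j" if "e \<in> F" for e j
      using eq[OF that, of j] \<alpha>0[OF that] J(3)[OF that] by (cases "j \<in> J (s e)") (auto simp: \<delta>_def)
    have const: "\<delta> v j = \<delta> w j" if "(v, w) \<in> reach F" for v w j
      using that unfolding reach_def
    proof (induction rule: rtrancl_induct)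
      case (step u w)
      then have e: "{u, w} \<in> F" by simp
      have "u = s {u, w} \<and> w = t {u, w} \<or> u = t {u, w} \<and> w = s {u, w}"
        using stF(1)[OF e] by (simp only: doubleton_eq_iff)
      then have "\<delta> u j = \<delta> w j" using edge[OF e, of j] by (elim disjE conjE) simp_all
      then show ?case using step.IH by simp
    qed simp
    have zero: "\<delta> v j = 0" if v: "v \<in> V" for v j
    proof -
      obtain r where "r \<in> R" "(v, r) \<in> reach F" using R(3) v by blast
      then show ?thesis using const[of v r j] by (simp add: \<delta>_def N_def)
    qed
    obtain i where i: "i \<in> ?I" "x i \<noteq> 0" using x(1) by blast
    then show False
    proof (cases i)
      case (Inl p)
      then have p: "(fst p, snd p) \<in> Sigma N J" using i(1) by auto
      then have "\<delta> (fst p) (snd p) \<noteq> 0" unfolding \<delta>_def using i(2) Inl by simp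
      moreover have "fst p \<in> V" using p by (auto simp: N_def)
      ultimately show False using zero by blast
    next
      case (Inr e)
      then show False using i \<alpha>0[of e] by (auto simp: \<alpha>_def)
    qed
  qed
  moreover have "\<forall>v j. j \<notin> J v \<longrightarrow> \<delta> v j = 0" by (simp add: \<delta>_def)
  ultimately show ?thesis using eq by blast
qed

section \<open>Polynomial curves of pictures\<close>

lemma eval_poly_multihomogeneous_cong:
  assumes "multihomogeneous d V E p"
    and "\<And>v i. v \<in> V \<Longrightarrow> i \<le> d \<Longrightarrow> \<phi> (Point_Coord v i) = \<psi> (Point_Coord v i)"
    and "\<And>e i j. e \<in> E \<Longrightarrow> i < j \<Longrightarrow> j \<le> d \<Longrightarrow> \<phi> (Line_Coord e i j) = \<psi> (Line_Coord e i j)"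
  shows "eval_poly p \<phi> = eval_poly p \<psi>"
proof (rule eval_poly_cong)
  fix z assume "z \<in> poly_vars p"
  then have "z \<in> (\<Union>v\<in>V. point_coords d v) \<union> (\<Union>e\<in>E. line_coords d e)"
    using assms(1) by (auto simp: multihomogeneous_def)
  then show "\<phi> z = \<psi> z" by (auto simp: point_coords_def line_coords_def assms(2,3))
qed

lemma poly_coords_of:
  "poly (coords_of x a b z) t =
     coords_of (\<lambda>v i. poly (x v i) t) (\<lambda>e i. poly (a e i) t) (\<lambda>e i. poly (b e i) t) z"
  by (cases z) simp_all

lemma eval_poly_on_curve:
  fixes x :: "'v \<Rightarrow> nat \<Rightarrow> 'a :: alg_closed_field poly" and a b :: "'e \<Rightarrow> nat \<Rightarrow> 'a poly"
  obtains r where "\<And>t. eval_poly p (coords_of (\<lambda>v i. poly (x v i) t) (\<lambda>e i. poly (a e i) t) (\<lambda>e i. poly (b e i) t)) = poly r t"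
  using eval_poly_curve[of p "coords_of x a b"] unfolding poly_coords_of by metis

lemma homog_coords_nondegenerate:
  assumes "homog_coords_of d V E P \<phi>"
  shows "nondegenerate_coords d V E \<phi>"
  unfolding nondegenerate_coords_def
proof (intro conjI ballI)
  fix v assume "v \<in> V"
  from homog_coords_pointD(1)[OF assms this] show "\<exists>i\<le>d. \<phi> (Point_Coord v i) \<noteq> 0"
    by (simp add: coord_vec_def vec_homog_vecs_iff)
next
  fix e assume "e \<in> E"
  then obtain x y where xy: "x \<in> homog_vecs d" "y \<in> homog_vecs d" "proj_point x \<noteq> proj_point y"
    and pl: "\<And>i j. i < j \<Longrightarrow> j \<le> d \<Longrightarrow> \<phi> (Line_Coord e i j) = pluecker x y i j"
    using homog_coords_lineE[OF assms, of e thesis for thesis] by metis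
  then obtain i j where "j \<le> d" "i < j" "pluecker x y i j \<noteq> 0"
    using proj_point_eq_iff_pluecker[OF xy(1,2)] by blast
  then show "\<exists>j\<le>d. \<exists>i<j. \<phi> (Line_Coord e i j) \<noteq> 0" using pl by metis
qed

lemma bracket_ordered:
  fixes f g :: "nat \<Rightarrow> 'a :: field"
  assumes "i \<le> d" "j \<le> d" "f i * g j - f j * g i \<noteq> 0"
  shows "\<exists>j\<le>d. \<exists>i<j. f i * g j - f j * g i \<noteq> 0"
proof (cases i j rule: linorder_cases)
  case less
  then show ?thesis using assms by blast
next
  case equal
  then show ?thesis using assms(3) by simp
next
  case greater
  moreover have "f j * g i - f i * g j \<noteq> 0" using assms(3) by simp
  ultimately show ?thesis using assms(1) by blast
qed

definition collapsed :: "('v set \<Rightarrow> 'v) \<Rightarrow> ('v set \<Rightarrow> 'v) \<Rightarrow> 'v set set \<Rightarrow> ('v, 'v set, 'a) configuration \<Rightarrow> 'v set set" where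
  "collapsed s t E P = {e \<in> E. fst P (s e) = fst P (t e)}"

text \<open>The lines of the collapsed edges are kept fixed while their ends move apart along them.\<close>

lemma closed_contains_degenerate:
  fixes W :: "('v, 'v set, 'a :: alg_closed_field) configuration set"
  assumes V: "finite V" and st: "orientation V E s t"
    and W: "zariski_closed d V E W"
    and P: "P \<in> picture_space d V E"
    and sparse: "int d * nullity V (collapsed s t E P) < int (card (collapsed s t E P))"
    and less: "\<And>Q. Q \<in> picture_space d V E \<Longrightarrow> collapsed s t E Q \<subset> collapsed s t E P \<Longrightarrow> Q \<in> W"
  shows "P \<in> W"
proof -
  obtain S where S: "\<And>p. p \<in> S \<Longrightarrow> multihomogeneous d V E p" and W_eq: "W = zero_locus d V E S"
    using W by (auto simp: zariski_closed_def)
  have E: "edge_set V E" by (rule orientation_edge_set[OF st])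
  have finE: "finite E" by (rule edge_set_finite[OF E V])
  note stE = orientationD[OF st]
  define F where "F = collapsed s t E P"
  have FE: "F \<subseteq> E" and Feq: "\<And>e. e \<in> F \<Longrightarrow> fst P (s e) = fst P (t e)"
    and Fne: "\<And>e. e \<in> E - F \<Longrightarrow> fst P (s e) \<noteq> fst P (t e)"
    by (auto simp: F_def collapsed_def)
  have conf: "P \<in> configurations d V E" using P by (simp add: picture_space_def)
  have "eval_poly p \<phi> = 0" if p: "p \<in> S" and \<phi>: "homog_coords_of d V E P \<phi>" for p \<phi>
  proof -
    note pt = homog_coords_pointD[OF \<phi>]
    \<comment> \<open>Chosen as a function of the point, so that the ends of a collapsed edge share
      this vector and hence the pivot \<open>m\<close>.\<close>
    define N where "N v = (SOME z. z \<in> homog_vecs d \<and> proj_point z = fst P v)" for v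
    have "N v \<in> homog_vecs d \<and> proj_point (N v) = fst P v" if "v \<in> V" for v
      unfolding N_def by (rule someI[of _ "coord_vec d \<phi> v"]) (use pt[OF that] in simp)
    then have N: "\<And>v. v \<in> V \<Longrightarrow> N v \<in> homog_vecs d" "\<And>v. v \<in> V \<Longrightarrow> proj_point (N v) = fst P v" by auto
    have N_eq: "N (s e) = N (t e)" if "e \<in> F" for e unfolding N_def Feq[OF that] ..
    define m where "m v = (SOME i. i \<le> d \<and> N v $ i \<noteq> 0)" for v
    have "m v \<le> d \<and> N v $ m v \<noteq> 0" if "v \<in> V" for v
      unfolding m_def by (rule someI_ex) (use N(1)[OF that] in \<open>auto simp: homog_vecs_iff\<close>)
    then have m: "\<And>v. v \<in> V \<Longrightarrow> m v \<le> d" "\<And>v. v \<in> V \<Longrightarrow> N v $ m v \<noteq> 0" by auto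
    have m_eq: "m (s e) = m (t e)" if "e \<in> F" for e unfolding m_def N_eq[OF that] ..
    have "\<exists>c. c \<noteq> 0 \<and> (\<forall>j\<le>d. \<phi> (Point_Coord v j) = c * N v $ j)" if v: "v \<in> V" for v
    proof -
      have "proj_point (coord_vec d \<phi> v) = proj_point (N v)" using pt(2)[OF v] N(2)[OF v] by simp
      then obtain c where c: "c \<noteq> 0" "coord_vec d \<phi> v = c \<cdot>\<^sub>v N v"
        using proj_point_eqD[OF _ pt(1)[OF v] N(1)[OF v]] by blast
      have "\<phi> (Point_Coord v j) = c * N v $ j" if "j \<le> d" for j
        using arg_cong[OF c(2), of "\<lambda>v. v $ j"] that homog_vecs_dim[OF N(1)[OF v]]
        by (simp add: coord_vec_def)
      then show ?thesis using c(1) by blast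
    qed
    then obtain c where c: "\<And>v. v \<in> V \<Longrightarrow> c v \<noteq> 0"
      "\<And>v j. v \<in> V \<Longrightarrow> j \<le> d \<Longrightarrow> \<phi> (Point_Coord v j) = c v * N v $ j" by metis
    have "\<exists>y. y \<in> homog_vecs d \<and> y $ m (s e) = 0 \<and>
      (\<forall>i j. i < j \<longrightarrow> j \<le> d \<longrightarrow> \<phi> (Line_Coord e i j) = N (s e) $ i * y $ j - N (s e) $ j * y $ i)" if e: "e \<in> F" for e
    proof -
      have eE: "e \<in> E" using e FE by blast
      obtain x z where xz: "x \<in> homog_vecs d" "z \<in> homog_vecs d" "proj_point x \<noteq> proj_point z"
        "snd P e = proj_line d x z" "\<And>i j. i < j \<Longrightarrow> j \<le> d \<Longrightarrow> \<phi> (Line_Coord e i j) = pluecker x z i j"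
        using homog_coords_lineE[OF \<phi> eE] by blast
      have sV: "s e \<in> V" by (rule stE(2)[OF eE])
      have "s e \<in> e" using stE(1)[OF eE] by blast
      then have "fst P (s e) \<in> snd P e" using P eE by (auto simp: picture_space_def)
      then have on: "proj_point (N (s e)) \<in> proj_line d x z" using N(2)[OF sV] xz(4) by simp
      obtain y where "y \<in> homog_vecs d" "y $ m (s e) = 0"
        "\<And>k l. k \<le> d \<Longrightarrow> l \<le> d \<Longrightarrow> pluecker (N (s e)) y k l = pluecker x z k l"
        using proj_line_basis_through[OF xz(1-3) N(1)[OF sV] on m[OF sV]] by metis
      then show ?thesis using xz(5) by (intro exI[of _ y]) (simp add: pluecker_def)
    qed
    then obtain y where y: "\<And>e. e \<in> F \<Longrightarrow> y e \<in> homog_vecs d" "\<And>e. e \<in> F \<Longrightarrow> y e $ m (s e) = 0"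
      "\<And>e i j. e \<in> F \<Longrightarrow> i < j \<Longrightarrow> j \<le> d \<Longrightarrow> \<phi> (Line_Coord e i j) = N (s e) $ i * y e $ j - N (s e) $ j * y e $ i"
      by metis
    have "\<exists>l. l \<noteq> 0 \<and> (\<forall>i j. i < j \<longrightarrow> j \<le> d \<longrightarrow> \<phi> (Line_Coord e i j) =
       l * (\<phi> (Point_Coord (s e) i) * \<phi> (Point_Coord (t e) j) - \<phi> (Point_Coord (s e) j) * \<phi> (Point_Coord (t e) i)))"
      if e: "e \<in> E - F" for e
    proof -
      have eE: "e \<in> E" using e by blast
      show ?thesis
        by (rule noncollapsed_line_coords[OF \<phi> P eE stE(1-3)[OF eE] Fne[OF e]]) blast
    qed
    then obtain l where l: "\<And>e. e \<in> E - F \<Longrightarrow> l e \<noteq> 0"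
      "\<And>e i j. e \<in> E - F \<Longrightarrow> i < j \<Longrightarrow> j \<le> d \<Longrightarrow> \<phi> (Line_Coord e i j) =
       l e * (\<phi> (Point_Coord (s e) i) * \<phi> (Point_Coord (t e) j) - \<phi> (Point_Coord (s e) j) * \<phi> (Point_Coord (t e) i))"
      by metis
    \<comment> \<open>The pivot coordinate is to stay constant along the curve up to the factor at
      the vertex; the other \<open>d\<close> coordinates move.\<close>
    define J where "J v = {..d} - {m v}" for v
    have J: "finite (J v)" for v by (simp add: J_def)
    have J_card: "card (J v) = d" if "v \<in> V" for v using m(1)[OF that] by (simp add: J_def)
    have J_eq: "J (s e) = J (t e)" if "e \<in> F" for e by (simp add: J_def m_eq[OF that])
    obtain \<delta> \<alpha> where \<delta>0: "\<And>v j. j \<notin> J v \<Longrightarrow> \<delta> v j = 0"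
      and \<delta>: "\<And>e j. e \<in> F \<Longrightarrow> j \<in> J (s e) \<Longrightarrow> \<delta> (s e) j - \<delta> (t e) j = \<alpha> e * y e $ j"
      and \<alpha>: "\<exists>e\<in>F. \<alpha> e \<noteq> 0"
      using exists_deformation[where J = J and y = "\<lambda>e j. y e $ j", OF V orientation_subset[OF st FE] J J_card J_eq sparse[folded F_def]]
      by blast
    have \<delta>_m: "\<delta> v (m v) = 0" for v by (rule \<delta>0) (simp add: J_def)
    have \<delta>_t: "\<delta> (t e) j = \<delta> (s e) j - \<alpha> e * y e $ j" if "e \<in> F" "j \<le> d" for e j
    proof (cases "j = m (s e)")
      case True
      then show ?thesis using \<delta>_m[of "s e"] \<delta>_m[of "t e"] m_eq[OF that(1)] y(2)[OF that(1)] by simp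
    next
      case False
      then have "j \<in> J (s e)" using that(2) by (simp add: J_def)
      from \<delta>[OF that(1) this] show ?thesis by (simp add: algebra_simps)
    qed
    \<comment> \<open>The factor \<open>c v\<close> makes the curve start at the given coordinates
      \<open>\<phi>\<close> themselves.\<close>
    define x where "x v j = [:c v * N v $ j, c v * \<delta> v j:]" for v j
    \<comment> \<open>The line at a collapsed edge keeps the direction \<open>y e\<close> and is
      carried along by \<open>s e\<close>. Any other line is spanned by its ends, and
      \<open>l e\<close> restores the given Pluecker coordinates.\<close>
    define a where "a e j = (if e \<in> F then [:N (s e) $ j, \<delta> (s e) j:] else [:l e:] * x (s e) j)" for e j
    define b where "b e j = (if e \<in> F then [:y e $ j:] else x (t e) j)" for e j
    let ?x = "\<lambda>t v i. poly (x v i) t" and ?a = "\<lambda>t e i. poly (a e i) t" and ?b = "\<lambda>t e i. poly (b e i) t"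
    let ?\<phi> = "\<lambda>t. coords_of (?x t) (?a t) (?b t)" and ?P = "\<lambda>t. picture_of d V E (?x t) (?a t) (?b t)"
    have x_t: "?x \<tau> v j = c v * (N v $ j + \<tau> * \<delta> v j)" for \<tau> v j by (simp add: x_def algebra_simps)
    have \<phi>0_pt: "?\<phi> 0 (Point_Coord v i) = \<phi> (Point_Coord v i)" if "v \<in> V" "i \<le> d" for v i
      using c(2)[OF that] by (simp add: x_def)
    have \<phi>0_line: "?\<phi> 0 (Line_Coord e i j) = \<phi> (Line_Coord e i j)" if e: "e \<in> E" "i < j" "j \<le> d" for e i j
    proof (cases "e \<in> F")
      case True
      then show ?thesis using y(3)[OF True e(2,3)] by (simp add: a_def b_def)
    next
      case False
      have "e \<in> E - F" using False e(1) by blast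
      from l(2)[OF this e(2,3)] show ?thesis
        using False e c(2)[OF stE(2)[OF e(1)]] c(2)[OF stE(3)[OF e(1)]]
        by (simp add: a_def b_def x_def algebra_simps)
    qed
    have "\<exists>ij. fst ij < snd ij \<and> snd ij \<le> d \<and> \<phi> (Line_Coord e (fst ij) (snd ij)) \<noteq> 0" if "e \<in> E" for e
      using homog_coords_nondegenerate[OF \<phi>] that unfolding nondegenerate_coords_def by (metis fst_conv snd_conv)
    then obtain ij where ij: "\<And>e. e \<in> E \<Longrightarrow> fst (ij e) < snd (ij e)" "\<And>e. e \<in> E \<Longrightarrow> snd (ij e) \<le> d"
      "\<And>e. e \<in> E \<Longrightarrow> \<phi> (Line_Coord e (fst (ij e)) (snd (ij e))) \<noteq> 0" by metis
    let ?r = "\<lambda>e. coords_of x a b (Line_Coord e (fst (ij e)) (snd (ij e)))"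
    \<comment> \<open>Besides 0, only parameters where the line of a noncollapsed edge degenerates
      are excluded: at vertices and collapsed edges the constant pivot coordinate prevents
      degeneration.\<close>
    define B where "B = insert 0 (\<Union>e\<in>E - F. {\<tau>. poly (?r e) \<tau> = 0})"
    have "finite {\<tau>. poly (?r e) \<tau> = 0}" if "e \<in> E" for e
    proof -
      have "poly (?r e) 0 \<noteq> 0" using \<phi>0_line[OF that ij(1,2)[OF that]] ij(3)[OF that] by (simp only: poly_coords_of) simp
      then have "?r e \<noteq> 0" by (rule contrapos_nn) (simp only: poly_0)
      then show ?thesis by (rule poly_roots_finite)
    qed
    then have finB: "finite B" using finE by (simp add: B_def)
    have good: "eval_poly p (?\<phi> \<tau>) = 0" if \<tau>: "\<tau> \<notin> B" for \<tau>
    proof -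
      have \<tau>0: "\<tau> \<noteq> 0" using \<tau> by (auto simp: B_def)
      have lineE: "?\<phi> \<tau> (Line_Coord e (fst (ij e)) (snd (ij e))) \<noteq> 0" if "e \<in> E - F" for e
        using \<tau> that unfolding B_def poly_coords_of[symmetric] by blast
      have y_k: "\<exists>k\<le>d. k \<noteq> m (s e) \<and> y e $ k \<noteq> 0" if "e \<in> F" for e
        using y(1,2)[OF that] by (auto simp: homog_vecs_iff)
      have nd: "nondegenerate_coords d V E (?\<phi> \<tau>)"
        unfolding nondegenerate_coords_def
      proof (intro conjI ballI)
        fix v assume v: "v \<in> V"
        have "?\<phi> \<tau> (Point_Coord v (m v)) \<noteq> 0" using c(1)[OF v] m(2)[OF v] by (simp add: x_t \<delta>_m)
        then show "\<exists>i\<le>d. ?\<phi> \<tau> (Point_Coord v i) \<noteq> 0" using m(1)[OF v] by blast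
      next
        fix e assume e: "e \<in> E"
        show "\<exists>j\<le>d. \<exists>i<j. ?\<phi> \<tau> (Line_Coord e i j) \<noteq> 0"
        proof (cases "e \<in> F")
          case True
          have sV: "s e \<in> V" by (rule stE(2)[OF e])
          obtain k where k: "k \<le> d" "y e $ k \<noteq> 0" using y_k[OF True] by blast
          have "?a \<tau> e (m (s e)) * ?b \<tau> e k - ?a \<tau> e k * ?b \<tau> e (m (s e)) \<noteq> 0"
            using True k(2) m(2)[OF sV] y(2)[OF True] by (simp add: a_def b_def \<delta>_m)
          from bracket_ordered[OF m(1)[OF sV] k(1), of "?a \<tau> e" "?b \<tau> e", OF this] show ?thesis by simp
        next
          case False
          then show ?thesis using lineE[of e] ij(1,2)[OF e] e by blast
        qed
      qed
      have "\<exists>k l. \<forall>i\<le>d. ?x \<tau> v i = k * ?a \<tau> e i + l * ?b \<tau> e i" if e: "e \<in> E" and v: "v \<in> e" for e v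
      proof (cases "e \<in> F")
        case True
        have "v = s e \<or> v = t e" using stE(1)[OF e] v by blast
        then show ?thesis
        proof
          assume "v = s e"
          then show ?thesis using True by (intro exI[of _ "c v"] exI[of _ 0]) (simp add: x_t a_def)
        next
          \<comment> \<open>By \<open>\<delta>_t\<close>, the end \<open>t e\<close> is displaced
            from \<open>s e\<close> by a multiple of \<open>y e\<close>, so it stays on the moving
            line.\<close>
          assume "v = t e"
          then have "\<forall>i\<le>d. ?x \<tau> v i = c v * ?a \<tau> e i + (- c v * \<tau> * \<alpha> e) * ?b \<tau> e i"
            using True by (simp add: x_t a_def b_def N_eq[OF True, symmetric] \<delta>_t[OF True] algebra_simps)
          then show ?thesis by blast
        qed
      next
        case False
        have le: "l e \<noteq> 0" using l(1)[of e] e False by blast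
        have "v = s e \<or> v = t e" using stE(1)[OF e] v by blast
        then show ?thesis
        proof
          assume "v = s e"
          then show ?thesis using False le by (intro exI[of _ "1 / l e"] exI[of _ 0]) (simp add: a_def)
        next
          assume "v = t e"
          then show ?thesis using False by (intro exI[of _ 0] exI[of _ 1]) (simp add: b_def)
        qed
      qed
      then have Q: "?P \<tau> \<in> picture_space d V E" by (rule picture_of_in_picture_space[OF nd E])
      have fst_P: "fst (?P \<tau>) v = proj_point (vec (Suc d) (?x \<tau> v))" if "v \<in> V" for v
        using that by (simp add: picture_of_def)
      have distinct: "e \<notin> collapsed s t E (?P \<tau>)"
        if e: "e \<in> E" "i \<le> d" "j \<le> d" "?x \<tau> (s e) i * ?x \<tau> (t e) j - ?x \<tau> (s e) j * ?x \<tau> (t e) i \<noteq> 0" for e i j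
      proof -
        obtain i' j' where "j' \<le> d" "i' < j'" "?x \<tau> (s e) i' * ?x \<tau> (t e) j' - ?x \<tau> (s e) j' * ?x \<tau> (t e) i' \<noteq> 0"
          using bracket_ordered[OF e(2,3), of "?x \<tau> (s e)" "?x \<tau> (t e)", OF e(4)] by blast
        from independent_vecs(3)[of j' d i' "?x \<tau> (s e)" "?x \<tau> (t e)", OF this]
        show ?thesis by (simp add: collapsed_def fst_P stE(2,3)[OF e(1)])
      qed
      have "e \<in> F" if "e \<in> collapsed s t E (?P \<tau>)" for e
      proof (rule ccontr)
        assume no: "e \<notin> F"
        have e: "e \<in> E" using that by (simp add: collapsed_def)
        have "?\<phi> \<tau> (Line_Coord e (fst (ij e)) (snd (ij e))) = l e * (?x \<tau> (s e) (fst (ij e)) * ?x \<tau> (t e) (snd (ij e))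
          - ?x \<tau> (s e) (snd (ij e)) * ?x \<tau> (t e) (fst (ij e)))"
          using no by (simp add: a_def b_def algebra_simps)
        then have "?x \<tau> (s e) (fst (ij e)) * ?x \<tau> (t e) (snd (ij e))
          - ?x \<tau> (s e) (snd (ij e)) * ?x \<tau> (t e) (fst (ij e)) \<noteq> 0"
          using lineE[of e] e no by auto
        from distinct[OF e _ _ this] ij(1,2)[OF e] that show False by simp
      qed
      moreover obtain e0 where e0: "e0 \<in> F" "\<alpha> e0 \<noteq> 0" using \<alpha> by blast
      have "e0 \<notin> collapsed s t E (?P \<tau>)"
      proof -
        have e0E: "e0 \<in> E" using e0 FE by blast
        note sV = stE(2)[OF e0E] and tV = stE(3)[OF e0E]
        obtain k where k: "k \<le> d" "y e0 $ k \<noteq> 0" using y_k[OF e0(1)] by blast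
        let ?m = "m (s e0)"
        \<comment> \<open>The bracket at the pivot and a nonzero coordinate of \<open>y e0\<close>
          is a nonzero multiple of \<open>\<tau> * \<alpha> e0\<close>, so this edge opens
          up.\<close>
        have "?x \<tau> (s e0) ?m * ?x \<tau> (t e0) k - ?x \<tau> (s e0) k * ?x \<tau> (t e0) ?m
          = - (c (s e0) * c (t e0) * N (s e0) $ ?m * \<tau> * \<alpha> e0 * y e0 $ k)"
          by (simp add: x_t \<delta>_t[OF e0(1)] k(1) m(1)[OF sV] N_eq[OF e0(1), symmetric]
              y(2)[OF e0(1)] \<delta>_m algebra_simps)
        also have "\<dots> \<noteq> 0" using c(1)[OF sV] c(1)[OF tV] m(2)[OF sV] \<tau>0 e0(2) k(2) by simp
        finally show ?thesis by (rule distinct[OF e0E m(1)[OF sV] k(1)])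
      qed
      ultimately have "collapsed s t E (?P \<tau>) \<subset> F" using e0(1) by blast
      then have "?P \<tau> \<in> W" using less[OF Q] by (simp add: F_def)
      then show ?thesis using p picture_of_homog_coords(2)[OF nd] by (auto simp: W_eq zero_locus_def)
    qed
    obtain r where r: "\<And>\<tau>. eval_poly p (?\<phi> \<tau>) = poly r \<tau>" using eval_poly_on_curve[of p x a b] by blast
    have "r = 0" using poly_eq_0_cofinite[OF finB] good r by metis
    then have "eval_poly p (?\<phi> 0) = 0" using r by simp
    moreover have "eval_poly p (?\<phi> 0) = eval_poly p \<phi>"
      by (rule eval_poly_multihomogeneous_cong[OF S[OF p] \<phi>0_pt \<phi>0_line])
    ultimately show ?thesis by simp
  qed
  then show ?thesis using conf by (auto simp: W_eq zero_locus_def)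
qed

subsection \<open>Sparse graphs have irreducible picture spaces\<close>

text \<open>Induction on the number of collapsed edges: sparsity of the collapsed set allows a
  deformation to pictures with fewer collapsed edges.\<close>

lemma closed_contains_picture_space:
  fixes W :: "('v, 'v set, 'a :: alg_closed_field) configuration set"
  assumes V: "finite V" and st: "orientation V E s t"
    and sparse: "\<And>F. F \<subseteq> E \<Longrightarrow> F \<noteq> {} \<Longrightarrow> int d * nullity V F < int (card F)"
    and W: "zariski_closed d V E W"
    and generic: "\<And>P. P \<in> picture_space d V E \<Longrightarrow> collapsed s t E P = {} \<Longrightarrow> P \<in> W"
  shows "picture_space d V E \<subseteq> W"
proof
  fix P :: "('v, 'v set, 'a) configuration"
  have finE: "finite E" by (rule edge_set_finite[OF orientation_edge_set[OF st] V])
  assume "P \<in> picture_space d V E"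
  then show "P \<in> W"
  proof (induction "card (collapsed s t E P)" arbitrary: P rule: less_induct)
    case (less P)
    show ?case
    proof (cases "collapsed s t E P = {}")
      case True
      then show ?thesis using generic less.prems by blast
    next
      case False
      have sub: "collapsed s t E P \<subseteq> E" by (auto simp: collapsed_def)
      have fin: "finite (collapsed s t E P)" using sub finE by (rule finite_subset)
      show ?thesis
      proof (rule closed_contains_degenerate[OF V st W less.prems sparse[OF sub False]])
        fix Q :: "('v, 'v set, 'a) configuration"
        assume "Q \<in> picture_space d V E" "collapsed s t E Q \<subset> collapsed s t E P"
        then show "Q \<in> W" using less.hyps psubset_card_mono[OF fin] by blast
      qed
    qed
  qed
qed

text \<open>Pictures without collapsed edges are determined by the positions of their vertices, which can
  be moved along a segment between any two such pictures.\<close>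

lemma generic_pictures_irreducible:
  fixes A B :: "('v, 'v set, 'a :: alg_closed_field) configuration set"
  assumes V: "finite V" and st: "orientation V E s t"
    and A: "zariski_closed d V E A" and B: "zariski_closed d V E B"
    and cover: "picture_space d V E \<subseteq> A \<union> B"
    and P: "P \<in> picture_space d V E" "collapsed s t E P = {}"
    and Q: "Q \<in> picture_space d V E" "collapsed s t E Q = {}"
  shows "P \<in> A \<or> Q \<in> B"
proof (rule ccontr)
  assume neg: "\<not> (P \<in> A \<or> Q \<in> B)"
  have E: "edge_set V E" by (rule orientation_edge_set[OF st])
  have finE: "finite E" by (rule edge_set_finite[OF E V])
  note stE = orientationD[OF st]
  have conf: "P \<in> configurations d V E" "Q \<in> configurations d V E"
    using P(1) Q(1) by (auto simp: picture_space_def)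
  obtain S where S: "\<And>p. p \<in> S \<Longrightarrow> multihomogeneous d V E p" "A = zero_locus d V E S"
    using A by (auto simp: zariski_closed_def)
  obtain T where T: "\<And>p. p \<in> T \<Longrightarrow> multihomogeneous d V E p" "B = zero_locus d V E T"
    using B by (auto simp: zariski_closed_def)
  obtain p \<phi> where p: "p \<in> S" and \<phi>: "homog_coords_of d V E P \<phi>" "eval_poly p \<phi> \<noteq> 0"
    using neg conf(1) unfolding S(2) zero_locus_def by blast
  obtain q \<psi> where q: "q \<in> T" and \<psi>: "homog_coords_of d V E Q \<psi>" "eval_poly q \<psi> \<noteq> 0"
    using neg conf(2) unfolding T(2) zero_locus_def by blast
  have ex_scale: "\<exists>c. \<forall>e\<in>E. \<forall>i j. i < j \<longrightarrow> j \<le> d \<longrightarrow> \<chi> (Line_Coord e i j) = c e *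
      (\<chi> (Point_Coord (s e) i) * \<chi> (Point_Coord (t e) j) - \<chi> (Point_Coord (s e) j) * \<chi> (Point_Coord (t e) i))"
    if R: "R \<in> picture_space d V E" "collapsed s t E R = {}" and \<chi>: "homog_coords_of d V E R \<chi>"
    for R :: "('v, 'v set, 'a) configuration" and \<chi>
  proof -
    have "\<exists>c. \<forall>i j. i < j \<longrightarrow> j \<le> d \<longrightarrow> \<chi> (Line_Coord e i j) = c *
      (\<chi> (Point_Coord (s e) i) * \<chi> (Point_Coord (t e) j) - \<chi> (Point_Coord (s e) j) * \<chi> (Point_Coord (t e) i))"
      if e: "e \<in> E" for e
    proof -
      have "fst R (s e) \<noteq> fst R (t e)" using R(2) e by (auto simp: collapsed_def)
      then show ?thesis
        by (rule noncollapsed_line_coords[OF \<chi> R(1) e stE(1-3)[OF e]]) blast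
    qed
    then show ?thesis by metis
  qed
  obtain c where c: "\<And>e i j. e \<in> E \<Longrightarrow> i < j \<Longrightarrow> j \<le> d \<Longrightarrow> \<phi> (Line_Coord e i j) = c e *
      (\<phi> (Point_Coord (s e) i) * \<phi> (Point_Coord (t e) j) - \<phi> (Point_Coord (s e) j) * \<phi> (Point_Coord (t e) i))"
    using ex_scale[OF P \<phi>(1)] by blast
  obtain c' where c': "\<And>e i j. e \<in> E \<Longrightarrow> i < j \<Longrightarrow> j \<le> d \<Longrightarrow> \<psi> (Line_Coord e i j) = c' e *
      (\<psi> (Point_Coord (s e) i) * \<psi> (Point_Coord (t e) j) - \<psi> (Point_Coord (s e) j) * \<psi> (Point_Coord (t e) i))"
    using ex_scale[OF Q \<psi>(1)] by blast
  define x where "x v i = [:\<phi> (Point_Coord v i), \<psi> (Point_Coord v i) - \<phi> (Point_Coord v i):]" for v i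
  define a where "a e i = [:c e, c' e - c e:] * x (s e) i" for e i
  define b where "b e i = x (t e) i" for e i
  let ?x = "\<lambda>\<tau> v i. poly (x v i) \<tau>" and ?a = "\<lambda>\<tau> e i. poly (a e i) \<tau>" and ?b = "\<lambda>\<tau> e i. poly (b e i) \<tau>"
  let ?\<phi> = "\<lambda>\<tau>. coords_of (?x \<tau>) (?a \<tau>) (?b \<tau>)" and ?P = "\<lambda>\<tau>. picture_of d V E (?x \<tau>) (?a \<tau>) (?b \<tau>)"
  have at0: "?\<phi> 0 (Point_Coord v i) = \<phi> (Point_Coord v i)" for v i by (simp add: x_def)
  have at0_line: "?\<phi> 0 (Line_Coord e i j) = \<phi> (Line_Coord e i j)" if "e \<in> E" "i < j" "j \<le> d" for e i j
    using c[OF that] by (simp add: x_def a_def b_def algebra_simps)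
  have at1: "?\<phi> 1 (Point_Coord v i) = \<psi> (Point_Coord v i)" for v i by (simp add: x_def)
  have at1_line: "?\<phi> 1 (Line_Coord e i j) = \<psi> (Line_Coord e i j)" if "e \<in> E" "i < j" "j \<le> d" for e i j
    using c'[OF that] by (simp add: x_def a_def b_def algebra_simps)
  note nd0 = homog_coords_nondegenerate[OF \<phi>(1), unfolded nondegenerate_coords_def]
  have "\<forall>v\<in>V. \<exists>i\<le>d. ?\<phi> 0 (Point_Coord v i) \<noteq> 0" using nd0 at0 by simp
  then obtain k where k: "\<And>v. v \<in> V \<Longrightarrow> k v \<le> d" "\<And>v. v \<in> V \<Longrightarrow> ?\<phi> 0 (Point_Coord v (k v)) \<noteq> 0" by metis
  have "\<exists>ij. fst ij < snd ij \<and> snd ij \<le> d \<and> ?\<phi> 0 (Line_Coord e (fst ij) (snd ij)) \<noteq> 0" if e: "e \<in> E" for e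
  proof -
    obtain i j where "j \<le> d" "i < j" "\<phi> (Line_Coord e i j) \<noteq> 0" using nd0 e by blast
    then show ?thesis using at0_line[OF e] by (intro exI[of _ "(i, j)"]) simp
  qed
  then obtain ij where ij: "\<And>e. e \<in> E \<Longrightarrow> fst (ij e) < snd (ij e)" "\<And>e. e \<in> E \<Longrightarrow> snd (ij e) \<le> d"
    "\<And>e. e \<in> E \<Longrightarrow> ?\<phi> 0 (Line_Coord e (fst (ij e)) (snd (ij e))) \<noteq> 0" by metis
  let ?z = "\<lambda>e. Line_Coord e (fst (ij e)) (snd (ij e))"
  \<comment> \<open>For every point and line one coordinate that is nonzero at 0 is watched; away
    from the finitely many zeros of these, the curve consists of pictures.\<close>
  define Bad where "Bad = (\<Union>v\<in>V. {\<tau>. poly (coords_of x a b (Point_Coord v (k v))) \<tau> = 0}) \<union>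
    (\<Union>e\<in>E. {\<tau>. poly (coords_of x a b (?z e)) \<tau> = 0})"
  have fin_roots: "finite {\<tau>. poly (coords_of x a b z) \<tau> = 0}" if "?\<phi> 0 z \<noteq> 0" for z
  proof -
    have "poly (coords_of x a b z) 0 \<noteq> 0" using that by (simp only: poly_coords_of) simp
    then have "coords_of x a b z \<noteq> 0" by (rule contrapos_nn) (simp only: poly_0)
    then show ?thesis by (rule poly_roots_finite)
  qed
  have finBad: "finite Bad"
    unfolding Bad_def by (intro finite_UnI finite_UN_I V finE fin_roots k(2) ij(3))
  obtain r where r: "\<And>\<tau>. eval_poly p (?\<phi> \<tau>) = poly r \<tau>" using eval_poly_on_curve[of p x a b] by blast
  obtain r' where r': "\<And>\<tau>. eval_poly q (?\<phi> \<tau>) = poly r' \<tau>" using eval_poly_on_curve[of q x a b] by blast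
  have "poly (r * r') \<tau> = 0" if \<tau>: "\<tau> \<notin> Bad" for \<tau>
  proof -
    have "?\<phi> \<tau> (Point_Coord v (k v)) \<noteq> 0" if "v \<in> V" for v
      using \<tau> that unfolding Bad_def poly_coords_of[symmetric] by blast
    moreover have "?\<phi> \<tau> (?z e) \<noteq> 0" if "e \<in> E" for e
      using \<tau> that unfolding Bad_def poly_coords_of[symmetric] by blast
    ultimately have nd: "nondegenerate_coords d V E (?\<phi> \<tau>)"
      unfolding nondegenerate_coords_def using k(1) ij(1,2) by blast
    have "\<exists>k l. \<forall>i\<le>d. ?x \<tau> v i = k * ?a \<tau> e i + l * ?b \<tau> e i" if e: "e \<in> E" and v: "v \<in> e" for e v
    proof -
      have "v = s e \<or> v = t e" using stE(1)[OF e] v by blast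
      then show ?thesis
      proof
        assume "v = s e"
        let ?l = "c e + \<tau> * (c' e - c e)"
        have a_val: "?a \<tau> e i = ?l * ?x \<tau> (s e) i" for i by (simp add: a_def algebra_simps)
        have "?\<phi> \<tau> (?z e) \<noteq> 0" using \<tau> e unfolding Bad_def poly_coords_of[symmetric] by blast
        \<comment> \<open>A zero factor would annihilate all Pluecker coordinates of the
          line.\<close>
        then have "?l \<noteq> 0" unfolding coords_of.simps a_val by (rule contrapos_nn) simp
        then have "\<forall>i\<le>d. ?x \<tau> v i = (1 / ?l) * ?a \<tau> e i + 0 * ?b \<tau> e i"
          unfolding a_val using \<open>v = s e\<close> by simp
        then show ?thesis by blast
      next
        assume "v = t e"
        then have "\<forall>i\<le>d. ?x \<tau> v i = 0 * ?a \<tau> e i + 1 * ?b \<tau> e i" by (simp add: b_def)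
        then show ?thesis by blast
      qed
    qed
    then have "?P \<tau> \<in> picture_space d V E" by (rule picture_of_in_picture_space[OF nd E])
    then have "?P \<tau> \<in> A \<or> ?P \<tau> \<in> B" using cover by blast
    moreover have "eval_poly p (?\<phi> \<tau>) = 0" if "?P \<tau> \<in> A"
      using that p picture_of_homog_coords(2)[OF nd] unfolding S(2) zero_locus_def by blast
    moreover have "eval_poly q (?\<phi> \<tau>) = 0" if "?P \<tau> \<in> B"
      using that q picture_of_homog_coords(2)[OF nd] unfolding T(2) zero_locus_def by blast
    ultimately show ?thesis using r r' by auto
  qed
  \<comment> \<open>Each good parameter gives a picture in \<open>A\<close> or in \<open>B\<close>,
    so the product vanishes there; yet \<open>r\<close> is nonzero at 0 and \<open>r'\<close> at
    1.\<close>
  then have "r * r' = 0" using poly_eq_0_cofinite[OF finBad] by blast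
  moreover have "eval_poly p (?\<phi> 0) = eval_poly p \<phi>"
    by (rule eval_poly_multihomogeneous_cong[OF S(1)[OF p] at0 at0_line])
  then have "r \<noteq> 0" using \<phi>(2) r[of 0] by auto
  moreover have "eval_poly q (?\<phi> 1) = eval_poly q \<psi>"
    by (rule eval_poly_multihomogeneous_cong[OF T(1)[OF q] at1 at1_line])
  then have "r' \<noteq> 0" using \<psi>(2) r'[of 1] by auto
  ultimately show False by simp
qed

text \<open>Irreducibility includes nonemptiness. All points are taken equal and all lines equal;
  \<open>0 < d\<close> provides the second basis vector.\<close>

lemma picture_space_nonempty:
  assumes "edge_set V E" "0 < d"
  shows "(picture_space d V E :: ('v, 'v set, 'a :: field) configuration set) \<noteq> {}"
proof -
  define o' :: "nat \<Rightarrow> 'a" where "o' i = (if i = 0 then 1 else 0)" for i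
  define o1 :: "nat \<Rightarrow> 'a" where "o1 i = (if i = 1 then 1 else 0)" for i
  have nd: "nondegenerate_coords d V E (coords_of (\<lambda>_. o') (\<lambda>_. o') (\<lambda>_. o1))"
    unfolding nondegenerate_coords_def
  proof (intro conjI ballI)
    show "\<exists>i\<le>d. coords_of (\<lambda>_. o') (\<lambda>_. o') (\<lambda>_. o1) (Point_Coord v i) \<noteq> 0" for v
      by (intro exI[of _ 0]) (simp add: o'_def)
    show "\<exists>j\<le>d. \<exists>i<j. coords_of (\<lambda>_. o') (\<lambda>_. o') (\<lambda>_. o1) (Line_Coord e i j) \<noteq> 0" for e
      using assms(2) by (intro exI[of _ 1] conjI exI[of _ 0]) (simp_all add: o'_def o1_def)
  qed
  have "\<exists>k l. \<forall>i\<le>d. o' i = k * o' i + l * o1 i" by (intro exI[of _ 1] exI[of _ 0]) simp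
  then have "picture_of d V E (\<lambda>_. o') (\<lambda>_. o') (\<lambda>_. o1) \<in> picture_space d V E"
    by (intro picture_of_in_picture_space[OF nd assms(1)])
  then show ?thesis by blast
qed

lemma irreducible_if_sparse:
  assumes V: "finite V" and E: "edge_set V E" and d: "0 < d"
    and sparse: "\<And>F. F \<subseteq> E \<Longrightarrow> F \<noteq> {} \<Longrightarrow> int d * nullity V F < int (card F)"
  shows "zariski_irreducible d V E (picture_space d V E :: ('v, 'v set, 'a :: alg_closed_field) configuration set)"
proof -
  obtain s t where st: "orientation V E s t" using exists_orientation[OF E] by blast
  let ?X = "picture_space d V E :: ('v, 'v set, 'a) configuration set"
  have "?X \<subseteq> A \<or> ?X \<subseteq> B" if A: "zariski_closed d V E A" and B: "zariski_closed d V E B" and AB: "?X \<subseteq> A \<union> B" for A B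
  proof -
    note whole = closed_contains_picture_space[OF V st sparse]
    \<comment> \<open>The disjunction holds for all pairs of pictures without collapsed edges, so
      one of the two closed sets contains every such picture.\<close>
    consider "\<And>P. P \<in> ?X \<Longrightarrow> collapsed s t E P = {} \<Longrightarrow> P \<in> A" |
      "\<And>P. P \<in> ?X \<Longrightarrow> collapsed s t E P = {} \<Longrightarrow> P \<in> B"
      using generic_pictures_irreducible[OF V st A B AB] by blast
    then show ?thesis using whole[OF _ _ A] whole[OF _ _ B] by cases blast+
  qed
  then show ?thesis
    using picture_space_nonempty[OF E d] unfolding zariski_irreducible_def by blast
qed

section \<open>Comparison of the two minima\<close>

lemma reducible_iff_ears:
  assumes V: "finite V" and E: "edge_set V E" and d: "0 < d"
  shows "\<not> zariski_irreducible d V E (picture_space d V E :: ('v, 'v set, 'a :: alg_closed_field) configuration set)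
    \<longleftrightarrow> (\<exists>Cs. 1 \<le> length Cs \<and> partial_ear_decomposition V E Cs \<and> (\<Sum>C\<leftarrow>Cs. card C) \<le> d * length Cs)"
proof -
  have "\<not> zariski_irreducible d V E (picture_space d V E :: ('v, 'v set, 'a) configuration set)
    \<longleftrightarrow> (\<exists>F\<subseteq>E. F \<noteq> {} \<and> int (card F) \<le> int d * nullity V F)" (is "?L \<longleftrightarrow> ?R")
  proof
    show ?R if ?L using that irreducible_if_sparse[OF V E d] not_le by metis
    show ?L if ?R by (rule reducible_if_dense[OF V E d that])
  qed
  then show ?thesis using dense_iff_ears[OF V E d] by blast
qed

text \<open>The last edge of a cycle joins vertices that stay linked without it, so putting it back
  raises the nullity. This is what provides an ear decomposition at all.\<close>

lemma nullity_pos_if_cyclic: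
  assumes V: "finite V" and E: "edge_set V E" and cyc: "\<not> acyclic_graph (graph_of V E)"
  shows "0 < nullity V E"
proof -
  obtain n x e where c: "cycle_through (graph_of V E) n x e"
    using cyc by (auto simp: acyclic_graph_def is_cycle_def)
  then have n: "1 \<le> n" and e: "inj_on e {..<n}" "e ` {..<n} \<subseteq> E"
    and ends: "\<And>i. i < n \<Longrightarrow> e i = {x i, x (Suc i mod n)}"
    by (auto simp: cycle_through_def graph_of_def)
  let ?f = "e (n - 1)"
  have "?f \<in> e ` {..<n}" using n by simp
  then have f: "?f \<in> E" "?f = {x (n - 1), x 0}" using e(2) n ends[of "n - 1"] by (blast, simp)
  have others: "e i \<in> E - {?f}" if "i < n - 1" for i
  proof -
    have mem: "i \<in> {..<n}" "n - 1 \<in> {..<n}" using that by auto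
    then have "e i \<noteq> ?f" using inj_on_eq_iff[OF e(1) mem] that by simp
    then show ?thesis using e(2) mem(1) by blast
  qed
  have path: "(x 0, x i) \<in> reach (E - {?f})" if "i \<le> n - 1" for i
    using that
  proof (induction i)
    case (Suc i)
    then have "(x i, x (Suc i)) \<in> reach (E - {?f})"
      using others[of i] ends[of i] by (intro reach_edge) simp
    then show ?case using Suc reach_trans by force
  qed simp
  have "(x (n - 1), x 0) \<in> reach (E - {?f})" by (rule reach_sym[OF path]) simp
  then have "nullity V (insert {x (n - 1), x 0} (E - {?f})) = nullity V (E - {?f}) + 1"
    using f(2) edge_set_finite[OF E V] by (intro nullity_insert_reachable) auto
  moreover have "insert {x (n - 1), x 0} (E - {?f}) = E" using f by auto
  moreover have "nullity V {} \<le> nullity V (E - {?f})"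
    by (rule nullity_mono[OF V edge_set_subset[OF E]]) auto
  ultimately show ?thesis by (simp add: nullity_empty)
qed

lemma ceiling_average_le_iff:
  assumes "1 \<le> length Cs"
  shows "nat \<lceil>real (\<Sum>C\<leftarrow>Cs. card C) / real (length Cs)\<rceil> \<le> d \<longleftrightarrow> (\<Sum>C\<leftarrow>Cs. card C) \<le> d * length Cs"
proof -
  have "nat \<lceil>real (\<Sum>C\<leftarrow>Cs. card C) / real (length Cs)\<rceil> \<le> d \<longleftrightarrow>
      real (\<Sum>C\<leftarrow>Cs. card C) / real (length Cs) \<le> real d"
    by (simp add: nat_le_iff ceiling_le_iff)
  also have "\<dots> \<longleftrightarrow> real (\<Sum>C\<leftarrow>Cs. card C) \<le> real (d * length Cs)"
    using assms by (simp add: divide_le_eq)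
  finally show ?thesis by (simp only: of_nat_le_iff)
qed

text \<open>As \<open>0 \<notin> M\<close>, the minimum of \<open>M\<close> itself satisfies the
  restriction \<open>0 < d\<close>.\<close>

lemma Inf_enat_upward_closure:
  assumes "finite M" "M \<noteq> {}" "0 \<notin> M"
  shows "Inf {enat d |d. 0 < d \<and> (\<exists>k\<in>M. k \<le> d)} = enat (Min M)"
proof (rule antisym)
  have "Min M \<in> M" by (rule Min_in[OF assms(1,2)])
  moreover from this have "0 < Min M" using assms(3) by (metis gr0I)
  ultimately show "Inf {enat d |d. 0 < d \<and> (\<exists>k\<in>M. k \<le> d)} \<le> enat (Min M)"
    by (intro Inf_lower) blast
  show "enat (Min M) \<le> Inf {enat d |d. 0 < d \<and> (\<exists>k\<in>M. k \<le> d)}"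
    by (intro Inf_greatest) (auto intro: order_trans[OF Min_le[OF assms(1)]])
qed

theorem proposition3p2:
  fixes V :: "'v set" and E :: "'v set set"
  assumes "simple_graph V E"
    and "connected_graph (graph_of V E)"
    and "\<not> acyclic_graph (graph_of V E)"
  shows "mcd TYPE('a::alg_closed_field) V E =
    enat (Min {nat \<lceil>real (\<Sum>C\<leftarrow>Cs. card C) / real (length Cs)\<rceil> |Cs.
      1 \<le> length Cs \<and> partial_ear_decomposition V E Cs})"
proof -
  let ?a = "\<lambda>Cs :: 'v set set list. nat \<lceil>real (\<Sum>C\<leftarrow>Cs. card C) / real (length Cs)\<rceil>"
  let ?M = "{?a Cs |Cs. 1 \<le> length Cs \<and> partial_ear_decomposition V E Cs}"
  have V: "finite V" using assms(1) by (simp add: simple_graph_def)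
  have E: "edge_set V E" by (rule simple_graph_edge_set[OF assms(1)])
  have finE: "finite E" by (rule edge_set_finite[OF E V])
  \<comment> \<open>The upper bound on the values, instead of a count of the decompositions, makes
    the set under \<open>Min\<close> finite; positivity matches \<open>0 < d\<close> in
    \<open>mcd\<close>.\<close>
  have bounds: "?a Cs \<le> card E \<and> 0 < ?a Cs" if Cs: "1 \<le> length Cs" "partial_ear_decomposition V E Cs" for Cs
  proof
    have props: "\<Union> (set Cs) \<subseteq> E" "nullity V (\<Union> (set Cs)) = int (length Cs)"
      "card (\<Union> (set Cs)) = (\<Sum>C\<leftarrow>Cs. card C)"
      using ear_sequence_props[OF V E, of "{}" Cs] Cs(2) partial_ear_decomposition_iff[OF V E, of Cs]
      by (simp_all add: nullity_empty)
    have "(\<Sum>C\<leftarrow>Cs. card C) \<le> card E" using card_mono[OF finE props(1)] props(3) by simp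
    also have "\<dots> \<le> card E * length Cs" using Cs(1) by simp
    finally show "?a Cs \<le> card E" using ceiling_average_le_iff[OF Cs(1)] by blast
    have "\<Union> (set Cs) \<noteq> {}" using props(2) Cs(1) nullity_empty[of V] by fastforce
    then have "0 < (\<Sum>C\<leftarrow>Cs. card C)"
      using props(1,3) finE by (metis card_gt_0_iff finite_subset)
    then have "\<not> (\<Sum>C\<leftarrow>Cs. card C) \<le> 0 * length Cs" by (simp only: mult_0 not_le)
    then have "\<not> ?a Cs \<le> 0" using ceiling_average_le_iff[OF Cs(1)] by blast
    then show "0 < ?a Cs" by (simp only: not_le)
  qed
  have zero: "0 \<notin> ?M"
  proof
    assume "0 \<in> ?M"
    then obtain Cs where Cs: "0 = ?a Cs" "1 \<le> length Cs" "partial_ear_decomposition V E Cs" by blast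
    then show False using bounds[OF Cs(2,3)] by (metis less_irrefl)
  qed
  have fin: "finite ?M" by (rule finite_subset[of _ "{..card E}"]) (use bounds in auto)
  have red: "\<not> zariski_irreducible d V E (picture_space d V E :: ('v, 'v set, 'a) configuration set)
      \<longleftrightarrow> (\<exists>k\<in>?M. k \<le> d)" if "0 < d" for d
    unfolding reducible_iff_ears[OF V E that] using ceiling_average_le_iff by blast
  have ne: "?M \<noteq> {}"
  proof -
    have pos: "0 < nullity V E" by (rule nullity_pos_if_cyclic[OF V E assms(3)])
    then have "E \<noteq> {}" by (auto simp: nullity_empty)
    then have d: "0 < card E" using finE by (simp add: card_gt_0_iff)
    \<comment> \<open>The whole edge set is dense for \<open>d = card E\<close>, since its nullity
      is at least 1.\<close>
    have "int (card E) * 1 \<le> int (card E) * nullity V E" using pos by (intro mult_left_mono) auto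
    then have "\<exists>F\<subseteq>E. F \<noteq> {} \<and> int (card F) \<le> int (card E) * nullity V F"
      using \<open>E \<noteq> {}\<close> by (intro exI[of _ E]) simp
    then show ?thesis using dense_iff_ears[OF V E d] by blast
  qed
  have "mcd TYPE('a) V E = Inf {enat d |d. 0 < d \<and> (\<exists>k\<in>?M. k \<le> d)}"
    unfolding mcd_def using red by (intro arg_cong[of _ _ Inf] Collect_cong) blast
  also have "\<dots> = enat (Min ?M)"
    by (rule Inf_enat_upward_closure[OF fin ne zero])
  finally show ?thesis .
qed

end
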